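(* Let $k\in\mathbb{N}$, $F\in\mathcal{H}_k$ with $e(F)>0$, and let $\mathcal{R}$ be the $F$-removal rule. Then the map $U\mapsto\mathrm{dest}_{\mathcal{R}}(U)$ is continuous as a map from $(\mathcal{W}_0,d_\square)$ to itself.
   Context: Let $(\Omega,\pi)$ be an atomless probability space with separable $\sigma$-algebra. A kernel is a bounded symmetric measurable $W:\Omega^2\to\mathbb{R}$ (up to a.e. equality); $\mathcal{W}$ is the Banach space of kernels with $\|\cdot\|_\infty$; graphons are kernels with values in $[0,1]$; $\mathcal{W}_0$ is the set of graphons; $d_\square(U,W)=\sup_{S,T\subseteq\Omega}|\int_{S\times T}(U-W)\,d\pi^2|$. $\mathcal{H}_k$ is the set of graphs on $[k]$. A rule of order $k$ is a matrix $\mathcal{R}\in[0,1]^{\mathcal{H}_k\times\mathcal{H}_k}$ with row sums $1$. For a kernel $W$, $G\in\mathcal{H}_k$, distinct $a,b$, $x,y$: $t^{x,y}_{\mathrm{ind}}(G^{a,b},W)=\int\prod_{ij\in E(G)}W(x_i,x_j)\prod_{ij\notin E(G)}(1-W(x_i,x_j))\prod_{i\ne a,b}d\pi(x_i)$ with $x_a=x,x_b=y$. Velocity: $\mathfrak{V}_{\mathcal{R}}W(x,y)=\sum_{G,H}\sum_{a\ne b}\mathcal{R}_{G,H}t^{x,y}_{\mathrm{ind}}(G^{a,b},W)(\mathbb{1}[ab\in E(H)\setminus E(G)]-\mathbb{1}[ab\in E(G)\setminus E(H)])$. For a graphon $W$, the trajectory $t\mapsto\Phi^tW$, $t\ge0$,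 is the unique solution of $\frac{d}{dt}\Phi^tW=\mathfrak{V}_{\mathcal{R}}(\Phi^tW)$ in $(\mathcal{W},\|\cdot\|_\infty)$ with $\Phi^0W=W$; $\mathrm{dest}_{\mathcal{R}}(W)$ is the graphon $S$ with $d_\square(\Phi^tW,S)\to0$ as $t\to\infty$ (it exists for removal rules). The $F$-removal rule of order $k$: $\mathcal{R}_{H,H-F}=1$ for every $H\in\mathcal{H}_k$ containing $F$ as a labelled subgraph (where $H-F$ is $H$ with the edges of $F$ deleted), and $\mathcal{R}_{H,H}=1$ for every $H$ not containing $F$ as a labelled subgraph; all other entries are $0$. *)

theory Defs
  imports "HOL-Probability.Probability"
begin

definition atomless :: "'a measure \<Rightarrow> bool" where
  "atomless M \<longleftrightarrow> (\<forall>A\<in>sets M. 0 < measure M A \<longrightarrow>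
     (\<exists>B\<in>sets M. B \<subseteq> A \<and> 0 < measure M B \<and> measure M B < measure M A))"

text \<open>Separability of the \<open>\<sigma>\<close>-algebra under the pseudometric \<open>\<pi>(A \<triangle> B)\<close>; every countably
  generated \<open>\<sigma>\<close>-algebra is separable in this sense.\<close>

definition separable_sigma_algebra :: "'a measure \<Rightarrow> bool" where
  "separable_sigma_algebra M \<longleftrightarrow> (\<exists>\<D>. countable \<D> \<and> \<D> \<subseteq> sets M \<and>
     (\<forall>A\<in>sets M. \<forall>e>0. \<exists>B\<in>\<D>. measure M (sym_diff A B) < e))"

definition kernel_fun :: "'a measure \<Rightarrow> ('a \<times> 'a \<Rightarrow> real) \<Rightarrow> bool" where
  "kernel_fun M W \<longleftrightarrow> W \<in> borel_measurable (M \<Otimes>\<^sub>M M) \<and>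
     (\<exists>B. \<forall>p\<in>space (M \<Otimes>\<^sub>M M). \<bar>W p\<bar> \<le> B) \<and>
     (\<forall>x\<in>space M. \<forall>y\<in>space M. W (x, y) = W (y, x))"

definition ae_rel :: "'a measure \<Rightarrow> (('a \<times> 'a \<Rightarrow> real) \<times> ('a \<times> 'a \<Rightarrow> real)) set" where
  "ae_rel M = {(U, W). kernel_fun M U \<and> kernel_fun M W \<and> (AE p in M \<Otimes>\<^sub>M M. U p = W p)}"

type_synonym 'a kernel = "('a \<times> 'a \<Rightarrow> real) set"

definition kernel_class :: "'a measure \<Rightarrow> ('a \<times> 'a \<Rightarrow> real) \<Rightarrow> 'a kernel" where
  "kernel_class M W = ae_rel M `` {W}"

definition kernels :: "'a measure \<Rightarrow> 'a kernel set" where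
  "kernels M = {W. kernel_fun M W} // ae_rel M"

definition rep :: "'a kernel \<Rightarrow> 'a \<times> 'a \<Rightarrow> real" where
  "rep X = (SOME W. W \<in> X)"

definition graphons :: "'a measure \<Rightarrow> 'a kernel set" where
  "graphons M = {X \<in> kernels M. AE p in M \<Otimes>\<^sub>M M. rep X p \<in> {0..1}}"

definition linf_norm :: "'a measure \<Rightarrow> ('a \<times> 'a \<Rightarrow> real) \<Rightarrow> ereal" where
  "linf_norm M f = esssup (M \<Otimes>\<^sub>M M) (\<lambda>p. ereal \<bar>f p\<bar>)"

definition cut_dist :: "'a measure \<Rightarrow> 'a kernel \<Rightarrow> 'a kernel \<Rightarrow> real" where
  "cut_dist M X Y = (SUP (S, T) \<in> sets M \<times> sets M.
     \<bar>LINT p:S \<times> T|M \<Otimes>\<^sub>M M. (rep X p - rep Y p)\<bar>)"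

text \<open>The locale \<open>Metric_space\<close> asks for a distance that is nonnegative on the whole
  type, which a real supremum need not be when it is unbounded. Hence the truncation to \<open>0\<close>
  outside the carrier, which does not affect the topology.\<close>

definition graphon_dist :: "'a measure \<Rightarrow> 'a kernel \<Rightarrow> 'a kernel \<Rightarrow> real" where
  "graphon_dist M X Y = (if X \<in> graphons M \<and> Y \<in> graphons M then cut_dist M X Y else 0)"

definition cut_topology :: "'a measure \<Rightarrow> 'a kernel topology" where
  "cut_topology M = Metric_space.mtopology (graphons M) (graphon_dist M)"

text \<open>A graph on \<open>{1..k}\<close> is given by its set of edges.\<close>

type_synonym graph = "nat set set"

definition graphs :: "nat \<Rightarrow> graph set" where
  "graphs k = Pow {{i, j} | i j. i \<in> {1..k} \<and> j \<in> {1..k} \<and> i \<noteq> j}"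

type_synonym flip_rule = "graph \<Rightarrow> graph \<Rightarrow> real"

definition is_rule :: "nat \<Rightarrow> flip_rule \<Rightarrow> bool" where
  "is_rule k R \<longleftrightarrow> (\<forall>G\<in>graphs k. (\<forall>H\<in>graphs k. R G H \<in> {0..1}) \<and> (\<Sum>H\<in>graphs k. R G H) = 1)"

definition removal_rule :: "graph \<Rightarrow> flip_rule" where
  "removal_rule F H H' = (if H' = (if F \<subseteq> H then H - F else H) then 1 else 0)"

definition t_ind ::
  "'a measure \<Rightarrow> nat \<Rightarrow> graph \<Rightarrow> nat \<Rightarrow> nat \<Rightarrow> ('a \<times> 'a \<Rightarrow> real) \<Rightarrow> 'a \<Rightarrow> 'a \<Rightarrow> real" where
  "t_ind M k G a b W x y =
     (LINT z|Pi\<^sub>M ({1..k} - {a, b}) (\<lambda>_. M).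
        (let u = z(a := x, b := y) in
        \<Prod>(i, j)\<in>{(i, j). i \<in> {1..k} \<and> j \<in> {1..k} \<and> i < j}.
          if {i, j} \<in> G then W (u i, u j) else 1 - W (u i, u j)))"

definition velocity_fun ::
  "'a measure \<Rightarrow> nat \<Rightarrow> flip_rule \<Rightarrow> ('a \<times> 'a \<Rightarrow> real) \<Rightarrow> 'a \<times> 'a \<Rightarrow> real" where
  "velocity_fun M k R W = (\<lambda>(x, y).
     \<Sum>G\<in>graphs k. \<Sum>H\<in>graphs k. \<Sum>(a, b)\<in>{(a, b). a \<in> {1..k} \<and> b \<in> {1..k} \<and> a \<noteq> b}.
       R G H * t_ind M k G a b W x y *
       (of_bool ({a, b} \<in> H - G) - of_bool ({a, b} \<in> G - H)))"

definition velocity :: "'a measure \<Rightarrow> nat \<Rightarrow> flip_rule \<Rightarrow> 'a kernel \<Rightarrow> 'a kernel" where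
  "velocity M k R X = kernel_class M (velocity_fun M k R (rep X))"

text \<open>The derivative in the norm \<open>\<parallel>\<cdot>\<parallel>\<^sub>\<infinity>\<close> of a curve defined on \<open>[0, \<infinity>)\<close>; it is one-sided at \<open>0\<close>.\<close>

definition has_linf_derivative ::
  "'a measure \<Rightarrow> (real \<Rightarrow> 'a kernel) \<Rightarrow> 'a kernel \<Rightarrow> real \<Rightarrow> bool" where
  "has_linf_derivative M \<phi> D t \<longleftrightarrow>
     ((\<lambda>s. linf_norm M (\<lambda>p. (rep (\<phi> s) p - rep (\<phi> t) p) / (s - t) - rep D p))
        \<longlongrightarrow> 0) (at t within {0..})"

definition is_trajectory ::
  "'a measure \<Rightarrow> nat \<Rightarrow> flip_rule \<Rightarrow> 'a kernel \<Rightarrow> (real \<Rightarrow> 'a kernel) \<Rightarrow> bool" where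
  "is_trajectory M k R X \<phi> \<longleftrightarrow> \<phi> 0 = X \<and>
     (\<forall>t\<ge>0. \<phi> t \<in> kernels M \<and> has_linf_derivative M \<phi> (velocity M k R (\<phi> t)) t)"

text \<open>Trajectories are unique only as functions on \<open>[0, \<infinity>)\<close>, so the description operator is
  applied to the value at time \<open>t\<close>.\<close>

definition flow :: "'a measure \<Rightarrow> nat \<Rightarrow> flip_rule \<Rightarrow> real \<Rightarrow> 'a kernel \<Rightarrow> 'a kernel" where
  "flow M k R t X = (THE Y. \<exists>\<phi>. is_trajectory M k R X \<phi> \<and> \<phi> t = Y)"

definition dest :: "'a measure \<Rightarrow> nat \<Rightarrow> flip_rule \<Rightarrow> 'a kernel \<Rightarrow> 'a kernel" where
  "dest M k R X = (THE S. S \<in> graphons M \<and> ((\<lambda>t. cut_dist M (flow M k R t X) S) \<longlongrightarrow> 0) at_top)"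

lemma finite_graphs: "finite (graphs k)"
proof -
  have "{{i, j} | i j. i \<in> {1..k} \<and> j \<in> {1..k} \<and> i \<noteq> j} \<subseteq> Pow {1..k}" by auto
  then show ?thesis unfolding graphs_def by (meson finite_Pow_iff finite_atLeastAtMost finite_subset)
qed

lemma is_rule_removal_rule: "is_rule k (removal_rule F)"
proof -
  have "(if F \<subseteq> H then H - F else H) \<in> graphs k" if "H \<in> graphs k" for H
    using that by (auto simp: graphs_def)
  then show ?thesis
    unfolding is_rule_def removal_rule_def by (auto simp: finite_graphs)
qed

lemma equiv_ae_rel: "equiv {W. kernel_fun M W} (ae_rel M)"
proof (rule equivI)
  show "ae_rel M \<subseteq> {W. kernel_fun M W} \<times> {W. kernel_fun M W}" by (auto simp: ae_rel_def)
  show "refl_on {W. kernel_fun M W} (ae_rel M)" by (auto simp: ae_rel_def refl_on_def)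
  show "sym (ae_rel M)" by (auto simp: ae_rel_def sym_def)
  show "trans (ae_rel M)" by (auto simp: ae_rel_def trans_def)
qed

lemma kernel_class_in_kernels: "kernel_fun M W \<Longrightarrow> kernel_class M W \<in> kernels M"
  unfolding kernel_class_def kernels_def by (simp add: quotientI)

lemma rep_in: "X \<in> kernels M \<Longrightarrow> rep X \<in> X"
  unfolding rep_def kernels_def
  by (metis in_quotient_imp_non_empty equiv_ae_rel some_in_eq)

lemma kernel_fun_rep: "X \<in> kernels M \<Longrightarrow> kernel_fun M (rep X)"
  using rep_in[of X M] in_quotient_imp_subset[OF equiv_ae_rel, of X M] by (auto simp: kernels_def)

lemma kernel_class_rep: "X \<in> kernels M \<Longrightarrow> kernel_class M (rep X) = X"
  using rep_in[of X M] unfolding kernel_class_def kernels_def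
  by (metis Image_singleton_iff equiv_ae_rel equiv_class_eq quotientE)

lemma rep_kernel_class: "kernel_fun M W \<Longrightarrow> AE p in M \<Otimes>\<^sub>M M. rep (kernel_class M W) p = W p"
  using rep_in[OF kernel_class_in_kernels, of M W]
  by (auto simp: kernel_class_def ae_rel_def elim!: eventually_mono)

lemma kernels_eqI:
  assumes "X \<in> kernels M" "Y \<in> kernels M" "AE p in M \<Otimes>\<^sub>M M. rep X p = rep Y p"
  shows "X = Y"
proof -
  have "(rep X, rep Y) \<in> ae_rel M"
    using assms kernel_fun_rep by (auto simp: ae_rel_def)
  then have "kernel_class M (rep X) = kernel_class M (rep Y)"
    unfolding kernel_class_def by (rule equiv_class_eq[OF equiv_ae_rel])
  then show ?thesis using assms by (simp add: kernel_class_rep)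
qed

context prob_space
begin

lemma prob_space_square: "prob_space (M \<Otimes>\<^sub>M M)"
proof -
  interpret pair_prob_space M M by unfold_locales
  show ?thesis by (rule P.prob_space_axioms)
qed

lemma integrable_kernel: "kernel_fun M W \<Longrightarrow> integrable (M \<Otimes>\<^sub>M M) W"
proof -
  assume W: "kernel_fun M W"
  interpret S: prob_space "M \<Otimes>\<^sub>M M" by (rule prob_space_square)
  from W obtain B where "\<forall>p\<in>space (M \<Otimes>\<^sub>M M). \<bar>W p\<bar> \<le> B" "W \<in> borel_measurable (M \<Otimes>\<^sub>M M)"
    by (auto simp: kernel_fun_def)
  then show ?thesis by (intro S.integrable_const_bound[of _ B]) auto
qed

lemma set_integrable_rep_diff:
  assumes "X \<in> kernels M" "Y \<in> kernels M" "S \<in> sets M" "T \<in> sets M"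
  shows "set_integrable (M \<Otimes>\<^sub>M M) (S \<times> T) (\<lambda>p. rep X p - rep Y p)"
  unfolding set_integrable_def
  using assms by (intro integrable_mult_indicator Bochner_Integration.integrable_diff
      integrable_kernel kernel_fun_rep) auto

lemma bdd_above_cut_dist:
  assumes "X \<in> kernels M" "Y \<in> kernels M"
  shows "bdd_above ((\<lambda>(S, T). \<bar>LINT p:S \<times> T|M \<Otimes>\<^sub>M M. (rep X p - rep Y p)\<bar>) ` (sets M \<times> sets M))"
proof (rule bdd_aboveI2, clarify)
  fix S T assume ST: "S \<in> sets M" "T \<in> sets M"
  have i: "integrable (M \<Otimes>\<^sub>M M) (\<lambda>p. rep X p - rep Y p)"
    using assms by (intro Bochner_Integration.integrable_diff integrable_kernel kernel_fun_rep)
  have "\<bar>LINT p:S \<times> T|M \<Otimes>\<^sub>M M. (rep X p - rep Y p)\<bar>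
      \<le> (LINT p|(M \<Otimes>\<^sub>M M). \<bar>indicator (S \<times> T) p *\<^sub>R (rep X p - rep Y p)\<bar>)"
    unfolding set_lebesgue_integral_def by (rule integral_abs_bound)
  also have "\<dots> \<le> (LINT p|(M \<Otimes>\<^sub>M M). \<bar>rep X p - rep Y p\<bar>)"
    using set_integrable_rep_diff[OF assms ST] i unfolding set_integrable_def
    by (intro integral_mono integrable_abs) (auto simp: indicator_def)
  finally show "\<bar>LINT p:S \<times> T|M \<Otimes>\<^sub>M M. (rep X p - rep Y p)\<bar>
      \<le> (LINT p|(M \<Otimes>\<^sub>M M). \<bar>rep X p - rep Y p\<bar>)" .
qed

lemma cut_dist_upper:
  assumes "X \<in> kernels M" "Y \<in> kernels M" "S \<in> sets M" "T \<in> sets M"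
  shows "\<bar>LINT p:S \<times> T|M \<Otimes>\<^sub>M M. (rep X p - rep Y p)\<bar> \<le> cut_dist M X Y"
  unfolding cut_dist_def
  using cSUP_upper[OF _ bdd_above_cut_dist[OF assms(1,2)], of "(S, T)"] assms by auto

lemma cut_dist_least:
  assumes "\<And>S T. S \<in> sets M \<Longrightarrow> T \<in> sets M \<Longrightarrow>
    \<bar>LINT p:S \<times> T|M \<Otimes>\<^sub>M M. (rep X p - rep Y p)\<bar> \<le> c"
  shows "cut_dist M X Y \<le> c"
  unfolding cut_dist_def using assms by (intro cSUP_least) auto

lemma AE_eq_0_of_rectangles:
  fixes f :: "'a \<times> 'a \<Rightarrow> real"
  assumes f[measurable]: "f \<in> borel_measurable (M \<Otimes>\<^sub>M M)"
    and B: "\<And>p. p \<in> space (M \<Otimes>\<^sub>M M) \<Longrightarrow> \<bar>f p\<bar> \<le> B"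
    and z: "\<And>S T. S \<in> sets M \<Longrightarrow> T \<in> sets M \<Longrightarrow> (LINT p:S \<times> T|M \<Otimes>\<^sub>M M. f p) = 0"
  shows "AE p in M \<Otimes>\<^sub>M M. f p = 0"
proof -
  let ?N = "M \<Otimes>\<^sub>M M"
  interpret S: prob_space ?N by (rule prob_space_square)
  have intf: "integrable ?N f" using B by (intro S.integrable_const_bound[of _ B]) auto
  obtain p0 where "p0 \<in> space ?N" using S.not_empty by blast
  then have B0: "0 \<le> B" using B[of p0] by linarith
  let ?\<mu> = "density ?N (\<lambda>p. ennreal (f p + B))" and ?\<nu> = "density ?N (\<lambda>p. ennreal B)"
  let ?E = "{S \<times> T | S T. S \<in> sets M \<and> T \<in> sets M}"
  have "?\<mu> = ?\<nu>"
  proof (rule measure_eqI_generator_eq[where E = ?E and \<Omega> = "space ?N" and A = "\<lambda>_. space ?N"])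
    show "Int_stable ?E" by (rule Int_stable_pair_measure_generator)
    show "?E \<subseteq> Pow (space ?N)"
      using sets.sets_into_space by (fastforce simp: space_pair_measure)
    show "sets ?\<mu> = sigma_sets (space ?N) ?E" "sets ?\<nu> = sigma_sets (space ?N) ?E"
      by (simp_all add: sets_pair_measure space_pair_measure)
    show "range (\<lambda>_::nat. space ?N) \<subseteq> ?E" by (auto simp: space_pair_measure)
    show "(\<Union>i::nat. space ?N) = space ?N" by simp
    have "emeasure ?\<mu> (space ?N) =
        (\<integral>\<^sup>+p. ennreal (f p + B) * indicator (space ?N) p \<partial>?N)"
      by (rule emeasure_density) auto
    also have "\<dots> \<le> (\<integral>\<^sup>+p. ennreal (2 * B) \<partial>?N)"
    proof (rule nn_integral_mono)
      fix p assume p: "p \<in> space ?N"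
      have "f p + B \<le> 2 * B" using B[OF p] by linarith
      then show "ennreal (f p + B) * indicator (space ?N) p \<le> ennreal (2 * B)"
        using p by (simp add: ennreal_leI)
    qed
    also have "\<dots> < \<infinity>" by (simp add: S.emeasure_space_1 ennreal_mult_less_top)
    finally show "emeasure ?\<mu> (space ?N) \<noteq> \<infinity>" for i :: nat by simp
  next
    fix X assume "X \<in> ?E"
    then obtain S T where X: "X = S \<times> T" and ST[measurable]: "S \<in> sets M" "T \<in> sets M" by auto
    have Xm[measurable]: "X \<in> sets ?N" unfolding X by simp
    have i1: "integrable ?N (\<lambda>p. indicator X p * f p)" "integrable ?N (\<lambda>p. indicator X p * B)"
      using integrable_mult_indicator[OF Xm intf] integrable_mult_indicator[OF Xm, of "\<lambda>_. B"]
      by (auto)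
    have nn: "0 \<le> f p + B" if "p \<in> space ?N" for p using B[OF that] by linarith
    have "emeasure ?\<mu> X = (\<integral>\<^sup>+p. ennreal (indicator X p * f p + indicator X p * B) \<partial>?N)"
      by (subst emeasure_density) (auto intro!: nn_integral_cong simp: indicator_def)
    also have "\<dots> = ennreal (LINT p|?N. (indicator X p * f p + indicator X p * B))"
      using nn i1 by (intro nn_integral_eq_integral AE_I2) (auto simp: indicator_def)
    also have "(LINT p|?N. (indicator X p * f p + indicator X p * B)) =
        (LINT p|?N. (indicator X p * B))"
      using z[OF ST] i1 by (simp add: X set_lebesgue_integral_def)
    also have "ennreal \<dots> = (\<integral>\<^sup>+p. ennreal (indicator X p * B) \<partial>?N)"
      using i1 B0 by (intro nn_integral_eq_integral[symmetric] AE_I2) (auto simp: indicator_def)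
    also have "\<dots> = emeasure ?\<nu> X"
      by (subst emeasure_density) (auto intro!: nn_integral_cong simp: indicator_def)
    finally show "emeasure ?\<mu> X = emeasure ?\<nu> X" .
  qed
  then have "AE p in ?N. ennreal (f p + B) = ennreal B"
    by (subst (asm) S.density_unique_iff) auto
  moreover have "AE p in ?N. 0 \<le> f p + B"
  proof (rule AE_I2)
    show "0 \<le> f p + B" if "p \<in> space ?N" for p using B[OF that] by linarith
  qed
  ultimately show ?thesis by eventually_elim (use B0 in simp)
qed

lemma cut_dist_nonneg:
  assumes "X \<in> kernels M" "Y \<in> kernels M"
  shows "0 \<le> cut_dist M X Y"
  using cut_dist_upper[OF assms sets.empty_sets sets.empty_sets] by linarith

lemma cut_dist_commute: "cut_dist M X Y = cut_dist M Y X"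
proof -
  have "(LINT p:A|M \<Otimes>\<^sub>M M. (rep X p - rep Y p)) = - (LINT p:A|M \<Otimes>\<^sub>M M. (rep Y p - rep X p))" for A
    unfolding set_lebesgue_integral_def
    by (simp flip: Bochner_Integration.integral_minus add: algebra_simps)
  then show ?thesis by (simp add: cut_dist_def)
qed

lemma cut_dist_triangle:
  assumes "X \<in> kernels M" "Y \<in> kernels M" "Z \<in> kernels M"
  shows "cut_dist M X Z \<le> cut_dist M X Y + cut_dist M Y Z"
proof (rule cut_dist_least)
  fix S T assume ST: "S \<in> sets M" "T \<in> sets M"
  have "(LINT p:S \<times> T|M \<Otimes>\<^sub>M M. (rep X p - rep Z p)) =
      (LINT p:S \<times> T|M \<Otimes>\<^sub>M M. ((rep X p - rep Y p) + (rep Y p - rep Z p)))" by simp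
  also have "\<dots> = (LINT p:S \<times> T|M \<Otimes>\<^sub>M M. (rep X p - rep Y p)) +
      (LINT p:S \<times> T|M \<Otimes>\<^sub>M M. (rep Y p - rep Z p))"
    using assms ST by (intro set_integral_add set_integrable_rep_diff)
  finally show "\<bar>LINT p:S \<times> T|M \<Otimes>\<^sub>M M. (rep X p - rep Z p)\<bar> \<le> cut_dist M X Y + cut_dist M Y Z"
    using cut_dist_upper[OF assms(1,2) ST] cut_dist_upper[OF assms(2,3) ST] by linarith
qed

lemma cut_dist_eq_0_iff:
  assumes "X \<in> kernels M" "Y \<in> kernels M"
  shows "cut_dist M X Y = 0 \<longleftrightarrow> X = Y"
proof
  assume 0: "cut_dist M X Y = 0"
  from assms have k: "kernel_fun M (rep X)" "kernel_fun M (rep Y)" by (auto intro: kernel_fun_rep)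
  then obtain B C where BC: "\<And>p. p \<in> space (M \<Otimes>\<^sub>M M) \<Longrightarrow> \<bar>rep X p\<bar> \<le> B"
    "\<And>p. p \<in> space (M \<Otimes>\<^sub>M M) \<Longrightarrow> \<bar>rep Y p\<bar> \<le> C"
    unfolding kernel_fun_def by metis
  have "AE p in M \<Otimes>\<^sub>M M. rep X p - rep Y p = 0"
  proof (rule AE_eq_0_of_rectangles)
    show "(\<lambda>p. rep X p - rep Y p) \<in> borel_measurable (M \<Otimes>\<^sub>M M)"
      using k by (intro borel_measurable_diff) (auto simp: kernel_fun_def)
    show "\<bar>rep X p - rep Y p\<bar> \<le> B + C" if "p \<in> space (M \<Otimes>\<^sub>M M)" for p
      using BC[OF that] by linarith
    show "(LINT p:S \<times> T|M \<Otimes>\<^sub>M M. (rep X p - rep Y p)) = 0" if "S \<in> sets M" "T \<in> sets M" for S T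
      using cut_dist_upper[OF assms that] 0 by linarith
  qed
  then show "X = Y" using assms by (intro kernels_eqI) auto
next
  assume "X = Y"
  then have "cut_dist M X Y \<le> 0"
    by (intro cut_dist_least) (simp add: set_lebesgue_integral_def)
  then show "cut_dist M X Y = 0" using cut_dist_nonneg[OF assms] by linarith
qed

lemma Metric_space_graphons: "Metric_space (graphons M) (graphon_dist M)"
proof
  have k: "X \<in> kernels M" if "X \<in> graphons M" for X using that by (simp add: graphons_def)
  fix X Y Z
  show "0 \<le> graphon_dist M X Y" "graphon_dist M X Y = graphon_dist M Y X"
    by (auto simp: graphon_dist_def k cut_dist_nonneg cut_dist_commute)
  show "graphon_dist M X Y = 0 \<longleftrightarrow> X = Y" if "X \<in> graphons M" "Y \<in> graphons M"
    using that by (simp add: graphon_dist_def k cut_dist_eq_0_iff)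
  show "graphon_dist M X Z \<le> graphon_dist M X Y + graphon_dist M Y Z"
    if "X \<in> graphons M" "Y \<in> graphons M" "Z \<in> graphons M"
    using that by (simp add: graphon_dist_def k cut_dist_triangle)
qed

lemma topspace_cut_topology: "topspace (cut_topology M) = graphons M"
  unfolding cut_topology_def by (rule Metric_space.topspace_mtopology[OF Metric_space_graphons])

end

end

theory Submission
  imports Defs
begin

text \<open>
  For the removal rule the terms of the velocity sum up to \<open>- \<Sum> t(F\<^sup>a\<^sup>b, W)\<close>, which equals
  \<open>- W * r(W)\<close> with \<open>r(W) \<ge> 0\<close>. Hence trajectories of graphons decrease pointwise, and their
  destination is the pointwise limit. By the counting lemma the velocity is Lipschitz in the cut
  norm, so every map \<open>\<Phi>\<^sup>t\<close> is continuous in the cut distance; it remains to control the loss after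
  time \<open>t\<close>. Let \<open>V\<close> be the destination of \<open>U\<close> and \<open>B = {V = 0}\<close>. As \<open>V\<close> has \<open>F\<close>-density zero, almost
  every copy of \<open>F\<close> uses a pair from \<open>B\<close>, so along any trajectory the total loss is at most a constant
  times the loss on \<open>B\<close>. If \<open>W\<close> is close to \<open>U\<close>, then \<open>\<Phi>\<^sup>tW\<close> is close to \<open>V\<close> in the cut distance for
  some large \<open>t\<close>, so that \<open>\<Phi>\<^sup>tW\<close> has little mass on \<open>B\<close> (approximate \<open>B\<close> by rectangles), and its
  destination is close to \<open>\<Phi>\<^sup>tW\<close> in \<open>L\<^sup>1\<close>.
\<close>

section \<open>Bounded measurable functions and the cut norm\<close>

text \<open>The stability estimate for the flow carries a factor that grows exponentially in
  \<open>t\<close>, so it does not allow continuity and the limit in \<open>t\<close> to be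
  interchanged; moreover, cut closeness does not yield \<open>L^1\<close> closeness. The way out is
  that the zero set of the destination of \<open>U\<close> is one fixed measurable set. The mass of
  another trajectory on it is a linear test, which the cut distance controls at a rate that may
  depend on the set, and this is enough for continuity at \<open>U\<close>, though it gives no
  explicit modulus.

  \<open>flow\<close> is a description that ranges over all trajectories of classes, and these are
  not known beforehand to stay in \<open>[0, 1]\<close> or even to be bounded uniformly in time.
  Uniqueness is therefore proved for general kernels, and it comes from the same cut stability, the
  cut distance being a metric on classes. Existence is proved for functions that satisfy the
  equation at every point, so that monotonicity and limits are those of real functions; classes
  return only to match the definitions.\<close>

definition bfun :: "'b measure \<Rightarrow> real \<Rightarrow> ('b \<Rightarrow> real) \<Rightarrow> bool" where
  "bfun N C f \<longleftrightarrow> f \<in> borel_measurable N \<and> (\<forall>x\<in>space N. \<bar>f x\<bar> \<le> C)"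

lemma bfun_measurable: "bfun N C f \<Longrightarrow> f \<in> borel_measurable N"
  and bfun_bound: "bfun N C f \<Longrightarrow> x \<in> space N \<Longrightarrow> \<bar>f x\<bar> \<le> C"
  by (auto simp: bfun_def)

lemma bfun_mono: "bfun N C f \<Longrightarrow> C \<le> D \<Longrightarrow> bfun N D f"
  by (force simp: bfun_def)

lemma bfun_cong: "(\<And>x. x \<in> space N \<Longrightarrow> f x = g x) \<Longrightarrow> bfun N C f \<longleftrightarrow> bfun N C g"
  by (simp add: bfun_def cong: measurable_cong)

lemma bfun_mult: "bfun N C f \<Longrightarrow> bfun N D g \<Longrightarrow> bfun N (C * D) (\<lambda>x. f x * g x)"
  by (auto simp: bfun_def abs_mult intro!: mult_mono intro: order_trans[OF abs_ge_zero])

lemma bfun_diff: "bfun N C f \<Longrightarrow> bfun N D g \<Longrightarrow> bfun N (C + D) (\<lambda>x. f x - g x)"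
  by (force simp: bfun_def)

lemma bfun_uminus: "bfun N C f \<Longrightarrow> bfun N C (\<lambda>x. - f x)"
  by (auto simp: bfun_def)

lemma bfun_indicator: "A \<in> sets N \<Longrightarrow> bfun N 1 (indicator A)"
  by (auto simp: bfun_def indicator_def)

lemma bfun_sum:
  assumes "\<And>i. i \<in> I \<Longrightarrow> bfun N C (f i)"
  shows "bfun N (real (card I) * C) (\<lambda>x. \<Sum>i\<in>I. f i x)"
  using assms unfolding bfun_def
  by (intro conjI borel_measurable_sum ballI order_trans[OF sum_abs] sum_bounded_above) auto

lemma bfun_prod:
  assumes "finite I" "\<And>i. i \<in> I \<Longrightarrow> bfun N C (f i)"
  shows "bfun N (C ^ card I) (\<lambda>x. \<Prod>i\<in>I. f i x)"
  using assms unfolding bfun_def abs_prod prod_constant[symmetric]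
  by (intro conjI borel_measurable_prod ballI prod_mono) auto

text \<open>Composition is why \<open>bfun\<close> asks for its bound everywhere: \<open>g\<close>
  may map into a null set, as the section maps \<open>\<lambda>y. (x, y)\<close> may do, and there
  an almost everywhere bound would be lost.\<close>

lemma bfun_comp: "bfun N C f \<Longrightarrow> g \<in> K \<rightarrow>\<^sub>M N \<Longrightarrow> bfun K C (\<lambda>x. f (g x))"
  by (auto simp: bfun_def dest: measurable_space)

lemma bfun_const: "bfun N \<bar>c\<bar> (\<lambda>_. c)"
  by (auto simp: bfun_def)

context prob_space
begin

lemma integrable_bfun: "bfun M C f \<Longrightarrow> integrable M f"
  by (rule integrable_const_bound[of _ C]) (auto simp: bfun_def)

lemma integral_bfun_bound:
  assumes "bfun M C f" shows "\<bar>LINT x|M. f x\<bar> \<le> C"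
proof -
  have "\<bar>LINT x|M. f x\<bar> \<le> (LINT x|M. \<bar>f x\<bar>)" by (rule integral_abs_bound)
  also have "\<dots> \<le> (LINT x|M. C)"
    using assms by (intro integral_mono integrable_abs integrable_bfun) (auto simp: bfun_def)
  finally show ?thesis by (simp add: prob_space)
qed

lemma bfun_integral:
  assumes "bfun (N \<Otimes>\<^sub>M M) C (\<lambda>(x, y). f x y)"
  shows "bfun N C (\<lambda>x. LINT y|M. f x y)"
proof -
  have "bfun M C (f x)" if "x \<in> space N" for x
    using bfun_comp[OF assms, of "\<lambda>y. (x, y)" M] that by simp
  moreover have "(\<lambda>x. LINT y|M. f x y) \<in> borel_measurable N"
    using bfun_measurable[OF assms] by (rule borel_measurable_lebesgue_integral)
  ultimately show ?thesis
    by (auto simp: bfun_def intro!: integral_bfun_bound)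
qed

end

lemma integral_pair_iterated:
  assumes "prob_space N" "prob_space M" "bfun (N \<Otimes>\<^sub>M M) C f"
  shows "(LINT p|(N \<Otimes>\<^sub>M M). f p) = (LINT x|N. LINT y|M. f (x, y))"
    and "(LINT p|(N \<Otimes>\<^sub>M M). f p) = (LINT y|M. LINT x|N. f (x, y))"
proof -
  interpret N: prob_space N by fact
  interpret M: prob_space M by fact
  interpret pair_prob_space N M by unfold_locales
  have i: "integrable (N \<Otimes>\<^sub>M M) f" using assms(3) by (rule P.integrable_bfun)
  then show "(LINT p|(N \<Otimes>\<^sub>M M). f p) = (LINT x|N. LINT y|M. f (x, y))"
    by (simp add: integral_fst')
  show "(LINT p|(N \<Otimes>\<^sub>M M). f p) = (LINT y|M. LINT x|N. f (x, y))"
    using i integral_snd[of "\<lambda>x y. f (x, y)"] by simp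
qed

text \<open>The best weight in \<open>[0, 1]\<close> is an indicator, so a cut norm may be tested on functions.\<close>

context prob_space
begin

lemma weight_le_indicator:
  assumes K: "bfun (M \<Otimes>\<^sub>M M) C K"
  obtains S where "S \<in> sets M" "\<And>f. f \<in> borel_measurable M \<Longrightarrow> (\<And>x. x \<in> space M \<Longrightarrow> f x \<in> {0..1}) \<Longrightarrow>
     (LINT p|(M \<Otimes>\<^sub>M M). f (fst p) * K p) \<le> (LINT p|(M \<Otimes>\<^sub>M M). indicator S (fst p) * K p)"
proof -
  define h where "h x = (LINT y|M. K (x, y))" for x
  have h: "bfun M C h" unfolding h_def using K by (intro bfun_integral) simp
  note [measurable] = bfun_measurable[OF h]
  \<comment> \<open>Over weights with values in \<open>[0, 1]\<close>, the integral of
    \<open>f x * h x\<close> is largest when \<open>f\<close> is \<open>1\<close> where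
    \<open>h\<close> is positive and \<open>0\<close> elsewhere.\<close>
  define S where "S = {x \<in> space M. 0 < h x}"
  have S[measurable]: "S \<in> sets M" unfolding S_def by measurable
  have eq: "(LINT p|(M \<Otimes>\<^sub>M M). f (fst p) * K p) = (LINT x|M. f x * h x)" if "bfun M 1 f" for f
  proof -
    have "bfun (M \<Otimes>\<^sub>M M) (1 * C) (\<lambda>p. f (fst p) * K p)"
      by (rule bfun_mult[OF bfun_comp[OF that] K]) simp
    from integral_pair_iterated(1)[OF prob_space_axioms prob_space_axioms this]
    show ?thesis by (simp add: h_def)
  qed
  show ?thesis
  proof (rule that[OF S])
    fix f :: "'a \<Rightarrow> real" assume [measurable]: "f \<in> borel_measurable M"
      and f: "\<And>x. x \<in> space M \<Longrightarrow> f x \<in> {0..1}"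
    then have b: "bfun M 1 f" by (auto simp: bfun_def)
    have "(LINT x|M. f x * h x) \<le> (LINT x|M. indicator S x * h x)"
    proof (rule integral_mono)
      show "integrable M (\<lambda>x. f x * h x)" "integrable M (\<lambda>x. indicator S x * h x)"
        by (rule integrable_bfun[OF bfun_mult[OF b h]])
          (rule integrable_bfun[OF bfun_mult[OF bfun_indicator[OF S] h]])
      fix x assume x: "x \<in> space M"
      show "f x * h x \<le> indicator S x * h x"
        using f[OF x] x by (auto simp: S_def indicator_def mult_le_cancel_right1 mult_nonneg_nonpos not_less)
    qed
    then show "(LINT p|(M \<Otimes>\<^sub>M M). f (fst p) * K p) \<le> (LINT p|(M \<Otimes>\<^sub>M M). indicator S (fst p) * K p)"
      using eq[OF b] eq[OF bfun_indicator[OF S]] by simp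
  qed
qed

lemma integral_swap:
  assumes "bfun (M \<Otimes>\<^sub>M M) C f"
  shows "(LINT p|(M \<Otimes>\<^sub>M M). f (snd p, fst p)) = (LINT p|(M \<Otimes>\<^sub>M M). f p)"
proof -
  have "bfun (M \<Otimes>\<^sub>M M) C (\<lambda>p. f (snd p, fst p))"
    by (rule bfun_comp[OF assms]) simp
  from integral_pair_iterated(2)[OF prob_space_axioms prob_space_axioms this]
    integral_pair_iterated(1)[OF prob_space_axioms prob_space_axioms assms]
  show ?thesis by simp
qed

text \<open>The weights are optimised in turn: for fixed \<open>g\<close> the best \<open>f\<close>
  is an indicator, then the coordinates are swapped and \<open>g\<close> is optimised against that
  indicator. Optimising works in one direction only, hence the bound without absolute value, which
  is later applied to \<open>D\<close> and to \<open>- D\<close>.\<close>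

lemma cut_bound_weights01_le:
  assumes D: "bfun (M \<Otimes>\<^sub>M M) C D"
    and d: "\<And>S T. S \<in> sets M \<Longrightarrow> T \<in> sets M \<Longrightarrow> (LINT p:S \<times> T|M \<Otimes>\<^sub>M M. D p) \<le> d"
    and f: "f \<in> borel_measurable M" "\<And>x. x \<in> space M \<Longrightarrow> f x \<in> {0..1}"
    and g: "g \<in> borel_measurable M" "\<And>x. x \<in> space M \<Longrightarrow> g x \<in> {0..1}"
  shows "(LINT p|(M \<Otimes>\<^sub>M M). f (fst p) * g (snd p) * D p) \<le> d"
proof -
  have b: "bfun M 1 f" "bfun M 1 g" using f g by (auto simp: bfun_def)
  have fs[measurable]: "bfun (M \<Otimes>\<^sub>M M) 1 (\<lambda>p. g (snd p))"
    by (intro bfun_comp[OF b(2)]) auto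
  obtain S where S: "S \<in> sets M" "\<And>f. f \<in> borel_measurable M \<Longrightarrow> (\<And>x. x \<in> space M \<Longrightarrow> f x \<in> {0..1}) \<Longrightarrow>
     (LINT p|(M \<Otimes>\<^sub>M M). f (fst p) * (g (snd p) * D p))
        \<le> (LINT p|(M \<Otimes>\<^sub>M M). indicator S (fst p) * (g (snd p) * D p))"
    using weight_le_indicator[OF bfun_mult[OF fs D]] by blast
  have iS: "bfun (M \<Otimes>\<^sub>M M) 1 (\<lambda>p. indicator S (snd p))"
    by (intro bfun_comp[OF bfun_indicator[OF S(1)]]) auto
  have sw: "bfun (M \<Otimes>\<^sub>M M) C (\<lambda>p. D (snd p, fst p))"
    by (intro bfun_comp[OF D]) auto
  obtain T where T: "T \<in> sets M" "\<And>f. f \<in> borel_measurable M \<Longrightarrow> (\<And>x. x \<in> space M \<Longrightarrow> f x \<in> {0..1}) \<Longrightarrow>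
     (LINT p|(M \<Otimes>\<^sub>M M). f (fst p) * (indicator S (snd p) * D (snd p, fst p)))
        \<le> (LINT p|(M \<Otimes>\<^sub>M M). indicator T (fst p) * (indicator S (snd p) * D (snd p, fst p)))"
    using weight_le_indicator[OF bfun_mult[OF iS sw]] by blast
  have swap: "(LINT p|(M \<Otimes>\<^sub>M M). q (fst p) * (indicator S (snd p) * D (snd p, fst p))) =
      (LINT p|(M \<Otimes>\<^sub>M M). indicator S (fst p) * (q (snd p) * D p))" if "bfun M 1 q" for q
  proof -
    have "bfun (M \<Otimes>\<^sub>M M) (1 * (1 * C)) (\<lambda>p. indicator S (fst p) * (q (snd p) * D p))"
      by (rule bfun_mult[OF bfun_comp[OF bfun_indicator[OF S(1)]] bfun_mult[OF bfun_comp[OF that] D]]) auto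
    from integral_swap[OF this] show ?thesis by (simp add: ac_simps)
  qed
  have "(LINT p|(M \<Otimes>\<^sub>M M). f (fst p) * g (snd p) * D p)
      \<le> (LINT p|(M \<Otimes>\<^sub>M M). indicator S (fst p) * (g (snd p) * D p))"
    using S(2)[OF f] by (simp add: mult.assoc)
  also have "\<dots> \<le> (LINT p|(M \<Otimes>\<^sub>M M). indicator S (fst p) * (indicator T (snd p) * D p))"
    using T(2)[OF g] swap[OF b(2)] swap[OF bfun_indicator[OF T(1)]] by simp
  also have "\<dots> = (LINT p:S \<times> T|M \<Otimes>\<^sub>M M. D p)"
    unfolding set_lebesgue_integral_def
    by (intro Bochner_Integration.integral_cong) (auto simp: indicator_def split: prod.splits)
  also have "\<dots> \<le> d" by (rule d[OF S(1) T(1)])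
  finally show ?thesis .
qed

lemma cut_bound_weights01:
  assumes D: "bfun (M \<Otimes>\<^sub>M M) C D"
    and d: "\<And>S T. S \<in> sets M \<Longrightarrow> T \<in> sets M \<Longrightarrow> \<bar>LINT p:S \<times> T|M \<Otimes>\<^sub>M M. D p\<bar> \<le> d"
    and fg: "f \<in> borel_measurable M" "\<And>x. x \<in> space M \<Longrightarrow> f x \<in> {0..1}"
      "g \<in> borel_measurable M" "\<And>x. x \<in> space M \<Longrightarrow> g x \<in> {0..1}"
  shows "\<bar>LINT p|(M \<Otimes>\<^sub>M M). f (fst p) * g (snd p) * D p\<bar> \<le> d"
proof -
  have "(LINT p|(M \<Otimes>\<^sub>M M). f (fst p) * g (snd p) * D p) \<le> d"
    using d by (intro cut_bound_weights01_le[OF D _ fg]) (meson abs_le_D1)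
  moreover have "(LINT p|(M \<Otimes>\<^sub>M M). f (fst p) * g (snd p) * - D p) \<le> d"
  proof (rule cut_bound_weights01_le[OF bfun_uminus[OF D] _ fg])
    fix S T assume "S \<in> sets M" "T \<in> sets M"
    from d[OF this] show "(LINT p:S \<times> T|M \<Otimes>\<^sub>M M. - D p) \<le> d"
      by (simp add: set_lebesgue_integral_def abs_le_iff)
  qed
  ultimately show ?thesis by (simp add: abs_le_iff)
qed

text \<open>A signed weight is \<open>c\<close> times a difference of two weights in
  \<open>[0, 1]\<close>; expanding the product gives the factor \<open>c\<^sup>2\<close> and four
  integrals, each of absolute value at most \<open>d\<close>.\<close>

lemma cut_bound_weights:
  assumes D: "bfun (M \<Otimes>\<^sub>M M) C D"
    and d: "\<And>S T. S \<in> sets M \<Longrightarrow> T \<in> sets M \<Longrightarrow> \<bar>LINT p:S \<times> T|M \<Otimes>\<^sub>M M. D p\<bar> \<le> d"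
    and f: "bfun M c f" and g: "bfun M c g" and c: "0 < c"
  shows "\<bar>LINT p|(M \<Otimes>\<^sub>M M). f (fst p) * g (snd p) * D p\<bar> \<le> 4 * c\<^sup>2 * d"
proof -
  define pos neg where "pos q x = max 0 (q x) / c" and "neg q x = max 0 (- q x) / c"
    for q :: "'a \<Rightarrow> real" and x
  have m: "pos q \<in> borel_measurable M" "neg q \<in> borel_measurable M"
    and r: "\<And>x. x \<in> space M \<Longrightarrow> pos q x \<in> {0..1}" "\<And>x. x \<in> space M \<Longrightarrow> neg q x \<in> {0..1}"
    if "bfun M c q" for q
    using that c unfolding pos_def neg_def bfun_def by (auto simp: abs_le_iff)
  have dec: "q x = c * (pos q x - neg q x)" for q x
    using c by (simp add: pos_def neg_def max_def field_simps)
  have i: "integrable (M \<Otimes>\<^sub>M M) (\<lambda>p. r (fst p) * s (snd p) * D p)"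
    if "r \<in> borel_measurable M" "\<And>x. x \<in> space M \<Longrightarrow> r x \<in> {0..1}"
      "s \<in> borel_measurable M" "\<And>x. x \<in> space M \<Longrightarrow> s x \<in> {0..1}" for r s :: "'a \<Rightarrow> real"
  proof -
    interpret P: prob_space "M \<Otimes>\<^sub>M M" by (rule prob_space_square)
    have "bfun M 1 r" "bfun M 1 s" using that by (auto simp: bfun_def)
    then have "bfun (M \<Otimes>\<^sub>M M) (1 * 1 * C) (\<lambda>p. r (fst p) * s (snd p) * D p)"
      by (intro bfun_mult[OF bfun_mult[OF bfun_comp bfun_comp] D]) auto
    then show ?thesis by (rule P.integrable_bfun)
  qed
  let ?I = "\<lambda>r s. LINT p|(M \<Otimes>\<^sub>M M). r (fst p) * s (snd p) * D p"
  have "?I f g = (LINT p|(M \<Otimes>\<^sub>M M). c\<^sup>2 * (pos f (fst p) * pos g (snd p) * D p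
      - pos f (fst p) * neg g (snd p) * D p - neg f (fst p) * pos g (snd p) * D p
      + neg f (fst p) * neg g (snd p) * D p))"
  proof (rule Bochner_Integration.integral_cong)
    fix p
    show "f (fst p) * g (snd p) * D p = c\<^sup>2 * (pos f (fst p) * pos g (snd p) * D p
      - pos f (fst p) * neg g (snd p) * D p - neg f (fst p) * pos g (snd p) * D p
      + neg f (fst p) * neg g (snd p) * D p)"
      unfolding dec[of f "fst p"] dec[of g "snd p"] by (simp add: algebra_simps power2_eq_square)
  qed simp
  also have "\<dots> = c\<^sup>2 * (?I (pos f) (pos g) - ?I (pos f) (neg g) - ?I (neg f) (pos g) + ?I (neg f) (neg g))"
    using i m r f g by simp
  finally have eq: "?I f g = \<dots>" .
  have b: "\<bar>?I (pos f) (pos g)\<bar> \<le> d" "\<bar>?I (pos f) (neg g)\<bar> \<le> d"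
    "\<bar>?I (neg f) (pos g)\<bar> \<le> d" "\<bar>?I (neg f) (neg g)\<bar> \<le> d"
    using m r f g by (auto intro!: cut_bound_weights01[OF D d])
  have "\<bar>?I (pos f) (pos g) - ?I (pos f) (neg g) - ?I (neg f) (pos g) + ?I (neg f) (neg g)\<bar> \<le> 4 * d"
    using b by linarith
  from mult_left_mono[OF this, of "c\<^sup>2"] show ?thesis
    unfolding eq abs_mult by simp
qed

end

section \<open>The counting lemma\<close>

lemma measurable_fun_upd2:
  assumes "a \<notin> J" "b \<notin> J" "a \<noteq> b"
  shows "(\<lambda>(p, z). z(a := fst p, b := snd p)) \<in>
    (M \<Otimes>\<^sub>M M) \<Otimes>\<^sub>M Pi\<^sub>M J (\<lambda>_. M) \<rightarrow>\<^sub>M Pi\<^sub>M (insert a (insert b J)) (\<lambda>_. M)"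
  unfolding split_beta
  by (rule measurable_fun_upd[where J = "insert a J"], force,
      rule measurable_fun_upd[where J = J]) (use assms in auto)

context prob_space
begin

lemma prob_space_PiM_const: "prob_space (Pi\<^sub>M J (\<lambda>_. M))"
  by (rule prob_space_PiM) (rule prob_space_axioms)

text \<open>The preimage of a box is again a box, so both measures agree on the boxes, which
  generate the product.\<close>

lemma distr_fun_upd2:
  fixes J :: "'i set"
  assumes "finite J" "a \<notin> J" "b \<notin> J" "a \<noteq> b"
  shows "distr ((M \<Otimes>\<^sub>M M) \<Otimes>\<^sub>M Pi\<^sub>M J (\<lambda>_. M)) (Pi\<^sub>M (insert a (insert b J)) (\<lambda>_. M))
      (\<lambda>(p, z). z(a := fst p, b := snd p)) = Pi\<^sub>M (insert a (insert b J)) (\<lambda>_. M)"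
proof -
  interpret N: prob_space "Pi\<^sub>M J (\<lambda>_. M)" by (rule prob_space_PiM_const)
  interpret Q: prob_space "M \<Otimes>\<^sub>M M" by (rule prob_space_square)
  interpret X: pair_prob_space "M \<Otimes>\<^sub>M M" "Pi\<^sub>M J (\<lambda>_. M)" by unfold_locales
  interpret PP: product_prob_space "\<lambda>_::'i. M" by unfold_locales
  let ?I = "insert a (insert b J)"
  show ?thesis
  proof (rule PP.PiM_eqI)
    show "finite ?I" using assms by simp
    fix A assume A: "\<And>i. i \<in> ?I \<Longrightarrow> A i \<in> sets M"
    have "(\<lambda>(p, z). z(a := fst p, b := snd p)) -` Pi\<^sub>E ?I A \<inter> space ((M \<Otimes>\<^sub>M M) \<Otimes>\<^sub>M Pi\<^sub>M J (\<lambda>_. M))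
        = (A a \<times> A b) \<times> Pi\<^sub>E J A"
      using A[THEN sets.sets_into_space] assms
      by (auto simp: space_pair_measure space_PiM PiE_iff extensional_def split: if_splits)
    then show "emeasure (distr ((M \<Otimes>\<^sub>M M) \<Otimes>\<^sub>M Pi\<^sub>M J (\<lambda>_. M)) (Pi\<^sub>M ?I (\<lambda>_. M))
        (\<lambda>(p, z). z(a := fst p, b := snd p))) (Pi\<^sub>E ?I A) = (\<Prod>i\<in>?I. emeasure M (A i))"
      using A assms
      by (subst emeasure_distr)
        (auto simp: N.emeasure_pair_measure_Times emeasure_pair_measure_Times PP.emeasure_PiM mult.assoc
          intro!: sets_PiM_I_finite measurable_fun_upd2)
  qed simp
qed

text \<open>With the pair outermost, a test against a rooted density becomes an integral over all
  tuples; with the pair innermost, the other coordinates are frozen, which is the situation of the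
  cut norm.\<close>

lemma integral_fun_upd2:
  assumes J: "finite J" "a \<notin> J" "b \<notin> J" "a \<noteq> b"
    and f: "bfun (Pi\<^sub>M (insert a (insert b J)) (\<lambda>_. M)) C f"
  shows "(LINT u|Pi\<^sub>M (insert a (insert b J)) (\<lambda>_. M). f u) =
      (LINT p|(M \<Otimes>\<^sub>M M). LINT z|Pi\<^sub>M J (\<lambda>_. M). f (z(a := fst p, b := snd p)))"
    and "(LINT u|Pi\<^sub>M (insert a (insert b J)) (\<lambda>_. M). f u) =
      (LINT z|Pi\<^sub>M J (\<lambda>_. M). LINT p|(M \<Otimes>\<^sub>M M). f (z(a := fst p, b := snd p)))"
proof -
  note m = measurable_fun_upd2[OF J(2-4), of M]
  have b: "bfun ((M \<Otimes>\<^sub>M M) \<Otimes>\<^sub>M Pi\<^sub>M J (\<lambda>_. M)) C (\<lambda>q. f ((\<lambda>(p, z). z(a := fst p, b := snd p)) q))"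
    by (rule bfun_comp[OF f m])
  have "(LINT u|Pi\<^sub>M (insert a (insert b J)) (\<lambda>_. M). f u) =
      (LINT q|((M \<Otimes>\<^sub>M M) \<Otimes>\<^sub>M Pi\<^sub>M J (\<lambda>_. M)). f ((\<lambda>(p, z). z(a := fst p, b := snd p)) q))"
    by (subst distr_fun_upd2[OF J, symmetric]) (rule integral_distr[OF m bfun_measurable[OF f]])
  with integral_pair_iterated[OF prob_space_square prob_space_PiM_const b]
  show "(LINT u|Pi\<^sub>M (insert a (insert b J)) (\<lambda>_. M). f u) =
      (LINT p|(M \<Otimes>\<^sub>M M). LINT z|Pi\<^sub>M J (\<lambda>_. M). f (z(a := fst p, b := snd p)))"
    and "(LINT u|Pi\<^sub>M (insert a (insert b J)) (\<lambda>_. M). f u) =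
      (LINT z|Pi\<^sub>M J (\<lambda>_. M). LINT p|(M \<Otimes>\<^sub>M M). f (z(a := fst p, b := snd p)))"
    by simp_all
qed

text \<open>A null set of pairs pulls back to a null set of tuples. This is what makes products of
  values \<open>W (u i, u j)\<close> depend, up to null sets, only on the class of
  \<open>W\<close>.\<close>

lemma AE_PiM_pair:
  assumes I: "finite I" "a \<in> I" "b \<in> I" "a \<noteq> b"
    and P: "AE p in M \<Otimes>\<^sub>M M. P p" "{p \<in> space (M \<Otimes>\<^sub>M M). P p} \<in> sets (M \<Otimes>\<^sub>M M)"
  shows "AE u in Pi\<^sub>M I (\<lambda>_. M). P (u a, u b)"
proof -
  interpret N: prob_space "Pi\<^sub>M (I - {a, b}) (\<lambda>_. M)" by (rule prob_space_PiM_const)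
  interpret Q: prob_space "M \<Otimes>\<^sub>M M" by (rule prob_space_square)
  interpret X: pair_prob_space "M \<Otimes>\<^sub>M M" "Pi\<^sub>M (I - {a, b}) (\<lambda>_. M)" by unfold_locales
  have eq: "insert a (insert b (I - {a, b})) = I" using I by auto
  have m: "(\<lambda>u. (u a, u b)) \<in> Pi\<^sub>M I (\<lambda>_. M) \<rightarrow>\<^sub>M M \<Otimes>\<^sub>M M"
    using I by (intro measurable_Pair measurable_component_singleton) auto
  have "{u \<in> space (Pi\<^sub>M I (\<lambda>_. M)). P (u a, u b)} =
      (\<lambda>u. (u a, u b)) -` {p \<in> space (M \<Otimes>\<^sub>M M). P p} \<inter> space (Pi\<^sub>M I (\<lambda>_. M))"
    using measurable_space[OF m] by auto
  then have s: "{u \<in> space (Pi\<^sub>M I (\<lambda>_. M)). P (u a, u b)} \<in> sets (Pi\<^sub>M I (\<lambda>_. M))"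
    using measurable_sets[OF m P(2)] by simp
  have "AE q in (M \<Otimes>\<^sub>M M) \<Otimes>\<^sub>M Pi\<^sub>M (I - {a, b}) (\<lambda>_. M). P (fst q)"
  proof (rule X.AE_pair_measure)
    have "{q \<in> space ((M \<Otimes>\<^sub>M M) \<Otimes>\<^sub>M Pi\<^sub>M (I - {a, b}) (\<lambda>_. M)). P (fst q)} =
        {p \<in> space (M \<Otimes>\<^sub>M M). P p} \<times> space (Pi\<^sub>M (I - {a, b}) (\<lambda>_. M))"
      by (auto simp: space_pair_measure)
    then show "{q \<in> space ((M \<Otimes>\<^sub>M M) \<Otimes>\<^sub>M Pi\<^sub>M (I - {a, b}) (\<lambda>_. M)). P (fst q)}
        \<in> sets ((M \<Otimes>\<^sub>M M) \<Otimes>\<^sub>M Pi\<^sub>M (I - {a, b}) (\<lambda>_. M))"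
      using P(2) by simp
    show "AE p in M \<Otimes>\<^sub>M M. AE z in Pi\<^sub>M (I - {a, b}) (\<lambda>_. M). P (fst (p, z))"
      using P(1) by simp
  qed
  moreover have "(\<lambda>(p, z). z(a := fst p, b := snd p)) \<in>
      (M \<Otimes>\<^sub>M M) \<Otimes>\<^sub>M Pi\<^sub>M (I - {a, b}) (\<lambda>_. M) \<rightarrow>\<^sub>M Pi\<^sub>M I (\<lambda>_. M)"
    using measurable_fun_upd2[of a "I - {a, b}" b M] I by (simp add: eq)
  ultimately have "AE u in distr ((M \<Otimes>\<^sub>M M) \<Otimes>\<^sub>M Pi\<^sub>M (I - {a, b}) (\<lambda>_. M)) (Pi\<^sub>M I (\<lambda>_. M))
      (\<lambda>(p, z). z(a := fst p, b := snd p)). P (u a, u b)"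
    using s I by (simp add: AE_distr_iff split_beta)
  moreover have "distr ((M \<Otimes>\<^sub>M M) \<Otimes>\<^sub>M Pi\<^sub>M (I - {a, b}) (\<lambda>_. M)) (Pi\<^sub>M I (\<lambda>_. M))
      (\<lambda>(p, z). z(a := fst p, b := snd p)) = Pi\<^sub>M I (\<lambda>_. M)"
    using distr_fun_upd2[of "I - {a, b}" a b, unfolded eq] I by blast
  ultimately show ?thesis by (simp only:)
qed

text \<open>Once the coordinates other than \<open>i\<close> and \<open>j\<close> are fixed, a weight that splits is a product of
  a function of \<open>u i\<close> and a function of \<open>u j\<close>, so it may be tested against the cut norm.\<close>

definition splits :: "'i set \<Rightarrow> 'i \<Rightarrow> 'i \<Rightarrow> real \<Rightarrow> (('i \<Rightarrow> 'a) \<Rightarrow> real) \<Rightarrow> bool" where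
  "splits I i j c G \<longleftrightarrow> (\<exists>P Q. bfun (Pi\<^sub>M I (\<lambda>_. M)) c P \<and> bfun (Pi\<^sub>M I (\<lambda>_. M)) c Q \<and>
     (\<forall>u x. P (u(j := x)) = P u) \<and> (\<forall>u x. Q (u(i := x)) = Q u) \<and> G = (\<lambda>u. P u * Q u))"

lemma splits_mult:
  assumes "splits I i j c G" "splits I i j d H"
  shows "splits I i j (c * d) (\<lambda>u. G u * H u)"
proof -
  from assms(1) obtain P Q where 1: "bfun (Pi\<^sub>M I (\<lambda>_. M)) c P" "bfun (Pi\<^sub>M I (\<lambda>_. M)) c Q"
    "\<forall>u x. P (u(j := x)) = P u" "\<forall>u x. Q (u(i := x)) = Q u" "G = (\<lambda>u. P u * Q u)"
    unfolding splits_def by auto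
  from assms(2) obtain P' Q' where 2: "bfun (Pi\<^sub>M I (\<lambda>_. M)) d P'" "bfun (Pi\<^sub>M I (\<lambda>_. M)) d Q'"
    "\<forall>u x. P' (u(j := x)) = P' u" "\<forall>u x. Q' (u(i := x)) = Q' u" "H = (\<lambda>u. P' u * Q' u)"
    unfolding splits_def by auto
  show ?thesis unfolding splits_def
    by (rule exI[of _ "\<lambda>u. P u * P' u"], rule exI[of _ "\<lambda>u. Q u * Q' u"])
      (use 1 2 bfun_mult[OF 1(1) 2(1)] bfun_mult[OF 1(2) 2(2)] in \<open>auto simp: ac_simps\<close>)
qed

text \<open>Such a \<open>G\<close> is itself one of the two factors; the other one is the constant
  \<open>1\<close>, whence \<open>1 \<le> c\<close>.\<close>

lemma splits_indep:
  assumes G: "bfun (Pi\<^sub>M I (\<lambda>_. M)) c G" and c: "1 \<le> c"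
    and "(\<forall>u x. G (u(i := x)) = G u) \<or> (\<forall>u x. G (u(j := x)) = G u)"
  shows "splits I i j c G"
proof -
  have 1: "bfun (Pi\<^sub>M I (\<lambda>_. M)) c (\<lambda>_. 1)"
    using bfun_mono[OF bfun_const[of _ 1], of c] c by simp
  from assms(3) show ?thesis
  proof
    assume "\<forall>u x. G (u(i := x)) = G u"
    then show ?thesis unfolding splits_def
      using G 1 by (intro exI[of _ "\<lambda>_. 1"] exI[of _ G]) simp
  next
    assume "\<forall>u x. G (u(j := x)) = G u"
    then show ?thesis unfolding splits_def
      using G 1 by (intro exI[of _ G] exI[of _ "\<lambda>_. 1"]) simp
  qed
qed

lemma splits_prod:
  assumes "finite A" "\<And>e. e \<in> A \<Longrightarrow> splits I i j c (G e)"
  shows "splits I i j (c ^ card A) (\<lambda>u. \<Prod>e\<in>A. G e u)"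
  using assms
proof (induction A rule: finite_induct)
  case empty
  show ?case using bfun_const[of "Pi\<^sub>M I (\<lambda>_. M)" 1] by (auto intro!: splits_indep)
next
  case (insert e A)
  then show ?case using splits_mult[of I i j c "G e" "c ^ card A" "\<lambda>u. \<Prod>e\<in>A. G e u"] by simp
qed

lemma bfun_PiM_pair:
  assumes "bfun (M \<Otimes>\<^sub>M M) c K" "i \<in> I" "j \<in> I"
  shows "bfun (Pi\<^sub>M I (\<lambda>_. M)) c (\<lambda>u. K (u i, u j))"
  using assms by (intro bfun_comp[OF assms(1)] measurable_Pair measurable_component_singleton)

text \<open>A simple graph has no parallel edges: a pair other than \<open>{i, j}\<close> misses
  \<open>i\<close> or \<open>j\<close>, and its factor is constant in the missed coordinate.\<close>

lemma splits_pair: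
  assumes "bfun (M \<Otimes>\<^sub>M M) c K" "1 \<le> c" "i' \<in> I" "j' \<in> I" "{i', j'} \<noteq> {i, j}" "i \<noteq> j" "i' \<noteq> j'"
  shows "splits I i j c (\<lambda>u. K (u i', u j'))"
proof (rule splits_indep[OF bfun_PiM_pair[OF assms(1,3,4)] assms(2)])
  have "i \<noteq> i' \<and> i \<noteq> j' \<or> j \<noteq> i' \<and> j \<noteq> j'" using assms by auto
  then show "(\<forall>u x. K ((u(i := x)) i', (u(i := x)) j') = K (u i', u j')) \<or>
      (\<forall>u x. K ((u(j := x)) i', (u(j := x)) j') = K (u i', u j'))" by auto
qed

lemma splits_single:
  assumes "bfun M c f" "1 \<le> c" "l \<in> I" "i \<noteq> j"
  shows "splits I i j c (\<lambda>u. f (u l))"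
proof (rule splits_indep[OF bfun_comp[OF assms(1)] assms(2)])
  show "(\<lambda>u. u l) \<in> Pi\<^sub>M I (\<lambda>_. M) \<rightarrow>\<^sub>M M" using assms(3) by (rule measurable_component_singleton)
  show "(\<forall>u x. f ((u(i := x)) l) = f (u l)) \<or> (\<forall>u x. f ((u(j := x)) l) = f (u l))"
    using assms(4) by auto
qed

lemma cut_bound_splits:
  assumes I: "finite I" "i \<in> I" "j \<in> I" "i \<noteq> j" and G: "splits I i j c G" and c: "0 < c"
    and D: "bfun (M \<Otimes>\<^sub>M M) C D"
    and d: "\<And>S T. S \<in> sets M \<Longrightarrow> T \<in> sets M \<Longrightarrow> \<bar>LINT p:S \<times> T|M \<Otimes>\<^sub>M M. D p\<bar> \<le> d"
  shows "\<bar>LINT u|Pi\<^sub>M I (\<lambda>_. M). G u * D (u i, u j)\<bar> \<le> 4 * c\<^sup>2 * d"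
proof -
  obtain P Q where P: "bfun (Pi\<^sub>M I (\<lambda>_. M)) c P" "\<And>u x. P (u(j := x)) = P u"
    and Q: "bfun (Pi\<^sub>M I (\<lambda>_. M)) c Q" "\<And>u x. Q (u(i := x)) = Q u" and eq: "G = (\<lambda>u. P u * Q u)"
    using G unfolding splits_def by blast
  let ?J = "I - {i, j}"
  have I': "insert i (insert j ?J) = I" using I by auto
  \<comment> \<open>An arbitrary point to fill the coordinate on which a factor does not depend; it
    turns \<open>P\<close> and \<open>Q\<close> into functions \<open>f\<close> and \<open>g\<close>
    of one variable.\<close>
  obtain o' where o': "o' \<in> space M" using not_empty by blast
  have b: "bfun (Pi\<^sub>M I (\<lambda>_. M)) (c * c * C) (\<lambda>u. P u * Q u * D (u i, u j))"
    by (rule bfun_mult[OF bfun_mult[OF P(1) Q(1)] bfun_PiM_pair[OF D I(2,3)]])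
  have "(LINT u|Pi\<^sub>M I (\<lambda>_. M). G u * D (u i, u j)) =
      (LINT z|Pi\<^sub>M ?J (\<lambda>_. M). LINT p|(M \<Otimes>\<^sub>M M).
        P (z(i := fst p, j := snd p)) * Q (z(i := fst p, j := snd p)) * D p)"
    unfolding eq using integral_fun_upd2(2)[of ?J i j "c * c * C", unfolded I', OF _ _ _ _ b] I by simp
  also have "\<bar>\<dots>\<bar> \<le> 4 * c\<^sup>2 * d"
  proof -
    interpret N: prob_space "Pi\<^sub>M ?J (\<lambda>_. M)" by (rule prob_space_PiM_const)
    have bd: "\<bar>LINT p|(M \<Otimes>\<^sub>M M). P (z(i := fst p, j := snd p)) * Q (z(i := fst p, j := snd p)) * D p\<bar>
        \<le> 4 * c\<^sup>2 * d" if z: "z \<in> space (Pi\<^sub>M ?J (\<lambda>_. M))" for z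
    proof -
      define f where "f x = P (z(i := x, j := o'))" for x
      define g where "g y = Q (z(i := o', j := y))" for y
      have m: "(\<lambda>x. z(i := x, j := o')) \<in> M \<rightarrow>\<^sub>M Pi\<^sub>M I (\<lambda>_. M)"
        "(\<lambda>y. z(i := o', j := y)) \<in> M \<rightarrow>\<^sub>M Pi\<^sub>M I (\<lambda>_. M)"
        by (rule measurable_fun_upd[where J = "insert i ?J"], use I in force,
            rule measurable_fun_upd[where J = ?J]; use I o' z in auto)+
      have Pf: "P (z(i := x, j := y)) = f x" for x y
        using P(2)[of "z(i := x, j := y)" o'] by (simp add: f_def)
      have Qg: "Q (z(i := x, j := y)) = g y" for x y
        using Q(2)[of "z(i := x, j := y)" o'] I by (simp add: g_def fun_upd_twist)
      have fg: "bfun M c f" "bfun M c g"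
        unfolding f_def g_def by (intro bfun_comp[OF P(1)] bfun_comp[OF Q(1)] m)+
      show ?thesis unfolding Pf Qg by (rule cut_bound_weights[OF D d fg c])
    qed
    \<comment> \<open>Joint measurability, so that the inner integral is measurable in
      \<open>z\<close>. The pair now comes second, the reverse of the order in
      \<open>measurable_fun_upd2\<close>.\<close>
    have b2: "bfun (Pi\<^sub>M ?J (\<lambda>_. M) \<Otimes>\<^sub>M (M \<Otimes>\<^sub>M M)) (c * c * C)
       (\<lambda>(z, p). P (z(i := fst p, j := snd p)) * Q (z(i := fst p, j := snd p)) * D p)"
    proof -
      have "(\<lambda>(z, p). (p, z)) \<in> Pi\<^sub>M ?J (\<lambda>_. M) \<Otimes>\<^sub>M (M \<Otimes>\<^sub>M M) \<rightarrow>\<^sub>M (M \<Otimes>\<^sub>M M) \<Otimes>\<^sub>M Pi\<^sub>M ?J (\<lambda>_. M)"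
        by measurable
      from measurable_compose[OF this measurable_fun_upd2[of i ?J j]]
      have "(\<lambda>(z, p). z(i := fst p, j := snd p)) \<in>
          Pi\<^sub>M ?J (\<lambda>_. M) \<Otimes>\<^sub>M (M \<Otimes>\<^sub>M M) \<rightarrow>\<^sub>M Pi\<^sub>M I (\<lambda>_. M)"
        using I I' by (simp add: split_beta)
      from bfun_comp[OF b this] show ?thesis
        by (rule bfun_cong[THEN iffD1, rotated]) (use I in \<open>auto simp: split_beta\<close>)
    qed
    interpret Q: prob_space "M \<Otimes>\<^sub>M M" by (rule prob_space_square)
    from Q.bfun_integral[OF b2] bd show ?thesis
      by (intro N.integral_bfun_bound) (auto simp: bfun_def)
  qed
  finally show ?thesis .
qed

text \<open>Telescoping over the edges: with \<open>e\<close> split off, the difference of products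
  is U_A (U_e - W_e) + W_e (U_A - W_A). The first term is a cut test at \<open>e\<close>, because
  \<open>G\<close> and all other edges split there. In the second term W_e joins the weight, which
  is why the induction runs over arbitrary \<open>G\<close>. The constant \<open>c\<close> bounds
  the two factors of the splitting and gains a factor \<open>B\<close> per edge; \<open>c'\<close>
  bounds \<open>G\<close> itself and provides integrability.\<close>

lemma counting_lemma:
  fixes I :: "'i::linorder set"
  assumes I: "finite I" and A: "finite A" "A \<subseteq> {(i, j). i \<in> I \<and> j \<in> I \<and> i < j}"
    and B: "1 \<le> B" and U: "bfun (M \<Otimes>\<^sub>M M) B U" and W: "bfun (M \<Otimes>\<^sub>M M) B W"
    and d: "\<And>S T. S \<in> sets M \<Longrightarrow> T \<in> sets M \<Longrightarrow> \<bar>LINT p:S \<times> T|M \<Otimes>\<^sub>M M. (U p - W p)\<bar> \<le> d"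
    and G: "\<And>i j. (i, j) \<in> A \<Longrightarrow> splits I i j c G" "bfun (Pi\<^sub>M I (\<lambda>_. M)) c' G" and c: "1 \<le> c"
  shows "\<bar>LINT u|Pi\<^sub>M I (\<lambda>_. M). G u * ((\<Prod>(i, j)\<in>A. U (u i, u j)) - (\<Prod>(i, j)\<in>A. W (u i, u j)))\<bar>
     \<le> real (card A) * (4 * (c * B ^ card A)\<^sup>2 * d)"
  using A G c
proof (induction A arbitrary: G c c' rule: finite_induct)
  case empty
  then show ?case by simp
next
  case (insert e A)
  interpret N: prob_space "Pi\<^sub>M I (\<lambda>_. M)" by (rule prob_space_PiM_const)
  obtain i j where e: "e = (i, j)" by (cases e)
  have ij: "i \<in> I" "j \<in> I" "i < j" "i \<noteq> j" using insert.prems(1) e by auto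
  have d0: "0 \<le> d" using d[of "{}" "{}"] by simp
  let ?n = "card A"
  have U': "bfun (M \<Otimes>\<^sub>M M) (B + B) (\<lambda>p. U p - W p)" by (rule bfun_diff[OF U W])
  have bp: "bfun (Pi\<^sub>M I (\<lambda>_. M)) (B ^ card A) (\<lambda>u. \<Prod>(i, j)\<in>A. K (u i, u j))"
    if "bfun (M \<Otimes>\<^sub>M M) B K" for K
    unfolding split_beta using insert.prems(1) insert.hyps(1)
    by (intro bfun_prod bfun_PiM_pair[OF that]) auto
  have Ge: "splits I i j (c * B ^ ?n) (\<lambda>u. G u * (\<Prod>(i, j)\<in>A. U (u i, u j)))"
  proof (intro splits_mult)
    show "splits I i j c G" using insert.prems(2) e by auto
    show "splits I i j (B ^ card A) (\<lambda>u. \<Prod>(i, j)\<in>A. U (u i, u j))"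
      unfolding split_beta
    proof (rule splits_prod[OF insert.hyps(1)])
      fix q assume q: "q \<in> A"
      then have "{fst q, snd q} \<noteq> {i, j}"
        using insert.prems(1) insert.hyps(2) e ij by (auto simp: doubleton_eq_iff)
      then show "splits I i j B (\<lambda>u. U (u (fst q), u (snd q)))"
        using insert.prems(1) ij q by (intro splits_pair[OF U B]) auto
    qed
  qed
  have cB: "1 \<le> c * B ^ ?n" using insert.prems(4) B by (simp add: mult_ge1_I)
  have 1: "\<bar>LINT u|Pi\<^sub>M I (\<lambda>_. M). G u * (\<Prod>(i, j)\<in>A. U (u i, u j)) * (U (u i, u j) - W (u i, u j))\<bar>
      \<le> 4 * (c * B ^ ?n)\<^sup>2 * d"
    using cB by (intro cut_bound_splits[OF I ij(1,2,4) Ge _ U' d]) auto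
  have GW: "bfun (Pi\<^sub>M I (\<lambda>_. M)) (c' * B) (\<lambda>u. G u * W (u i, u j))"
    by (rule bfun_mult[OF insert.prems(3) bfun_PiM_pair[OF W ij(1,2)]])
  have 2: "\<bar>LINT u|Pi\<^sub>M I (\<lambda>_. M). G u * W (u i, u j) *
        ((\<Prod>(i, j)\<in>A. U (u i, u j)) - (\<Prod>(i, j)\<in>A. W (u i, u j)))\<bar>
      \<le> real ?n * (4 * ((c * B) * B ^ ?n)\<^sup>2 * d)"
  proof (rule insert.IH[OF _ _ GW])
    show "A \<subseteq> {(i, j). i \<in> I \<and> j \<in> I \<and> i < j}" using insert.prems(1) by simp
    show "1 \<le> c * B" using insert.prems(4) B by (simp add: mult_ge1_I)
    fix i' j' assume q: "(i', j') \<in> A"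
    then have "{i, j} \<noteq> {i', j'}"
      using insert.prems(1) insert.hyps(2) e ij by (auto simp: doubleton_eq_iff)
    then show "splits I i' j' (c * B) (\<lambda>u. G u * W (u i, u j))"
      using insert.prems(1,2) ij q by (intro splits_mult splits_pair[OF W B]) auto
  qed
  have i1: "integrable (Pi\<^sub>M I (\<lambda>_. M))
     (\<lambda>u. G u * (\<Prod>(i, j)\<in>A. U (u i, u j)) * (U (u i, u j) - W (u i, u j)))"
    by (rule N.integrable_bfun[OF bfun_mult[OF bfun_mult[OF insert.prems(3) bp[OF U]]
            bfun_PiM_pair[OF U' ij(1,2)]]])
  have i2: "integrable (Pi\<^sub>M I (\<lambda>_. M))
     (\<lambda>u. G u * W (u i, u j) * ((\<Prod>(i, j)\<in>A. U (u i, u j)) - (\<Prod>(i, j)\<in>A. W (u i, u j))))"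
    by (rule N.integrable_bfun[OF bfun_mult[OF GW bfun_diff[OF bp[OF U] bp[OF W]]]])
  have "(LINT u|Pi\<^sub>M I (\<lambda>_. M). G u * ((\<Prod>(i, j)\<in>insert e A. U (u i, u j)) - (\<Prod>(i, j)\<in>insert e A. W (u i, u j))))
    = (LINT u|Pi\<^sub>M I (\<lambda>_. M). G u * (\<Prod>(i, j)\<in>A. U (u i, u j)) * (U (u i, u j) - W (u i, u j))
      + G u * W (u i, u j) * ((\<Prod>(i, j)\<in>A. U (u i, u j)) - (\<Prod>(i, j)\<in>A. W (u i, u j))))"
    using insert.hyps e by (intro Bochner_Integration.integral_cong) (auto simp: algebra_simps)
  also have "\<dots> = (LINT u|Pi\<^sub>M I (\<lambda>_. M). G u * (\<Prod>(i, j)\<in>A. U (u i, u j)) * (U (u i, u j) - W (u i, u j)))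
      + (LINT u|Pi\<^sub>M I (\<lambda>_. M). G u * W (u i, u j) * ((\<Prod>(i, j)\<in>A. U (u i, u j)) - (\<Prod>(i, j)\<in>A. W (u i, u j))))"
    by (rule Bochner_Integration.integral_add[OF i1 i2])
  also have "\<bar>\<dots>\<bar> \<le> 4 * (c * B ^ ?n)\<^sup>2 * d + real ?n * (4 * ((c * B) * B ^ ?n)\<^sup>2 * d)"
    using 1 2 by linarith
  \<comment> \<open>Both summands are raised to the constant for one more edge; powers of
    \<open>B\<close> increase because \<open>1 \<le> B\<close>.\<close>
  also have "\<dots> \<le> 4 * (c * B ^ Suc ?n)\<^sup>2 * d + real ?n * (4 * (c * B ^ Suc ?n)\<^sup>2 * d)"
  proof -
    have "(c * B ^ ?n)\<^sup>2 \<le> (c * B ^ Suc ?n)\<^sup>2"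
      using insert.prems(4) B by (intro power_mono mult_left_mono power_increasing) auto
    then show ?thesis using d0 by (auto simp: mult.assoc intro!: mult_right_mono)
  qed
  finally show ?case using insert.hyps by (simp add: algebra_simps)
qed

end

section \<open>The velocity of the removal rule\<close>

lemma kernel_fun_iff_bfun:
  "kernel_fun M W \<longleftrightarrow> (\<exists>B\<ge>1. bfun (M \<Otimes>\<^sub>M M) B W) \<and> (\<forall>x\<in>space M. \<forall>y\<in>space M. W (x, y) = W (y, x))"
proof -
  have "\<exists>B\<ge>1. bfun (M \<Otimes>\<^sub>M M) B W" if "bfun (M \<Otimes>\<^sub>M M) B W" for B
    using bfun_mono[OF that, of "max 1 B"] by (intro exI[of _ "max 1 B"]) auto
  then show ?thesis unfolding kernel_fun_def bfun_def by metis
qed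

locale removal = prob_space M for M :: "'a measure" +
  fixes k :: nat and F :: graph
  assumes F_graph: "F \<in> graphs k" and F_nonempty: "card F > 0"
begin

text \<open>A product over a copy of \<open>F\<close> uses each edge once, hence
  \<open>i < j\<close>. The roots of the velocity run over ordered pairs, so \<open>arcs\<close>
  holds both orientations of each edge, which also makes \<open>vel\<close> symmetric.\<close>

definition edges :: "(nat \<times> nat) set" where
  "edges = {(i, j). i \<in> {1..k} \<and> j \<in> {1..k} \<and> i < j \<and> {i, j} \<in> F}"

definition arcs :: "(nat \<times> nat) set" where
  "arcs = {(a, b). a \<in> {1..k} \<and> b \<in> {1..k} \<and> a \<noteq> b \<and> {a, b} \<in> F}"

definition hom :: "(nat \<times> nat) set \<Rightarrow> ('a \<times> 'a \<Rightarrow> real) \<Rightarrow> (nat \<Rightarrow> 'a) \<Rightarrow> real" where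
  "hom A W u = (\<Prod>(i, j)\<in>A. W (u i, u j))"

text \<open>The edge set is a parameter because the decay rate of a solution needs the density of
  \<open>F\<close> without its root edge.\<close>

definition rooted :: "(nat \<times> nat) set \<Rightarrow> nat \<Rightarrow> nat \<Rightarrow> ('a \<times> 'a \<Rightarrow> real) \<Rightarrow> 'a \<times> 'a \<Rightarrow> real" where
  "rooted A a b W p = (LINT z|Pi\<^sub>M ({1..k} - {a, b}) (\<lambda>_. M). hom A W (z(a := fst p, b := snd p)))"

definition vel :: "('a \<times> 'a \<Rightarrow> real) \<Rightarrow> 'a \<times> 'a \<Rightarrow> real" where
  "vel W p = - (\<Sum>(a, b)\<in>arcs. rooted edges a b W p)"

lemma finite_edges: "finite edges"
  by (rule finite_subset[of _ "{1..k} \<times> {1..k}"]) (auto simp: edges_def)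

lemma finite_arcs: "finite arcs"
  by (rule finite_subset[of _ "{1..k} \<times> {1..k}"]) (auto simp: arcs_def)

lemma card_arcs_pos: "0 < card arcs"
proof -
  obtain e where "e \<in> F" using F_nonempty by fastforce
  moreover then obtain i j where "e = {i, j}" "i \<in> {1..k}" "j \<in> {1..k}" "i \<noteq> j"
    using F_graph unfolding graphs_def by auto
  ultimately have "(i, j) \<in> arcs" by (auto simp: arcs_def)
  then show ?thesis using finite_arcs by (auto simp: card_gt_0_iff)
qed

lemma arcsD: "(a, b) \<in> arcs \<Longrightarrow> a \<in> {1..k} \<and> b \<in> {1..k} \<and> a \<noteq> b \<and> {a, b} \<in> F"
  by (auto simp: arcs_def)

lemma insert_roots:
  "a \<in> {1..k} \<Longrightarrow> b \<in> {1..k} \<Longrightarrow> insert a (insert b ({1..k} - {a, b})) = {1..k}"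
  by auto

lemma measurable_roots:
  assumes "a \<in> {1..k}" "b \<in> {1..k}" "a \<noteq> b"
  shows "(\<lambda>(p, z). z(a := fst p, b := snd p)) \<in>
    (M \<Otimes>\<^sub>M M) \<Otimes>\<^sub>M Pi\<^sub>M ({1..k} - {a, b}) (\<lambda>_. M) \<rightarrow>\<^sub>M Pi\<^sub>M {1..k} (\<lambda>_. M)"
  using measurable_fun_upd2[of a "{1..k} - {a, b}" b M, unfolded insert_roots[OF assms(1,2)]] assms
  by blast

lemma measurable_roots_at:
  assumes "a \<in> {1..k}" "b \<in> {1..k}" "a \<noteq> b" "p \<in> space (M \<Otimes>\<^sub>M M)"
  shows "(\<lambda>z. z(a := fst p, b := snd p)) \<in> Pi\<^sub>M ({1..k} - {a, b}) (\<lambda>_. M) \<rightarrow>\<^sub>M Pi\<^sub>M {1..k} (\<lambda>_. M)"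
  using measurable_compose[OF _ measurable_roots[OF assms(1-3)],
      of "\<lambda>z. (p, z)" "Pi\<^sub>M ({1..k} - {a, b}) (\<lambda>_. M)"] assms(4) by simp

lemma bfun_hom:
  assumes "A \<subseteq> edges" "bfun (M \<Otimes>\<^sub>M M) B W"
  shows "bfun (Pi\<^sub>M {1..k} (\<lambda>_. M)) (B ^ card A) (hom A W)"
proof -
  have "bfun (Pi\<^sub>M {1..k} (\<lambda>_. M)) (B ^ card A) (\<lambda>u. \<Prod>q\<in>A. W (u (fst q), u (snd q)))"
    using assms(1) finite_subset[OF assms(1) finite_edges]
    by (intro bfun_prod bfun_PiM_pair[OF assms(2)]) (auto simp: edges_def)
  then show ?thesis by (simp add: hom_def[abs_def] case_prod_unfold)
qed

text \<open>The parameter \<open>t\<close> ranges over time in the Picard iteration, where the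
  density has to be measurable in time and roots jointly.\<close>

lemma bfun_rooted_param:
  assumes A: "A \<subseteq> edges" and ab: "a \<in> {1..k}" "b \<in> {1..k}" "a \<noteq> b"
    and w: "bfun (N \<Otimes>\<^sub>M (M \<Otimes>\<^sub>M M)) B (\<lambda>(t, p). w t p)"
  shows "bfun (N \<Otimes>\<^sub>M (M \<Otimes>\<^sub>M M)) (B ^ card A) (\<lambda>(t, p). rooted A a b (w t) p)"
proof -
  let ?J = "{1..k} - {a, b}"
  interpret P: prob_space "Pi\<^sub>M ?J (\<lambda>_. M)" by (rule prob_space_PiM_const)
  let ?K = "(N \<Otimes>\<^sub>M (M \<Otimes>\<^sub>M M)) \<Otimes>\<^sub>M Pi\<^sub>M ?J (\<lambda>_. M)"
  have "(\<lambda>q. (snd (fst q), snd q)) \<in> ?K \<rightarrow>\<^sub>M (M \<Otimes>\<^sub>M M) \<Otimes>\<^sub>M Pi\<^sub>M ?J (\<lambda>_. M)"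
    by measurable
  from measurable_compose[OF this measurable_roots[OF ab]]
  have u: "(\<lambda>q. (snd q)(a := fst (snd (fst q)), b := snd (snd (fst q)))) \<in> ?K \<rightarrow>\<^sub>M Pi\<^sub>M {1..k} (\<lambda>_. M)"
    by simp
  have c: "(\<lambda>q. ((snd q)(a := fst (snd (fst q)), b := snd (snd (fst q)))) i) \<in> ?K \<rightarrow>\<^sub>M M"
    if "i \<in> {1..k}" for i
    by (rule measurable_compose[OF u measurable_component_singleton[OF that]])
  let ?u = "\<lambda>q. (snd q)(a := fst (snd (fst q)), b := snd (snd (fst q)))"
  have "bfun ?K (B ^ card A) (\<lambda>q. \<Prod>e\<in>A. w (fst (fst q)) (?u q (fst e), ?u q (snd e)))"
  proof (rule bfun_prod[OF finite_subset[OF A finite_edges]])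
    fix e assume "e \<in> A"
    then have e: "fst e \<in> {1..k}" "snd e \<in> {1..k}" using A by (auto simp: edges_def)
    have "(\<lambda>q. (fst (fst q), (?u q (fst e), ?u q (snd e)))) \<in> ?K \<rightarrow>\<^sub>M N \<Otimes>\<^sub>M (M \<Otimes>\<^sub>M M)"
      by (intro measurable_Pair c e measurable_compose[OF measurable_fst measurable_fst])
    from bfun_comp[OF w this]
    show "bfun ?K B (\<lambda>q. w (fst (fst q)) (?u q (fst e), ?u q (snd e)))" by simp
  qed
  then have "bfun ?K (B ^ card A) (\<lambda>(s, z). hom A (w (fst s)) (z(a := fst (snd s), b := snd (snd s))))"
    by (simp add: hom_def case_prod_unfold)
  from P.bfun_integral[OF this] show ?thesis
    by (simp add: rooted_def case_prod_unfold)
qed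

lemma bfun_rooted:
  assumes "A \<subseteq> edges" "a \<in> {1..k}" "b \<in> {1..k}" "a \<noteq> b" "bfun (M \<Otimes>\<^sub>M M) B W"
  shows "bfun (M \<Otimes>\<^sub>M M) (B ^ card A) (rooted A a b W)"
proof -
  \<comment> \<open>A one-point parameter space gives the version without parameter.\<close>
  have "bfun (count_space {()} \<Otimes>\<^sub>M (M \<Otimes>\<^sub>M M)) B (\<lambda>s. W (snd s))"
    by (rule bfun_comp[OF assms(5)]) simp
  then have "bfun (count_space {()} \<Otimes>\<^sub>M (M \<Otimes>\<^sub>M M)) B (\<lambda>(t, p). W p)" by (simp add: case_prod_unfold)
  from bfun_comp[OF bfun_rooted_param[OF assms(1-4) this], of "\<lambda>p. ((), p)" "M \<Otimes>\<^sub>M M"]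
  show ?thesis by simp
qed

lemma bfun_vel:
  assumes "bfun (M \<Otimes>\<^sub>M M) B W"
  shows "bfun (M \<Otimes>\<^sub>M M) (real (card arcs) * B ^ card edges) (vel W)"
proof -
  have "bfun (M \<Otimes>\<^sub>M M) (real (card arcs) * B ^ card edges)
      (\<lambda>p. \<Sum>e\<in>arcs. rooted edges (fst e) (snd e) W p)"
    using assms by (intro bfun_sum bfun_rooted) (auto simp: arcs_def)
  from bfun_uminus[OF this] show ?thesis by (simp add: vel_def[abs_def] case_prod_unfold)
qed

text \<open>Averaging over the roots as well yields an integral over all tuples, the form that
  \<open>counting_lemma\<close> treats; \<open>h\<close> then acts as a weight.\<close>

lemma integral_rooted:
  assumes A: "A \<subseteq> edges" and ab: "a \<in> {1..k}" "b \<in> {1..k}" "a \<noteq> b"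
    and W: "bfun (M \<Otimes>\<^sub>M M) B W" and h: "bfun (M \<Otimes>\<^sub>M M) C h"
  shows "(LINT p|(M \<Otimes>\<^sub>M M). h p * rooted A a b W p) =
      (LINT u|Pi\<^sub>M {1..k} (\<lambda>_. M). h (u a, u b) * hom A W u)"
proof -
  have b: "bfun (Pi\<^sub>M {1..k} (\<lambda>_. M)) (C * B ^ card A) (\<lambda>u. h (u a, u b) * hom A W u)"
    by (rule bfun_mult[OF bfun_PiM_pair[OF h ab(1,2)] bfun_hom[OF A W]])
  have "(LINT u|Pi\<^sub>M {1..k} (\<lambda>_. M). h (u a, u b) * hom A W u) =
     (LINT p|(M \<Otimes>\<^sub>M M). LINT z|Pi\<^sub>M ({1..k} - {a, b}) (\<lambda>_. M).
        h p * hom A W (z(a := fst p, b := snd p)))"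
    using integral_fun_upd2(1)[of "{1..k} - {a, b}" a b, unfolded insert_roots[OF ab(1,2)],
        OF _ _ _ _ b] ab by simp
  then show ?thesis by (simp add: rooted_def)
qed

text \<open>For almost every tuple, all pairs in \<open>A\<close> lie in the set where
  \<open>U\<close> and \<open>W\<close> agree; Fubini turns this into almost all completions
  \<open>z\<close> for almost all roots \<open>p\<close>.\<close>

lemma AE_rooted_cong:
  assumes A: "A \<subseteq> edges" and ab: "a \<in> {1..k}" "b \<in> {1..k}" "a \<noteq> b"
    and U: "bfun (M \<Otimes>\<^sub>M M) B U" and W: "bfun (M \<Otimes>\<^sub>M M) C W"
    and eq: "AE p in M \<Otimes>\<^sub>M M. U p = W p"
  shows "AE p in M \<Otimes>\<^sub>M M. rooted A a b U p = rooted A a b W p"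
proof -
  let ?J = "{1..k} - {a, b}" and ?I = "{1..k}"
  note [measurable] = bfun_measurable[OF U] bfun_measurable[OF W]
    bfun_measurable[OF bfun_hom[OF A U]] bfun_measurable[OF bfun_hom[OF A W]] measurable_roots[OF ab]
  interpret N: prob_space "Pi\<^sub>M ?J (\<lambda>_. M)" by (rule prob_space_PiM_const)
  interpret Q: prob_space "M \<Otimes>\<^sub>M M" by (rule prob_space_square)
  interpret X: pair_prob_space "M \<Otimes>\<^sub>M M" "Pi\<^sub>M ?J (\<lambda>_. M)" by unfold_locales
  have distr: "distr ((M \<Otimes>\<^sub>M M) \<Otimes>\<^sub>M Pi\<^sub>M ?J (\<lambda>_. M)) (Pi\<^sub>M ?I (\<lambda>_. M))
      (\<lambda>(p, z). z(a := fst p, b := snd p)) = Pi\<^sub>M ?I (\<lambda>_. M)"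
    using distr_fun_upd2[of ?J a b, unfolded insert_roots[OF ab(1,2)]] ab by blast
  have "AE u in Pi\<^sub>M ?I (\<lambda>_. M). \<forall>q\<in>A. U (u (fst q), u (snd q)) = W (u (fst q), u (snd q))"
  proof (rule AE_finite_allI)
    show "finite A" by (rule finite_subset[OF A finite_edges])
    fix q assume "q \<in> A"
    then show "AE u in Pi\<^sub>M ?I (\<lambda>_. M). U (u (fst q), u (snd q)) = W (u (fst q), u (snd q))"
      using A eq by (intro AE_PiM_pair[where P = "\<lambda>p. U p = W p"]) (auto simp: edges_def)
  qed
  then have "AE u in Pi\<^sub>M ?I (\<lambda>_. M). hom A U u = hom A W u"
    by eventually_elim (auto simp: hom_def intro!: prod.cong)
  then have "AE u in distr ((M \<Otimes>\<^sub>M M) \<Otimes>\<^sub>M Pi\<^sub>M ?J (\<lambda>_. M)) (Pi\<^sub>M ?I (\<lambda>_. M))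
      (\<lambda>(p, z). z(a := fst p, b := snd p)). hom A U u = hom A W u"
    unfolding distr .
  then have "AE q in (M \<Otimes>\<^sub>M M) \<Otimes>\<^sub>M Pi\<^sub>M ?J (\<lambda>_. M).
      hom A U ((snd q)(a := fst (fst q), b := snd (fst q))) = hom A W ((snd q)(a := fst (fst q), b := snd (fst q)))"
    by (subst (asm) AE_distr_iff[OF measurable_roots[OF ab]]) (measurable, simp add: case_prod_unfold)
  then have "AE p in M \<Otimes>\<^sub>M M. AE z in Pi\<^sub>M ?J (\<lambda>_. M).
      hom A U (z(a := fst p, b := snd p)) = hom A W (z(a := fst p, b := snd p))"
    using X.AE_pair by fastforce
  moreover have "AE p in M \<Otimes>\<^sub>M M. p \<in> space (M \<Otimes>\<^sub>M M)" by (rule AE_space)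
  ultimately show ?thesis
  proof eventually_elim
    fix p assume ae: "AE z in Pi\<^sub>M ?J (\<lambda>_. M).
        hom A U (z(a := fst p, b := snd p)) = hom A W (z(a := fst p, b := snd p))"
      and p: "p \<in> space (M \<Otimes>\<^sub>M M)"
    note m = measurable_roots_at[OF ab p]
    show "rooted A a b U p = rooted A a b W p"
      unfolding rooted_def
      using ae measurable_compose[OF m bfun_measurable[OF bfun_hom[OF A U]]]
        measurable_compose[OF m bfun_measurable[OF bfun_hom[OF A W]]] by (intro integral_cong_AE)
  qed
qed

lemma AE_vel_cong:
  assumes "bfun (M \<Otimes>\<^sub>M M) B U" "bfun (M \<Otimes>\<^sub>M M) C W" "AE p in M \<Otimes>\<^sub>M M. U p = W p"
  shows "AE p in M \<Otimes>\<^sub>M M. vel U p = vel W p"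
proof -
  have "AE p in M \<Otimes>\<^sub>M M. \<forall>e\<in>arcs. rooted edges (fst e) (snd e) U p = rooted edges (fst e) (snd e) W p"
    using finite_arcs assms by (intro AE_finite_allI AE_rooted_cong) (auto simp: arcs_def)
  then show ?thesis
    by eventually_elim (auto simp: vel_def intro!: sum.cong)
qed

lemma vel_swap: "vel W (y, x) = vel W (x, y)"
proof -
  have r: "rooted edges a b W (y, x) = rooted edges b a W (x, y)" if "(a, b) \<in> arcs" for a b
    using arcsD[OF that] by (simp add: rooted_def fun_upd_twist insert_commute)
  have "(\<Sum>(a, b)\<in>arcs. rooted edges a b W (y, x)) = (\<Sum>(a, b)\<in>arcs. rooted edges a b W (x, y))"
    by (rule sum.reindex_bij_witness[of _ prod.swap prod.swap])
      (auto simp: r, auto simp: arcs_def insert_commute)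
  then show ?thesis by (simp add: vel_def)
qed

lemma kernel_fun_vel: "kernel_fun M W \<Longrightarrow> kernel_fun M (vel W)"
  using bfun_vel[of _ W] vel_swap[of W] bfun_mono
  unfolding kernel_fun_iff_bfun by (metis max.cobounded1 max.cobounded2)

text \<open>A pair outside \<open>F\<close> may or may not be an edge of \<open>G\<close>, which
  contributes \<open>w e + (1 - w e) = 1\<close>. So the induced densities of all supergraphs of
  \<open>F\<close> add up to the homomorphism density; as a polynomial identity this holds for all
  real values of \<open>w\<close>.\<close>

lemma sum_supergraphs:
  fixes w :: "nat \<times> nat \<Rightarrow> real"
  defines "P \<equiv> {(i, j). i \<in> {1..k} \<and> j \<in> {1..k} \<and> i < j}"
  shows "(\<Sum>G\<in>{G \<in> graphs k. F \<subseteq> G}. \<Prod>(i, j)\<in>P. if {i, j} \<in> G then w (i, j) else 1 - w (i, j)) =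
    (\<Prod>e\<in>edges. w e)"
proof -
  define c :: "nat \<times> nat \<Rightarrow> nat set" where "c = (\<lambda>(i, j). {i, j})"
  have fP: "finite P" by (rule finite_subset[of _ "{1..k} \<times> {1..k}"]) (auto simp: P_def)
  have inj: "inj_on c P" by (auto simp: inj_on_def c_def P_def doubleton_eq_iff)
  have gr: "graphs k = Pow (c ` P)"
  proof -
    have "{{i, j} | i j. i \<in> {1..k} \<and> j \<in> {1..k} \<and> i \<noteq> j} = c ` P"
    proof (intro set_eqI iffI)
      fix e assume "e \<in> {{i, j} | i j. i \<in> {1..k} \<and> j \<in> {1..k} \<and> i \<noteq> j}"
      then obtain i j where "e = {i, j}" "i \<in> {1..k}" "j \<in> {1..k}" "i \<noteq> j" by auto
      then have "e = c (min i j, max i j)" "(min i j, max i j) \<in> P"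
        by (auto simp: c_def P_def min_def max_def)
      then show "e \<in> c ` P" by blast
    qed (force simp: c_def P_def)
    then show ?thesis by (simp add: graphs_def)
  qed
  have eP: "edges \<subseteq> P" and eF: "c ` edges \<subseteq> F" and Fe: "F \<subseteq> c ` edges"
    using F_graph unfolding gr by (auto simp: edges_def P_def c_def)
  have "(\<Sum>G\<in>{G \<in> graphs k. F \<subseteq> G}. \<Prod>(i, j)\<in>P. if {i, j} \<in> G then w (i, j) else 1 - w (i, j)) =
      (\<Sum>X\<in>Pow (P - edges). (\<Prod>e\<in>edges. w e) * ((\<Prod>e\<in>X. w e) * (\<Prod>e\<in>(P - edges) - X. 1 - w e)))"
  \<comment> \<open>A supergraph \<open>G\<close> of \<open>F\<close> is encoded by the set
    \<open>X\<close> of its edges outside \<open>F\<close>.\<close>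
  proof (rule sum.reindex_bij_witness[of _ "\<lambda>X. c ` (edges \<union> X)" "\<lambda>G. {e \<in> P - edges. c e \<in> G}"])
    fix G assume G: "G \<in> {G \<in> graphs k. F \<subseteq> G}"
    then show "c ` (edges \<union> {e \<in> P - edges. c e \<in> G}) = G"
      unfolding gr using eP eF Fe by blast
    show "{e \<in> P - edges. c e \<in> G} \<in> Pow (P - edges)" by auto
    let ?X = "{e \<in> P - edges. c e \<in> G}"
    have "(\<Prod>(i, j)\<in>P. if {i, j} \<in> G then w (i, j) else 1 - w (i, j)) = (\<Prod>e\<in>P. if c e \<in> G then w e else 1 - w e)"
      by (intro prod.cong) (auto simp: c_def)
    also have "\<dots> = (\<Prod>e\<in>edges \<union> (?X \<union> (P - edges - ?X)). if c e \<in> G then w e else 1 - w e)"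
      using eP by (intro prod.cong) auto
    also have "\<dots> = (\<Prod>e\<in>edges. if c e \<in> G then w e else 1 - w e) *
        ((\<Prod>e\<in>?X. if c e \<in> G then w e else 1 - w e) * (\<Prod>e\<in>P - edges - ?X. if c e \<in> G then w e else 1 - w e))"
    proof -
      have fin: "finite ?X" "finite (P - edges - ?X)" "finite (?X \<union> (P - edges - ?X))"
        using fP by auto
      have dis: "edges \<inter> (?X \<union> (P - edges - ?X)) = {}" "?X \<inter> (P - edges - ?X) = {}" by auto
      show ?thesis
        by (simp only: prod.union_disjoint[OF finite_edges fin(3) dis(1)]
            prod.union_disjoint[OF fin(1,2) dis(2)])
    qed
    also have "\<dots> = (\<Prod>e\<in>edges. w e) * ((\<Prod>e\<in>?X. w e) * (\<Prod>e\<in>P - edges - ?X. 1 - w e))"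
      using G eF by (intro arg_cong2[where f = "(*)"] prod.cong) auto
    finally show "(\<Prod>e\<in>edges. w e) * ((\<Prod>e\<in>?X. w e) * (\<Prod>e\<in>P - edges - ?X. 1 - w e)) =
      (\<Prod>(i, j)\<in>P. if {i, j} \<in> G then w (i, j) else 1 - w (i, j))" by simp
  next
    fix X assume X: "X \<in> Pow (P - edges)"
    then show "{e \<in> P - edges. c e \<in> c ` (edges \<union> X)} = X"
      using inj eP unfolding inj_on_def by blast
    show "c ` (edges \<union> X) \<in> {G \<in> graphs k. F \<subseteq> G}"
      unfolding gr using X eP Fe by blast
  qed
  also have "\<dots> = (\<Prod>e\<in>edges. w e) * (\<Prod>e\<in>P - edges. w e + (1 - w e))"
    using fP by (subst prod_add) (auto simp: sum_distrib_left)
  finally show ?thesis by simp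
qed

text \<open>A graph \<open>G\<close> changes only if it contains \<open>F\<close>, and then exactly
  the pairs of \<open>F\<close> turn from edges into non-edges: hence the minus sign and the
  restriction to \<open>arcs\<close>. The sum over \<open>G\<close> is then carried out under the
  integral by \<open>sum_supergraphs\<close>.\<close>

lemma velocity_fun_removal:
  assumes W: "bfun (M \<Otimes>\<^sub>M M) B W" and p: "p \<in> space (M \<Otimes>\<^sub>M M)"
  shows "velocity_fun M k (removal_rule F) W p = vel W p"
proof -
  obtain x y where xy: "p = (x, y)" "x \<in> space M" "y \<in> space M"
    using p by (auto simp: space_pair_measure)
  let ?R = "removal_rule F"
  define P2 where "P2 = {(a, b). a \<in> {1..k} \<and> b \<in> {1..k} \<and> a \<noteq> b}"
  define P where "P = {(i, j). i \<in> {1..k} \<and> j \<in> {1..k} \<and> i < j}"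
  have fP: "finite P" by (rule finite_subset[of _ "{1..k} \<times> {1..k}"]) (auto simp: P_def)
  have fP2: "finite P2" by (rule finite_subset[of _ "{1..k} \<times> {1..k}"]) (auto simp: P2_def)
  let ?c = "\<lambda>H G e. of_bool ({fst e, snd e} \<in> H - G) - of_bool ({fst e, snd e} \<in> G - H) :: real"
  let ?t = "\<lambda>G e. t_ind M k G (fst e) (snd e) W x y"
  have "velocity_fun M k ?R W p = (\<Sum>G\<in>graphs k. \<Sum>H\<in>graphs k. \<Sum>e\<in>P2. ?R G H * ?t G e * ?c H G e)"
    by (simp add: velocity_fun_def xy P2_def case_prod_unfold)
  also have "\<dots> = (\<Sum>G\<in>graphs k. \<Sum>e\<in>P2. - (of_bool (F \<subseteq> G) * of_bool ({fst e, snd e} \<in> F) * ?t G e))"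
  proof (rule sum.cong[OF refl])
    fix G assume G: "G \<in> graphs k"
    let ?G' = "if F \<subseteq> G then G - F else G"
    have G': "?G' \<in> graphs k" using G by (auto simp: graphs_def)
    have "(\<Sum>H\<in>graphs k. \<Sum>e\<in>P2. ?R G H * ?t G e * ?c H G e) =
        (\<Sum>H\<in>graphs k. if H = ?G' then (\<Sum>e\<in>P2. ?t G e * ?c H G e) else 0)"
      by (intro sum.cong refl) (auto simp: removal_rule_def)
    also have "\<dots> = (\<Sum>e\<in>P2. ?t G e * ?c ?G' G e)"
      using G' by (simp add: sum.delta[OF finite_graphs])
    also have "\<dots> = (\<Sum>e\<in>P2. - (of_bool (F \<subseteq> G) * of_bool ({fst e, snd e} \<in> F) * ?t G e))"
      by (intro sum.cong refl) auto
    finally show "(\<Sum>H\<in>graphs k. \<Sum>e\<in>P2. ?R G H * ?t G e * ?c H G e) = \<dots>" .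
  qed
  also have "\<dots> = - (\<Sum>e\<in>P2. \<Sum>G\<in>graphs k. of_bool (F \<subseteq> G) * of_bool ({fst e, snd e} \<in> F) * ?t G e)"
    by (subst sum.swap) (simp add: sum_negf)
  also have "(\<Sum>e\<in>P2. \<Sum>G\<in>graphs k. of_bool (F \<subseteq> G) * of_bool ({fst e, snd e} \<in> F) * ?t G e) =
      (\<Sum>e\<in>P2. if e \<in> arcs then (\<Sum>G\<in>{G \<in> graphs k. F \<subseteq> G}. ?t G e) else 0)"
  proof (rule sum.cong[OF refl])
    fix e assume e: "e \<in> P2"
    have "(\<Sum>G\<in>{G \<in> graphs k. F \<subseteq> G}. ?t G e) = (\<Sum>G\<in>graphs k. of_bool (F \<subseteq> G) * ?t G e)"
      by (subst sum.inter_filter[OF finite_graphs]) (auto intro!: sum.cong)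
    then show "(\<Sum>G\<in>graphs k. of_bool (F \<subseteq> G) * of_bool ({fst e, snd e} \<in> F) * ?t G e) =
        (if e \<in> arcs then (\<Sum>G\<in>{G \<in> graphs k. F \<subseteq> G}. ?t G e) else 0)"
      using e by (cases e) (auto simp: arcs_def P2_def)
  qed
  also have "\<dots> = (\<Sum>e\<in>arcs. \<Sum>G\<in>{G \<in> graphs k. F \<subseteq> G}. ?t G e)"
  proof -
    have "{e \<in> P2. e \<in> arcs} = arcs" by (auto simp: arcs_def P2_def)
    then show ?thesis by (subst sum.inter_filter[OF fP2, symmetric]) simp
  qed
  also have "\<dots> = (\<Sum>e\<in>arcs. rooted edges (fst e) (snd e) W p)"
  proof (rule sum.cong[OF refl])
    fix e assume "e \<in> arcs"
    moreover obtain a b where e: "e = (a, b)" by (cases e)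
    ultimately have ab: "a \<in> {1..k}" "b \<in> {1..k}" "a \<noteq> b" by (auto simp: arcs_def)
    let ?J = "{1..k} - {a, b}"
    interpret N: prob_space "Pi\<^sub>M ?J (\<lambda>_. M)" by (rule prob_space_PiM_const)
    have m: "(\<lambda>z. z(a := x, b := y)) \<in> Pi\<^sub>M ?J (\<lambda>_. M) \<rightarrow>\<^sub>M Pi\<^sub>M {1..k} (\<lambda>_. M)"
      using measurable_roots_at[OF ab p] xy by simp
    have i: "integrable (Pi\<^sub>M ?J (\<lambda>_. M)) (\<lambda>z. \<Prod>(i, j)\<in>P. if {i, j} \<in> G then W ((z(a := x, b := y)) i, (z(a := x, b := y)) j)
        else 1 - W ((z(a := x, b := y)) i, (z(a := x, b := y)) j))" for G
    proof -
      have "bfun (Pi\<^sub>M {1..k} (\<lambda>_. M)) ((1 + B) ^ card P) (\<lambda>u. \<Prod>e\<in>P. if {fst e, snd e} \<in> G then W (u (fst e), u (snd e))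
        else 1 - W (u (fst e), u (snd e)))"
      proof (rule bfun_prod[OF fP])
        fix e assume "e \<in> P"
        then have "bfun (Pi\<^sub>M {1..k} (\<lambda>_. M)) B (\<lambda>u. W (u (fst e), u (snd e)))"
          by (intro bfun_PiM_pair[OF W]) (auto simp: P_def)
        from this bfun_diff[OF bfun_const[of _ 1] this]
        show "bfun (Pi\<^sub>M {1..k} (\<lambda>_. M)) (1 + B) (\<lambda>u. if {fst e, snd e} \<in> G then W (u (fst e), u (snd e))
           else 1 - W (u (fst e), u (snd e)))"
          by (cases "{fst e, snd e} \<in> G") (auto intro: bfun_mono)
      qed
      from N.integrable_bfun[OF bfun_comp[OF this m]] show ?thesis by (simp add: case_prod_unfold)
    qed
    have "(\<Sum>G\<in>{G \<in> graphs k. F \<subseteq> G}. ?t G e) = (LINT z|Pi\<^sub>M ?J (\<lambda>_. M).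
        (\<Sum>G\<in>{G \<in> graphs k. F \<subseteq> G}. (\<Prod>(i, j)\<in>P. if {i, j} \<in> G then W ((z(a := x, b := y)) i, (z(a := x, b := y)) j)
        else 1 - W ((z(a := x, b := y)) i, (z(a := x, b := y)) j))))"
      using Bochner_Integration.integral_sum[OF i, of "\<lambda>G. G"] by (simp add: t_ind_def e P_def Let_def)
    also have "\<dots> = rooted edges a b W p"
    proof -
      have "(\<Sum>G\<in>{G \<in> graphs k. F \<subseteq> G}. \<Prod>(i, j)\<in>P. if {i, j} \<in> G then W (u i, u j) else 1 - W (u i, u j)) =
          hom edges W u" for u
        using sum_supergraphs[of "\<lambda>e. W (u (fst e), u (snd e))"]
        by (simp add: P_def hom_def case_prod_unfold cong: if_cong)
      then show ?thesis by (simp only: rooted_def xy fst_conv snd_conv)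
    qed
    finally show "(\<Sum>G\<in>{G \<in> graphs k. F \<subseteq> G}. ?t G e) = rooted edges (fst e) (snd e) W p" by (simp add: e)
  qed
  finally show ?thesis by (simp add: vel_def case_prod_unfold)
qed

section \<open>Lipschitz bound for the velocity in the cut norm\<close>

lemma cut_bound_vel:
  assumes B: "1 \<le> B" and U: "bfun (M \<Otimes>\<^sub>M M) B U" and W: "bfun (M \<Otimes>\<^sub>M M) B W"
    and d: "\<And>S T. S \<in> sets M \<Longrightarrow> T \<in> sets M \<Longrightarrow> \<bar>LINT p:S \<times> T|M \<Otimes>\<^sub>M M. (U p - W p)\<bar> \<le> d"
    and ST: "S \<in> sets M" "T \<in> sets M"
  shows "\<bar>LINT p:S \<times> T|M \<Otimes>\<^sub>M M. (vel U p - vel W p)\<bar>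
     \<le> real (card arcs) * (real (card edges) * (4 * (B ^ card edges)\<^sup>2)) * d"
proof -
  interpret Q: prob_space "M \<Otimes>\<^sub>M M" by (rule prob_space_square)
  interpret N: prob_space "Pi\<^sub>M {1..k} (\<lambda>_. M)" by (rule prob_space_PiM_const)
  \<comment> \<open>The constant of \<open>counting_lemma\<close> with \<open>c = 1\<close>, as the
    weight is the indicator of a rectangle at the roots.\<close>
  let ?K = "real (card edges) * (4 * (1 * B ^ card edges)\<^sup>2 * d)"
  have ind: "bfun (M \<Otimes>\<^sub>M M) 1 (indicator (S \<times> T))" using ST by (intro bfun_indicator) auto
  have bd: "\<bar>LINT p|(M \<Otimes>\<^sub>M M). indicator (S \<times> T) p * (rooted edges a b U p - rooted edges a b W p)\<bar> \<le> ?K"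
    and i: "integrable (M \<Otimes>\<^sub>M M) (\<lambda>p. indicator (S \<times> T) p * (rooted edges a b U p - rooted edges a b W p))"
    if "(a, b) \<in> arcs" for a b
  proof -
    have ab: "a \<in> {1..k}" "b \<in> {1..k}" "a \<noteq> b" using arcsD[OF that] by auto
    let ?h = "\<lambda>u. indicator (S \<times> T) (u a, u b) :: real"
    note bU = bfun_mult[OF ind bfun_rooted[OF subset_refl ab U]]
      and bW = bfun_mult[OF ind bfun_rooted[OF subset_refl ab W]]
    show "integrable (M \<Otimes>\<^sub>M M) (\<lambda>p. indicator (S \<times> T) p * (rooted edges a b U p - rooted edges a b W p))"
      using Bochner_Integration.integrable_diff[OF Q.integrable_bfun[OF bU] Q.integrable_bfun[OF bW]]
      by (simp add: algebra_simps)
    have hU: "integrable (Pi\<^sub>M {1..k} (\<lambda>_. M)) (\<lambda>u. ?h u * hom edges U u)"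
      "integrable (Pi\<^sub>M {1..k} (\<lambda>_. M)) (\<lambda>u. ?h u * hom edges W u)"
      by (rule N.integrable_bfun[OF bfun_mult[OF bfun_PiM_pair[OF ind ab(1,2)] bfun_hom[OF subset_refl]]];
          fact)+
    have "(LINT p|(M \<Otimes>\<^sub>M M). indicator (S \<times> T) p * (rooted edges a b U p - rooted edges a b W p)) =
      (LINT p|(M \<Otimes>\<^sub>M M). indicator (S \<times> T) p * rooted edges a b U p) -
      (LINT p|(M \<Otimes>\<^sub>M M). indicator (S \<times> T) p * rooted edges a b W p)"
      using Bochner_Integration.integral_diff[OF Q.integrable_bfun[OF bU] Q.integrable_bfun[OF bW]]
      by (simp add: right_diff_distrib)
    also have "\<dots> = (LINT u|Pi\<^sub>M {1..k} (\<lambda>_. M). ?h u * hom edges U u) - (LINT u|Pi\<^sub>M {1..k} (\<lambda>_. M). ?h u * hom edges W u)"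
      by (simp add: integral_rooted[OF subset_refl ab U ind] integral_rooted[OF subset_refl ab W ind])
    also have "\<dots> = (LINT u|Pi\<^sub>M {1..k} (\<lambda>_. M). ?h u * (hom edges U u - hom edges W u))"
      using hU by (simp add: right_diff_distrib)
    also have "\<bar>\<dots>\<bar> \<le> ?K"
      unfolding hom_def
    proof (rule counting_lemma[OF _ finite_edges _ B U W d])
      show "edges \<subseteq> {(i, j). i \<in> {1..k} \<and> j \<in> {1..k} \<and> i < j}" by (auto simp: edges_def)
      show "bfun (Pi\<^sub>M {1..k} (\<lambda>_. M)) 1 ?h" by (rule bfun_PiM_pair[OF ind ab(1,2)])
      fix i j assume "(i, j) \<in> edges"
      then have "i \<noteq> j" by (auto simp: edges_def)
      \<comment> \<open>The indicator of a rectangle is a product of functions of one coordinate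
        each, so it splits at every edge, even at the root edge. An arbitrary set of pairs in place
        of \<open>S \<times> T\<close> would not.\<close>
      then have "splits {1..k} i j (1 * 1) (\<lambda>u. indicator S (u a) * indicator T (u b))"
        using ab ST by (intro splits_mult splits_single bfun_indicator) auto
      then show "splits {1..k} i j 1 ?h" by (simp add: indicator_times)
    qed auto
    finally show "\<bar>LINT p|(M \<Otimes>\<^sub>M M). indicator (S \<times> T) p * (rooted edges a b U p - rooted edges a b W p)\<bar> \<le> ?K" .
  qed
  have "(LINT p:S \<times> T|M \<Otimes>\<^sub>M M. (vel U p - vel W p)) = - (LINT p|(M \<Otimes>\<^sub>M M). (\<Sum>(a, b)\<in>arcs.
      indicator (S \<times> T) p * (rooted edges a b U p - rooted edges a b W p)))"
    unfolding set_lebesgue_integral_def vel_def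
    by (subst Bochner_Integration.integral_minus[symmetric], intro Bochner_Integration.integral_cong)
      (auto simp: case_prod_unfold sum_subtractf sum_distrib_left[symmetric] algebra_simps)
  also have "\<dots> = - (\<Sum>(a, b)\<in>arcs. LINT p|(M \<Otimes>\<^sub>M M).
      indicator (S \<times> T) p * (rooted edges a b U p - rooted edges a b W p))"
    unfolding case_prod_unfold using i by (subst Bochner_Integration.integral_sum) auto
  also have "\<bar>\<dots>\<bar> \<le> (\<Sum>(a, b)\<in>arcs. ?K)"
    unfolding abs_minus_cancel case_prod_unfold using bd by (intro order_trans[OF sum_abs] sum_mono) auto
  also have "\<dots> = real (card arcs) * (real (card edges) * (4 * (B ^ card edges)\<^sup>2)) * d"
    by (simp add: case_prod_unfold algebra_simps)
  finally show ?thesis .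
qed

end

section \<open>Stability and uniqueness of trajectories\<close>

text \<open>On an interval of length \<open>1 / (2C)\<close> starting at \<open>s\<close> the supremum \<open>A\<close> of \<open>f\<close> satisfies
  \<open>A \<le> f s + A / 2\<close>, so \<open>f\<close> at most doubles there.\<close>

lemma gronwall_family:
  fixes h h' :: "'i \<Rightarrow> real \<Rightarrow> real" and f :: "real \<Rightarrow> real"
  assumes der: "\<And>i t. i \<in> I \<Longrightarrow> 0 \<le> t \<Longrightarrow> (h i has_real_derivative h' i t) (at t within {0..})"
    and h': "\<And>i t. i \<in> I \<Longrightarrow> 0 \<le> t \<Longrightarrow> t \<le> T \<Longrightarrow> \<bar>h' i t\<bar> \<le> C * f t"
    and ub: "\<And>i t. i \<in> I \<Longrightarrow> 0 \<le> t \<Longrightarrow> t \<le> T \<Longrightarrow> \<bar>h i t\<bar> \<le> f t"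
    and least: "\<And>t c. 0 \<le> t \<Longrightarrow> t \<le> T \<Longrightarrow> (\<And>i. i \<in> I \<Longrightarrow> \<bar>h i t\<bar> \<le> c) \<Longrightarrow> f t \<le> c"
    and bdd: "\<And>t. 0 \<le> t \<Longrightarrow> t \<le> T \<Longrightarrow> f t \<le> K"
    and nn: "\<And>t. 0 \<le> t \<Longrightarrow> t \<le> T \<Longrightarrow> 0 \<le> f t" and C: "0 < C"
  shows "0 \<le> t \<Longrightarrow> t \<le> T \<Longrightarrow> t \<le> real n / (2 * C) \<Longrightarrow> f t \<le> 2 ^ n * f 0"
proof (induction n arbitrary: t)
  case 0
  then show ?case by simp
next
  case (Suc n)
  define s where "s = real n / (2 * C)"
  have s0: "0 \<le> s" using C by (simp add: s_def)
  have f0: "0 \<le> f 0" using nn[of 0] Suc.prems by simp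
  show ?case
  proof (cases "t \<le> s")
    case True
    then have "f t \<le> 2 ^ n * f 0" using Suc by (simp add: s_def)
    also have "\<dots> \<le> 2 ^ Suc n * f 0" using f0 by simp
    finally show ?thesis .
  next
    case False
    define A where "A = (SUP r\<in>{s..t}. f r)"
    have bd: "bdd_above (f ` {s..t})"
      using bdd s0 Suc.prems by (intro bdd_aboveI[of _ K]) auto
    have fA: "f r \<le> A" if "r \<in> {s..t}" for r
      unfolding A_def using that bd by (intro cSUP_upper)
    have fs: "f s \<le> 2 ^ n * f 0"
      using Suc.IH[of s] s0 False Suc.prems by (simp add: s_def)
    have step: "f r \<le> f s + A / 2" if r: "r \<in> {s..t}" for r
    proof (rule least)
      show "0 \<le> r" "r \<le> T" using r s0 Suc.prems by auto
      fix i assume i: "i \<in> I"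
      have A0: "0 \<le> A" using fA[of s] nn[of s] s0 False Suc.prems by force
      have "norm (h i r - h i s) \<le> (C * A) * norm (r - s)"
      proof (rule field_differentiable_bound[where S = "{s..t}" and f' = "h' i"])
        fix z assume z: "z \<in> {s..t}"
        show "(h i has_real_derivative h' i z) (at z within {s..t})"
          using z s0 by (intro DERIV_subset[OF der[OF i]]) auto
        have "\<bar>h' i z\<bar> \<le> C * f z" using z s0 Suc.prems by (intro h' i) auto
        also have "\<dots> \<le> C * A" using fA[OF z] C by simp
        finally show "norm (h' i z) \<le> C * A" by simp
      qed (use r False in auto)
      also have "\<dots> \<le> (C * A) * (1 / (2 * C))"
      proof (rule mult_left_mono)
        have "t \<le> s + 1 / (2 * C)" using Suc.prems(3) by (simp add: s_def add_divide_distrib)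
        then show "norm (r - s) \<le> 1 / (2 * C)" using r by auto
      qed (use A0 C in simp)
      also have "\<dots> = A / 2" using C by simp
      finally have "\<bar>h i r - h i s\<bar> \<le> A / 2" by simp
      moreover have "\<bar>h i s\<bar> \<le> f s" using s0 False Suc.prems by (intro ub i) auto
      ultimately show "\<bar>h i r\<bar> \<le> f s + A / 2" by linarith
    qed
    have "A \<le> f s + A / 2"
      unfolding A_def by (rule cSUP_least) (use False step A_def in auto)
    then have "A \<le> 2 * f s" by simp
    moreover have "f t \<le> A" using False by (intro fA) auto
    ultimately show ?thesis using fs by simp
  qed
qed

lemma (in prob_space) abs_set_integral_AE_le:
  fixes f :: "'a \<Rightarrow> real"
  assumes "integrable M f" "AE x in M. \<bar>f x\<bar> \<le> c" "A \<in> sets M"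
  shows "\<bar>LINT x:A|M. f x\<bar> \<le> c"
proof -
  have "\<bar>LINT x:A|M. f x\<bar> \<le> (LINT x|M. \<bar>indicator A x *\<^sub>R f x\<bar>)"
    unfolding set_lebesgue_integral_def by (rule integral_abs_bound)
  also have "\<dots> \<le> (LINT x|M. c)"
  proof (rule integral_mono_AE)
    show "integrable M (\<lambda>x. \<bar>indicator A x *\<^sub>R f x\<bar>)"
      using assms by (intro integrable_abs integrable_mult_indicator)
    show "AE x in M. \<bar>indicator A x *\<^sub>R f x\<bar> \<le> c"
      using assms(2) by eventually_elim (auto simp: indicator_def intro: order_trans[OF abs_ge_zero])
  qed simp
  finally show ?thesis by (simp add: prob_space)
qed

lemma set_integral_cong_AE2:
  assumes "U \<in> borel_measurable N" "W \<in> borel_measurable N" "A \<in> sets N" "AE x in N. U x = (W x :: real)"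
  shows "(LINT x:A|N. U x) = (LINT x:A|N. W x)"
  unfolding set_lebesgue_integral_def using assms by (intro integral_cong_AE) auto

lemma kernel_fun_cong:
  assumes "\<And>p. p \<in> space (M \<Otimes>\<^sub>M M) \<Longrightarrow> U p = W p"
  shows "kernel_fun M U \<longleftrightarrow> kernel_fun M W"
proof -
  have "bfun (M \<Otimes>\<^sub>M M) B U \<longleftrightarrow> bfun (M \<Otimes>\<^sub>M M) B W" for B by (rule bfun_cong[OF assms])
  then show ?thesis using assms unfolding kernel_fun_iff_bfun by (simp add: space_pair_measure)
qed

context removal
begin

abbreviation "rule \<equiv> removal_rule F"

text \<open>\<open>velocity\<close> is defined through the arbitrary choice \<open>rep\<close>; this
  allows any representative that is easier to bound.\<close>

lemma velocity_removal:
  assumes X: "X \<in> kernels M" and W: "kernel_fun M W" and eq: "AE p in M \<Otimes>\<^sub>M M. rep X p = W p"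
  shows "velocity M k rule X \<in> kernels M" "AE p in M \<Otimes>\<^sub>M M. rep (velocity M k rule X) p = vel W p"
proof -
  obtain B where B: "bfun (M \<Otimes>\<^sub>M M) B (rep X)"
    using kernel_fun_rep[OF X] by (auto simp: kernel_fun_iff_bfun)
  obtain C where C: "bfun (M \<Otimes>\<^sub>M M) C W" using W by (auto simp: kernel_fun_iff_bfun)
  have kf: "kernel_fun M (velocity_fun M k rule (rep X))"
    using kernel_fun_cong[of M "velocity_fun M k rule (rep X)" "vel (rep X)"]
      velocity_fun_removal[OF B] kernel_fun_vel[OF kernel_fun_rep[OF X]] by blast
  then show "velocity M k rule X \<in> kernels M"
    unfolding velocity_def by (rule kernel_class_in_kernels)
  have "AE p in M \<Otimes>\<^sub>M M. rep (velocity M k rule X) p = velocity_fun M k rule (rep X) p"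
    unfolding velocity_def by (rule rep_kernel_class[OF kf])
  moreover have "AE p in M \<Otimes>\<^sub>M M. velocity_fun M k rule (rep X) p = vel (rep X) p"
    using velocity_fun_removal[OF B] by (rule AE_I2)
  ultimately show "AE p in M \<Otimes>\<^sub>M M. rep (velocity M k rule X) p = vel W p"
    using AE_vel_cong[OF B C eq] by eventually_elim simp
qed

lemma has_linf_derivative_eventually:
  assumes "has_linf_derivative M \<phi> D t" "0 < e"
  shows "\<forall>\<^sub>F s in at t within {0..}. AE p in M \<Otimes>\<^sub>M M.
    \<bar>(rep (\<phi> s) p - rep (\<phi> t) p) / (s - t) - rep D p\<bar> \<le> e"
proof -
  have "\<forall>\<^sub>F s in at t within {0..}.
      linf_norm M (\<lambda>p. (rep (\<phi> s) p - rep (\<phi> t) p) / (s - t) - rep D p) < ereal e"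
    using assms unfolding has_linf_derivative_def by (intro order_tendstoD) auto
  then show ?thesis
  proof eventually_elim
    fix s assume s: "linf_norm M (\<lambda>p. (rep (\<phi> s) p - rep (\<phi> t) p) / (s - t) - rep D p) < ereal e"
    have "AE p in M \<Otimes>\<^sub>M M. ereal \<bar>(rep (\<phi> s) p - rep (\<phi> t) p) / (s - t) - rep D p\<bar>
        \<le> linf_norm M (\<lambda>p. (rep (\<phi> s) p - rep (\<phi> t) p) / (s - t) - rep D p)"
      unfolding linf_norm_def by (rule esssup_AE)
    then show "AE p in M \<Otimes>\<^sub>M M. \<bar>(rep (\<phi> s) p - rep (\<phi> t) p) / (s - t) - rep D p\<bar> \<le> e"
    proof eventually_elim
      fix p assume "ereal \<bar>(rep (\<phi> s) p - rep (\<phi> t) p) / (s - t) - rep D p\<bar>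
        \<le> linf_norm M (\<lambda>p. (rep (\<phi> s) p - rep (\<phi> t) p) / (s - t) - rep D p)"
      from order_le_less_trans[OF this s]
      show "\<bar>(rep (\<phi> s) p - rep (\<phi> t) p) / (s - t) - rep D p\<bar> \<le> e" by simp
    qed
  qed
qed

lemma is_trajectoryD:
  assumes "is_trajectory M k rule X \<phi>"
  shows "\<phi> 0 = X" "0 \<le> t \<Longrightarrow> \<phi> t \<in> kernels M"
    "0 \<le> t \<Longrightarrow> has_linf_derivative M \<phi> (velocity M k rule (\<phi> t)) t"
    "0 \<le> t \<Longrightarrow> velocity M k rule (\<phi> t) \<in> kernels M"
  using assms velocity_removal(1)[OF _ kernel_fun_rep AE_I2] unfolding is_trajectory_def by auto

text \<open>Integration over \<open>A\<close> is a linear functional of norm at most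
  \<open>1\<close> for the supremum norm, so it preserves derivatives.\<close>

lemma has_derivative_set_integral_trajectory:
  assumes tr: "is_trajectory M k rule X \<phi>" and A: "A \<in> sets (M \<Otimes>\<^sub>M M)" and t: "0 \<le> t"
  shows "((\<lambda>s. LINT p:A|M \<Otimes>\<^sub>M M. rep (\<phi> s) p) has_real_derivative
    (LINT p:A|M \<Otimes>\<^sub>M M. rep (velocity M k rule (\<phi> t)) p)) (at t within {0..})"
proof -
  interpret Q: prob_space "M \<Otimes>\<^sub>M M" by (rule prob_space_square)
  let ?D = "velocity M k rule (\<phi> t)" and ?I = "\<lambda>X. LINT p:A|M \<Otimes>\<^sub>M M. rep X p"
  have int: "integrable (M \<Otimes>\<^sub>M M) (rep Y)" if "Y \<in> kernels M" for Y
    using integrable_kernel[OF kernel_fun_rep[OF that]] .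
  have sint: "set_integrable (M \<Otimes>\<^sub>M M) A (rep Y)" if "Y \<in> kernels M" for Y
    unfolding set_integrable_def using A int[OF that] by (rule integrable_mult_indicator)
  show ?thesis
    unfolding has_field_derivative_iff
  proof (rule tendstoI)
    fix e :: real assume e: "0 < e"
    have "\<forall>\<^sub>F s in at t within {0..}. s \<in> {0..} \<and> s \<noteq> t"
      by (simp add: eventually_at_filter)
    moreover have "\<forall>\<^sub>F s in at t within {0..}. AE p in M \<Otimes>\<^sub>M M.
        \<bar>(rep (\<phi> s) p - rep (\<phi> t) p) / (s - t) - rep ?D p\<bar> \<le> e / 2"
      using is_trajectoryD(3)[OF tr t] e by (intro has_linf_derivative_eventually) auto
    ultimately show "\<forall>\<^sub>F s in at t within {0..}. dist ((?I (\<phi> s) - ?I (\<phi> t)) / (s - t)) (?I ?D) < e"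
    proof eventually_elim
      fix s assume s: "s \<in> {0..} \<and> s \<noteq> t" and
        ae: "AE p in M \<Otimes>\<^sub>M M. \<bar>(rep (\<phi> s) p - rep (\<phi> t) p) / (s - t) - rep ?D p\<bar> \<le> e / 2"
      have k: "\<phi> s \<in> kernels M" "\<phi> t \<in> kernels M" "?D \<in> kernels M"
        using s t is_trajectoryD[OF tr] by auto
      have "(?I (\<phi> s) - ?I (\<phi> t)) / (s - t) - ?I ?D =
          (LINT p:A|M \<Otimes>\<^sub>M M. ((rep (\<phi> s) p - rep (\<phi> t) p) / (s - t) - rep ?D p))"
        using k sint by (simp add: set_integral_diff)
      also have "\<bar>\<dots>\<bar> \<le> e / 2"
        using k int A by (intro Q.abs_set_integral_AE_le[OF _ ae]) auto
      finally show "dist ((?I (\<phi> s) - ?I (\<phi> t)) / (s - t)) (?I ?D) < e"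
        using e by (simp add: dist_real_def)
    qed
  qed
qed

text \<open>Each kernel on the trajectory has its own bound, and differentiability at
  \<open>t\<close> extends the bound at \<open>t\<close> to a neighbourhood. Compactness of
  \<open>[0, T]\<close>, in the form of bisection, makes it uniform.\<close>

lemma trajectory_locally_bounded:
  assumes tr: "is_trajectory M k rule X \<phi>" and T: "0 \<le> T"
  obtains B where "1 \<le> B" "\<And>t. t \<in> {0..T} \<Longrightarrow> AE p in M \<Otimes>\<^sub>M M. \<bar>rep (\<phi> t) p\<bar> \<le> B"
proof -
  have ker: "\<exists>B\<ge>1. AE p in M \<Otimes>\<^sub>M M. \<bar>rep Y p\<bar> \<le> B" if "Y \<in> kernels M" for Y
    using kernel_fun_rep[OF that] bfun_bound[of "M \<Otimes>\<^sub>M M" _ "rep Y"]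
    unfolding kernel_fun_iff_bfun by (metis AE_I2)
  \<comment> \<open>The premise \<open>0 \<le> t\<close> is there because the small intervals of
    \<open>Bolzano\<close> around a point near \<open>0\<close> may begin at a negative
    time.\<close>
  define bd where "bd a b \<longleftrightarrow> (\<exists>B. \<forall>t\<in>{a..b}. 0 \<le> t \<longrightarrow> (AE p in M \<Otimes>\<^sub>M M. \<bar>rep (\<phi> t) p\<bar> \<le> B))" for a b
  have "bd 0 T"
    using T
  proof (induction rule: Bolzano)
    case (trans a b c)
    then obtain B C where BC: "\<forall>t\<in>{a..b}. 0 \<le> t \<longrightarrow> (AE p in M \<Otimes>\<^sub>M M. \<bar>rep (\<phi> t) p\<bar> \<le> B)"
      "\<forall>t\<in>{b..c}. 0 \<le> t \<longrightarrow> (AE p in M \<Otimes>\<^sub>M M. \<bar>rep (\<phi> t) p\<bar> \<le> C)" by (auto simp: bd_def)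
    show ?case unfolding bd_def
    proof (intro exI[of _ "max B C"] ballI impI)
      fix t assume t: "t \<in> {a..c}" "0 \<le> t"
      show "AE p in M \<Otimes>\<^sub>M M. \<bar>rep (\<phi> t) p\<bar> \<le> max B C"
      proof (cases "t \<le> b")
        case True
        then have "AE p in M \<Otimes>\<^sub>M M. \<bar>rep (\<phi> t) p\<bar> \<le> B" using t BC by auto
        then show ?thesis by eventually_elim simp
      next
        case False
        then have "AE p in M \<Otimes>\<^sub>M M. \<bar>rep (\<phi> t) p\<bar> \<le> C" using t BC by auto
        then show ?thesis by eventually_elim simp
      qed
    qed
  next
    case (local t)
    let ?D = "velocity M k rule (\<phi> t)"
    obtain B where B: "AE p in M \<Otimes>\<^sub>M M. \<bar>rep (\<phi> t) p\<bar> \<le> B"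
      using ker is_trajectoryD(2)[OF tr] local by blast
    obtain C where C: "1 \<le> C" "AE p in M \<Otimes>\<^sub>M M. \<bar>rep ?D p\<bar> \<le> C"
      using ker is_trajectoryD(4)[OF tr] local by blast
    have "\<forall>\<^sub>F s in at t within {0..}. AE p in M \<Otimes>\<^sub>M M.
        \<bar>(rep (\<phi> s) p - rep (\<phi> t) p) / (s - t) - rep ?D p\<bar> \<le> 1"
      using is_trajectoryD(3)[OF tr] local by (intro has_linf_derivative_eventually) auto
    then obtain d where d: "0 < d" "\<And>s. s \<in> {0..} \<Longrightarrow> s \<noteq> t \<Longrightarrow> dist s t < d \<Longrightarrow>
        AE p in M \<Otimes>\<^sub>M M. \<bar>(rep (\<phi> s) p - rep (\<phi> t) p) / (s - t) - rep ?D p\<bar> \<le> 1"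
      unfolding eventually_at by blast
    \<comment> \<open>The difference quotient at \<open>t\<close> is at most \<open>1 + C\<close> in
      absolute value, and the time step is below \<open>d\<close>.\<close>
    have bnd: "AE p in M \<Otimes>\<^sub>M M. \<bar>rep (\<phi> s) p\<bar> \<le> B + d * (1 + C)" if s: "0 \<le> s" "dist s t < d" for s
    proof (cases "s = t")
      case True
      have "0 \<le> d * (1 + C)" using d C by simp
      then show ?thesis using B True by (auto elim!: eventually_mono)
    next
      case False
      then have "AE p in M \<Otimes>\<^sub>M M. \<bar>(rep (\<phi> s) p - rep (\<phi> t) p) / (s - t) - rep ?D p\<bar> \<le> 1"
        using d s by auto
      then show ?thesis using B C(2)
      proof eventually_elim
        fix p assume 1: "\<bar>(rep (\<phi> s) p - rep (\<phi> t) p) / (s - t) - rep ?D p\<bar> \<le> 1"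
          "\<bar>rep (\<phi> t) p\<bar> \<le> B" "\<bar>rep ?D p\<bar> \<le> C"
        then have "\<bar>(rep (\<phi> s) p - rep (\<phi> t) p) / (s - t)\<bar> \<le> 1 + C" by linarith
        then have "\<bar>rep (\<phi> s) p - rep (\<phi> t) p\<bar> \<le> (1 + C) * \<bar>s - t\<bar>"
          using False by (simp add: abs_divide divide_le_eq)
        also have "\<dots> \<le> (1 + C) * d"
          using s C by (intro mult_left_mono) (auto simp: dist_real_def)
        finally show "\<bar>rep (\<phi> s) p\<bar> \<le> B + d * (1 + C)" using 1(2) by (simp add: algebra_simps)
      qed
    qed
    show ?case
    proof (intro exI[of _ d] conjI allI impI d(1))
      fix a b assume ab: "a \<le> t \<and> t \<le> b \<and> b - a < d"
      then show "bd a b"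
        unfolding bd_def using bnd
        by (intro exI[of _ "B + d * (1 + C)"]) (auto simp: dist_real_def)
    qed
  qed
  then obtain B where B: "\<And>t. t \<in> {0..T} \<Longrightarrow> 0 \<le> t \<longrightarrow> (AE p in M \<Otimes>\<^sub>M M. \<bar>rep (\<phi> t) p\<bar> \<le> B)"
    unfolding bd_def by blast
  show ?thesis
  proof (rule that[of "max 1 B"])
    fix t assume t: "t \<in> {0..T}"
    then have "AE p in M \<Otimes>\<^sub>M M. \<bar>rep (\<phi> t) p\<bar> \<le> B" using B by simp
    then show "AE p in M \<Otimes>\<^sub>M M. \<bar>rep (\<phi> t) p\<bar> \<le> max 1 B" by eventually_elim simp
  qed simp
qed

text \<open>Turns an almost everywhere bound into one that holds everywhere, as \<open>bfun\<close>
  demands, without leaving the class.\<close>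

definition clamp :: "real \<Rightarrow> ('a \<times> 'a \<Rightarrow> real) \<Rightarrow> 'a \<times> 'a \<Rightarrow> real" where
  "clamp B W p = max (- B) (min B (W p))"

lemma clamp:
  assumes "kernel_fun M W" "0 \<le> B"
  shows "bfun (M \<Otimes>\<^sub>M M) B (clamp B W)" "kernel_fun M (clamp B W)"
proof -
  show b: "bfun (M \<Otimes>\<^sub>M M) B (clamp B W)"
    using assms unfolding clamp_def[abs_def] bfun_def kernel_fun_def by auto
  show "kernel_fun M (clamp B W)"
    using assms b unfolding kernel_fun_def clamp_def bfun_def by auto
qed

text \<open>The constant of \<open>cut_bound_vel\<close>; the summand \<open>1\<close> makes it
  positive for every \<open>B\<close>, as it ends up in the denominator of a time step.\<close>

definition cut_lip :: "real \<Rightarrow> real" where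
  "cut_lip B = real (card arcs) * (real (card edges) * (4 * (B ^ card edges)\<^sup>2)) + 1"

lemma cut_bound_velocity:
  assumes B: "1 \<le> B" and X: "X \<in> kernels M" "AE p in M \<Otimes>\<^sub>M M. \<bar>rep X p\<bar> \<le> B"
    and Y: "Y \<in> kernels M" "AE p in M \<Otimes>\<^sub>M M. \<bar>rep Y p\<bar> \<le> B"
    and ST: "S \<in> sets M" "T \<in> sets M"
  shows "\<bar>LINT p:S \<times> T|M \<Otimes>\<^sub>M M. (rep (velocity M k rule X) p - rep (velocity M k rule Y) p)\<bar>
    \<le> cut_lip B * cut_dist M X Y"
proof -
  define u v where "u = clamp B (rep X)" and "v = clamp B (rep Y)"
  note ku = clamp[OF kernel_fun_rep[OF X(1)], of B, folded u_def]
    and kv = clamp[OF kernel_fun_rep[OF Y(1)], of B, folded v_def]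
  have aeu: "AE p in M \<Otimes>\<^sub>M M. rep X p = u p"
    using X(2) by eventually_elim (auto simp: u_def clamp_def)
  have aev: "AE p in M \<Otimes>\<^sub>M M. rep Y p = v p"
    using Y(2) by eventually_elim (auto simp: v_def clamp_def)
  have kX: "velocity M k rule X \<in> kernels M" "AE p in M \<Otimes>\<^sub>M M. rep (velocity M k rule X) p = vel u p"
    and kY: "velocity M k rule Y \<in> kernels M" "AE p in M \<Otimes>\<^sub>M M. rep (velocity M k rule Y) p = vel v p"
    using velocity_removal X(1) Y(1) ku(2) kv(2) aeu aev B by auto
  have meas: "W \<in> borel_measurable (M \<Otimes>\<^sub>M M)" if "kernel_fun M W" for W
    using that by (simp add: kernel_fun_def)
  note [measurable] = meas[OF kernel_fun_rep[OF X(1)]] meas[OF kernel_fun_rep[OF Y(1)]]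
    meas[OF kernel_fun_rep[OF kX(1)]] meas[OF kernel_fun_rep[OF kY(1)]]
  have B0: "0 \<le> B" using B by simp
  note [measurable] = meas[OF ku(2)[OF B0]] meas[OF kv(2)[OF B0]]
    meas[OF kernel_fun_vel[OF ku(2)[OF B0]]] meas[OF kernel_fun_vel[OF kv(2)[OF B0]]]
  have "(LINT p:S \<times> T|M \<Otimes>\<^sub>M M. (rep (velocity M k rule X) p - rep (velocity M k rule Y) p)) =
      (LINT p:S \<times> T|M \<Otimes>\<^sub>M M. (vel u p - vel v p))"
  proof (rule set_integral_cong_AE2)
    show "AE p in M \<Otimes>\<^sub>M M. rep (velocity M k rule X) p - rep (velocity M k rule Y) p = vel u p - vel v p"
      using kX(2) kY(2) by eventually_elim simp
  qed (use ST in measurable)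
  also have "\<bar>\<dots>\<bar> \<le> real (card arcs) * (real (card edges) * (4 * (B ^ card edges)\<^sup>2)) * cut_dist M X Y"
  proof (rule cut_bound_vel[OF B ku(1)[OF B0] kv(1)[OF B0] _ ST])
    fix S T assume ST: "S \<in> sets M" "T \<in> sets M"
    have "(LINT p:S \<times> T|M \<Otimes>\<^sub>M M. (u p - v p)) = (LINT p:S \<times> T|M \<Otimes>\<^sub>M M. (rep X p - rep Y p))"
    proof (rule set_integral_cong_AE2)
      show "AE p in M \<Otimes>\<^sub>M M. u p - v p = rep X p - rep Y p"
        using aeu aev by eventually_elim simp
    qed (use ST in measurable)
    then show "\<bar>LINT p:S \<times> T|M \<Otimes>\<^sub>M M. (u p - v p)\<bar> \<le> cut_dist M X Y"
      using cut_dist_upper[OF X(1) Y(1) ST] by simp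
  qed
  also have "\<dots> \<le> cut_lip B * cut_dist M X Y"
    using cut_dist_nonneg[OF X(1) Y(1)] by (simp add: cut_lip_def algebra_simps)
  finally show ?thesis .
qed

text \<open>The cut distance is a supremum over rectangles and need not be differentiable in time.
  The integral over each single rectangle is differentiable, with derivative bounded by
  \<open>cut_lip B\<close> times the cut distance; this is the reason for the family form of
  Gronwall's inequality.\<close>

lemma trajectory_cut_stability:
  assumes \<phi>: "is_trajectory M k rule X \<phi>" and \<psi>: "is_trajectory M k rule Y \<psi>" and B: "1 \<le> B"
    and bd: "\<And>t. t \<in> {0..T} \<Longrightarrow> AE p in M \<Otimes>\<^sub>M M. \<bar>rep (\<phi> t) p\<bar> \<le> B"
      "\<And>t. t \<in> {0..T} \<Longrightarrow> AE p in M \<Otimes>\<^sub>M M. \<bar>rep (\<psi> t) p\<bar> \<le> B"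
    and T: "0 \<le> T" "T \<le> real n / (2 * cut_lip B)"
  shows "cut_dist M (\<phi> T) (\<psi> T) \<le> 2 ^ n * cut_dist M X Y"
proof -
  interpret Q: prob_space "M \<Otimes>\<^sub>M M" by (rule prob_space_square)
  have C: "0 < cut_lip B" unfolding cut_lip_def by (intro add_nonneg_pos) auto
  note k = is_trajectoryD(2)[OF \<phi>] is_trajectoryD(2)[OF \<psi>]
  note kv = is_trajectoryD(4)[OF \<phi>] is_trajectoryD(4)[OF \<psi>]
  have si: "set_integrable (M \<Otimes>\<^sub>M M) (S \<times> T) (rep Z)"
    if "Z \<in> kernels M" "S \<in> sets M" "T \<in> sets M" for Z S T
    unfolding set_integrable_def using that
    by (intro integrable_mult_indicator integrable_kernel kernel_fun_rep) auto
  have "cut_dist M (\<phi> T) (\<psi> T) \<le> 2 ^ n * cut_dist M (\<phi> 0) (\<psi> 0)"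
  proof (rule gronwall_family[where I = "sets M \<times> sets M" and f = "\<lambda>t. cut_dist M (\<phi> t) (\<psi> t)"
        and h = "\<lambda>ST t. LINT p:fst ST \<times> snd ST|M \<Otimes>\<^sub>M M. (rep (\<phi> t) p - rep (\<psi> t) p)"
        and h' = "\<lambda>ST t. LINT p:fst ST \<times> snd ST|M \<Otimes>\<^sub>M M.
          (rep (velocity M k rule (\<phi> t)) p - rep (velocity M k rule (\<psi> t)) p)"
        and K = "2 * B" and C = "cut_lip B" and T = T])
    fix ST t assume ST: "ST \<in> sets M \<times> sets M" and t: "0 \<le> (t::real)"
    then have s: "fst ST \<in> sets M" "snd ST \<in> sets M" "fst ST \<times> snd ST \<in> sets (M \<Otimes>\<^sub>M M)" by auto
    have "((\<lambda>t. (LINT p:fst ST \<times> snd ST|M \<Otimes>\<^sub>M M. rep (\<phi> t) p) - (LINT p:fst ST \<times> snd ST|M \<Otimes>\<^sub>M M. rep (\<psi> t) p))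
       has_real_derivative ((LINT p:fst ST \<times> snd ST|M \<Otimes>\<^sub>M M. rep (velocity M k rule (\<phi> t)) p) -
         (LINT p:fst ST \<times> snd ST|M \<Otimes>\<^sub>M M. rep (velocity M k rule (\<psi> t)) p))) (at t within {0..})"
      by (intro DERIV_diff has_derivative_set_integral_trajectory[OF \<phi> s(3) t]
          has_derivative_set_integral_trajectory[OF \<psi> s(3) t])
    moreover have "(LINT p:fst ST \<times> snd ST|M \<Otimes>\<^sub>M M. rep (velocity M k rule (\<phi> t)) p) -
         (LINT p:fst ST \<times> snd ST|M \<Otimes>\<^sub>M M. rep (velocity M k rule (\<psi> t)) p) =
        (LINT p:fst ST \<times> snd ST|M \<Otimes>\<^sub>M M. (rep (velocity M k rule (\<phi> t)) p - rep (velocity M k rule (\<psi> t)) p))"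
      using si kv t s by (simp add: set_integral_diff)
    moreover have "(LINT p:fst ST \<times> snd ST|M \<Otimes>\<^sub>M M. rep (\<phi> t) p) - (LINT p:fst ST \<times> snd ST|M \<Otimes>\<^sub>M M. rep (\<psi> t) p)
       = (LINT p:fst ST \<times> snd ST|M \<Otimes>\<^sub>M M. (rep (\<phi> t) p - rep (\<psi> t) p))" if "t \<in> {0..}" for t
      using si k that s by (simp add: set_integral_diff)
    ultimately show "((\<lambda>t. LINT p:fst ST \<times> snd ST|M \<Otimes>\<^sub>M M. (rep (\<phi> t) p - rep (\<psi> t) p)) has_real_derivative
        (LINT p:fst ST \<times> snd ST|M \<Otimes>\<^sub>M M. (rep (velocity M k rule (\<phi> t)) p - rep (velocity M k rule (\<psi> t)) p)))
        (at t within {0..})"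
      using t by (auto intro: has_field_derivative_transform_within[of _ _ _ _ 1])
  next
    fix ST t assume ST: "ST \<in> sets M \<times> sets M" and t: "0 \<le> t" "t \<le> T"
    then show "\<bar>LINT p:fst ST \<times> snd ST|M \<Otimes>\<^sub>M M.
          (rep (velocity M k rule (\<phi> t)) p - rep (velocity M k rule (\<psi> t)) p)\<bar>
        \<le> cut_lip B * cut_dist M (\<phi> t) (\<psi> t)"
      using k bd by (intro cut_bound_velocity[OF B]) auto
    show "\<bar>LINT p:fst ST \<times> snd ST|M \<Otimes>\<^sub>M M. (rep (\<phi> t) p - rep (\<psi> t) p)\<bar> \<le> cut_dist M (\<phi> t) (\<psi> t)"
      using ST t k by (intro cut_dist_upper) auto
  next
    fix t c assume t: "0 \<le> t" "t \<le> T"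
      and c: "\<And>ST. ST \<in> sets M \<times> sets M \<Longrightarrow> \<bar>LINT p:fst ST \<times> snd ST|M \<Otimes>\<^sub>M M. (rep (\<phi> t) p - rep (\<psi> t) p)\<bar> \<le> c"
    show "cut_dist M (\<phi> t) (\<psi> t) \<le> c"
      using c[of "(S, T)" for S T] by (intro cut_dist_least) auto
  next
    fix t assume t: "0 \<le> t" "t \<le> T"
    show "0 \<le> cut_dist M (\<phi> t) (\<psi> t)" using k t by (intro cut_dist_nonneg) auto
    have "AE p in M \<Otimes>\<^sub>M M. \<bar>rep (\<phi> t) p - rep (\<psi> t) p\<bar> \<le> 2 * B"
      using bd(1)[of t] bd(2)[of t] t by auto
    then show "cut_dist M (\<phi> t) (\<psi> t) \<le> 2 * B"
      using k t
      by (intro cut_dist_least Q.abs_set_integral_AE_le Bochner_Integration.integrable_diff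
          integrable_kernel kernel_fun_rep) auto
  qed (use T C in auto)
  then show ?thesis by (simp add: is_trajectoryD(1)[OF \<phi>] is_trajectoryD(1)[OF \<psi>])
qed

text \<open>The cut distance separates classes, so stability from equal starting points gives
  equality. The bounds \<open>B\<close> and \<open>C\<close> belong to the interval
  \<open>[0, t]\<close>, since an arbitrary trajectory is not known to stay in
  \<open>[0, 1]\<close>.\<close>

lemma trajectory_unique:
  assumes \<phi>: "is_trajectory M k rule X \<phi>" and \<psi>: "is_trajectory M k rule X \<psi>" and t: "0 \<le> t"
  shows "\<phi> t = \<psi> t"
proof -
  obtain B where B: "1 \<le> B" "\<And>s. s \<in> {0..t} \<Longrightarrow> AE p in M \<Otimes>\<^sub>M M. \<bar>rep (\<phi> s) p\<bar> \<le> B"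
    using trajectory_locally_bounded[OF \<phi> t] by blast
  obtain C where C: "1 \<le> C" "\<And>s. s \<in> {0..t} \<Longrightarrow> AE p in M \<Otimes>\<^sub>M M. \<bar>rep (\<psi> s) p\<bar> \<le> C"
    using trajectory_locally_bounded[OF \<psi> t] by blast
  let ?B = "max B C"
  have L: "0 < cut_lip ?B" unfolding cut_lip_def by (intro add_nonneg_pos) auto
  obtain n :: nat where "t * (2 * cut_lip ?B) \<le> real n" using real_arch_simple by blast
  then have n: "t \<le> real n / (2 * cut_lip ?B)" using L by (simp add: field_simps)
  have X: "X \<in> kernels M" using is_trajectoryD(1,2)[OF \<phi>] by (metis order_refl)
  have "cut_dist M (\<phi> t) (\<psi> t) \<le> 2 ^ n * cut_dist M X X"
  proof (rule trajectory_cut_stability[OF \<phi> \<psi> _ _ _ t n])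
    fix s assume s: "s \<in> {0..t}"
    show "AE p in M \<Otimes>\<^sub>M M. \<bar>rep (\<phi> s) p\<bar> \<le> ?B" using B(2)[OF s] by eventually_elim simp
    show "AE p in M \<Otimes>\<^sub>M M. \<bar>rep (\<psi> s) p\<bar> \<le> ?B" using C(2)[OF s] by eventually_elim simp
  qed (use B in simp)
  also have "\<dots> = 0" using cut_dist_eq_0_iff[OF X X] by simp
  finally have "cut_dist M (\<phi> t) (\<psi> t) = 0"
    using cut_dist_nonneg is_trajectoryD(2)[OF \<phi> t] is_trajectoryD(2)[OF \<psi> t] by fastforce
  then show ?thesis
    using cut_dist_eq_0_iff is_trajectoryD(2)[OF \<phi> t] is_trajectoryD(2)[OF \<psi> t] by blast
qed

lemma flow_eq:
  assumes "is_trajectory M k rule X \<phi>" "0 \<le> t"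
  shows "flow M k rule t X = \<phi> t"
  unfolding flow_def using assms trajectory_unique by (intro the_equality) blast+

end

section \<open>Existence of trajectories\<close>

lemma geometric_steps_limit:
  fixes x :: "nat \<Rightarrow> real"
  assumes "\<And>n. \<bar>x (Suc n) - x n\<bar> \<le> K / 2 ^ n"
  shows "x \<longlonglongrightarrow> lim x" "\<bar>lim x - x n\<bar> \<le> 2 * K / 2 ^ n"
proof -
  have K: "0 \<le> K" using assms[of 0] by simp
  \<comment> \<open>Subtracting the remaining tail of the geometric series makes the induction on
    \<open>j\<close> close.\<close>
  have d: "\<bar>x (n + j) - x n\<bar> \<le> 2 * K / 2 ^ n - 2 * K / 2 ^ (n + j)" for n j
  proof (induction j)
    case (Suc j)
    have "\<bar>x (n + Suc j) - x n\<bar> \<le> \<bar>x (Suc (n + j)) - x (n + j)\<bar> + \<bar>x (n + j) - x n\<bar>" by simp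
    also have "\<dots> \<le> K / 2 ^ (n + j) + (2 * K / 2 ^ n - 2 * K / 2 ^ (n + j))"
      using Suc assms[of "n + j"] by simp
    also have "\<dots> = 2 * K / 2 ^ n - 2 * K / 2 ^ (n + Suc j)" by (simp add: field_simps)
    finally show ?case .
  qed simp
  have d': "\<bar>x m - x n\<bar> \<le> 2 * K / 2 ^ n" if "n \<le> m" for m n
  proof -
    have "\<bar>x m - x n\<bar> \<le> 2 * K / 2 ^ n - 2 * K / 2 ^ m" using d[of n "m - n"] that by simp
    also have "\<dots> \<le> 2 * K / 2 ^ n" using K by simp
    finally show ?thesis .
  qed
  have "Cauchy x"
  proof (rule metric_CauchyI)
    fix e :: real assume e: "0 < e"
    have "(\<lambda>n. 2 * K / 2 ^ n) \<longlonglongrightarrow> 0" by real_asymp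
    then have "\<forall>\<^sub>F n in sequentially. 2 * K / 2 ^ n < e / 2" using e by (intro order_tendstoD) auto
    then obtain N where N: "2 * K / 2 ^ N < e / 2" by (auto simp: eventually_sequentially)
    have "dist (x m) (x n) < e" if "N \<le> m" "N \<le> n" for m n
      using d'[OF that(1)] d'[OF that(2)] N unfolding dist_real_def by linarith
    then show "\<exists>N. \<forall>m\<ge>N. \<forall>n\<ge>N. dist (x m) (x n) < e" by blast
  qed
  then show l: "x \<longlonglongrightarrow> lim x" by (simp add: Cauchy_convergent_iff convergent_LIMSEQ_iff)
  show "\<bar>lim x - x n\<bar> \<le> 2 * K / 2 ^ n"
  proof (rule tendsto_upperbound)
    show "(\<lambda>m. \<bar>x m - x n\<bar>) \<longlonglongrightarrow> \<bar>lim x - x n\<bar>" by (intro tendsto_intros l)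
    show "\<forall>\<^sub>F m in sequentially. \<bar>x m - x n\<bar> \<le> 2 * K / 2 ^ n"
      using d' by (auto simp: eventually_sequentially)
  qed simp
qed

lemma exp_minus_lipschitz:
  fixes a b :: real
  assumes "0 \<le> a" "0 \<le> b"
  shows "\<bar>exp (- a) - exp (- b)\<bar> \<le> \<bar>a - b\<bar>"
proof -
  have "norm (exp (- a) - exp (- b)) \<le> 1 * norm (a - b)"
  proof (rule field_differentiable_bound[where S = "{0..}" and f' = "\<lambda>x. - exp (- x)"])
    show "((\<lambda>a. exp (- a)) has_real_derivative - exp (- z)) (at z within {0..})" for z :: real
      by (auto intro!: derivative_eq_intros)
  qed (use assms in auto)
  then show ?thesis by simp
qed

lemma set_integrable_bfun:
  assumes "bfun lborel C f" shows "set_integrable lborel {a..b::real} f"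
proof (rule set_integrable_bound[where f = "\<lambda>_. C"])
  show "set_integrable lborel {a..b} (\<lambda>_. C)"
    by (auto simp: set_integrable_def intro!: integrable_mult_right integrable_real_indicator
        simp: emeasure_lborel_Icc_eq)
  show "set_borel_measurable lborel {a..b} f"
    using assms by (auto simp: set_borel_measurable_def bfun_def)
  show "AE x in lborel. x \<in> {a..b} \<longrightarrow> norm (f x) \<le> norm C"
    using assms by (auto simp: bfun_def intro!: AE_I2 intro: order_trans[OF _ abs_ge_self])
qed

lemma abs_set_integral_diff_le:
  fixes t :: real
  assumes f: "bfun lborel C f" and g: "bfun lborel D g" and t: "0 \<le> t"
    and h: "set_integrable lborel {0..t} h" "\<And>s. s \<in> {0..t} \<Longrightarrow> \<bar>f s - g s\<bar> \<le> h s"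
  shows "\<bar>(LINT s:{0..t}|lborel. f s) - (LINT s:{0..t}|lborel. g s)\<bar> \<le> (LINT s:{0..t}|lborel. h s)"
proof -
  have i: "set_integrable lborel {0..t} (\<lambda>s. f s - g s)"
    by (intro set_integral_diff(1) set_integrable_bfun[OF f] set_integrable_bfun[OF g])
  have "(LINT s:{0..t}|lborel. f s) - (LINT s:{0..t}|lborel. g s) = (LINT s:{0..t}|lborel. f s - g s)"
    by (intro set_integral_diff(2)[symmetric] set_integrable_bfun[OF f] set_integrable_bfun[OF g])
  also have "\<bar>\<dots>\<bar> \<le> (LINT s:{0..t}|lborel. \<bar>f s - g s\<bar>)"
    using set_integral_norm_bound[OF i] by simp
  also have "\<dots> \<le> (LINT s:{0..t}|lborel. h s)"
    using h set_integrable_abs[OF i] by (intro set_integral_mono) auto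
  finally show ?thesis .
qed

lemma set_integral_const_Icc: "0 \<le> t \<Longrightarrow> (LINT s:{0..t}|lborel. c) = c * (t::real)"
  by (simp add: set_lebesgue_integral_def)

section \<open>The velocity on functions with values in the unit interval\<close>

context removal
begin

text \<open>A graphon without exceptional null sets, so that the equation can be solved at every
  point.\<close>

definition unit_fun :: "('a \<times> 'a \<Rightarrow> real) \<Rightarrow> bool" where
  "unit_fun W \<longleftrightarrow> kernel_fun M W \<and> (\<forall>p\<in>space (M \<Otimes>\<^sub>M M). W p \<in> {0..1})"

lemma unit_funD:
  assumes "unit_fun W"
  shows "kernel_fun M W" "bfun (M \<Otimes>\<^sub>M M) 1 W" "W \<in> borel_measurable (M \<Otimes>\<^sub>M M)"
    "p \<in> space (M \<Otimes>\<^sub>M M) \<Longrightarrow> 0 \<le> W p" "p \<in> space (M \<Otimes>\<^sub>M M) \<Longrightarrow> W p \<le> 1"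
    "p \<in> space (M \<Otimes>\<^sub>M M) \<Longrightarrow> W (snd p, fst p) = W p"
proof -
  show "kernel_fun M W" using assms by (simp add: unit_fun_def)
qed (use assms in \<open>auto simp: unit_fun_def kernel_fun_def bfun_def space_pair_measure\<close>)

text \<open>The velocity divided by \<open>- W p\<close>, made sense of where \<open>W\<close>
  vanishes by dropping the root edge from each product. The root edge occurs in \<open>edges\<close>
  with its smaller endpoint first, hence \<open>min\<close> and \<open>max\<close>.\<close>

definition rate :: "('a \<times> 'a \<Rightarrow> real) \<Rightarrow> 'a \<times> 'a \<Rightarrow> real" where
  "rate W p = (\<Sum>(a, b)\<in>arcs. rooted (edges - {(min a b, max a b)}) a b W p)"

lemma pair_in_space:
  assumes "u \<in> space (Pi\<^sub>M {1..k} (\<lambda>_. M))" "(i, j) \<in> edges"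
  shows "(u i, u j) \<in> space (M \<Otimes>\<^sub>M M)"
  using assms by (auto simp: edges_def space_PiM space_pair_measure)

lemma hom_nonneg:
  assumes "unit_fun W" "A \<subseteq> edges" "u \<in> space (Pi\<^sub>M {1..k} (\<lambda>_. M))"
  shows "0 \<le> hom A W u"
  unfolding hom_def using unit_funD(4)[OF assms(1) pair_in_space[OF assms(3)]] assms(2)
  by (intro prod_nonneg) auto

lemma rooted_nonneg:
  assumes "unit_fun W" "A \<subseteq> edges" "a \<in> {1..k}" "b \<in> {1..k}" "a \<noteq> b" "p \<in> space (M \<Otimes>\<^sub>M M)"
  shows "0 \<le> rooted A a b W p"
  unfolding rooted_def
  by (intro Bochner_Integration.integral_nonneg hom_nonneg[OF assms(1,2)]
      measurable_space[OF measurable_roots_at[OF assms(3-6)]])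

text \<open>A product of numbers in \<open>[0, 1]\<close> changes by at most the sum of the changes
  of its factors. Unlike the cut bound, this supremum bound holds at each single \<open>p\<close>,
  as the Picard iteration requires.\<close>

lemma rooted_lipschitz:
  assumes U: "unit_fun U" and W: "unit_fun W" and A: "A \<subseteq> edges"
    and ab: "a \<in> {1..k}" "b \<in> {1..k}" "a \<noteq> b" and p: "p \<in> space (M \<Otimes>\<^sub>M M)"
    and c: "\<And>q. q \<in> space (M \<Otimes>\<^sub>M M) \<Longrightarrow> \<bar>U q - W q\<bar> \<le> c"
  shows "\<bar>rooted A a b U p - rooted A a b W p\<bar> \<le> real (card edges) * c"
proof -
  interpret N: prob_space "Pi\<^sub>M ({1..k} - {a, b}) (\<lambda>_. M)" by (rule prob_space_PiM_const)
  note m = measurable_roots_at[OF ab p]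
  have c0: "0 \<le> c" using c[OF p] by linarith
  have bU: "bfun (Pi\<^sub>M ({1..k} - {a, b}) (\<lambda>_. M)) (1 ^ card A) (\<lambda>z. hom A U (z(a := fst p, b := snd p)))"
    and bW: "bfun (Pi\<^sub>M ({1..k} - {a, b}) (\<lambda>_. M)) (1 ^ card A) (\<lambda>z. hom A W (z(a := fst p, b := snd p)))"
    by (intro bfun_comp[OF bfun_hom[OF A] m] unit_funD[OF U] unit_funD[OF W])+
  have b: "\<bar>hom A U u - hom A W u\<bar> \<le> real (card edges) * c" if u: "u \<in> space (Pi\<^sub>M {1..k} (\<lambda>_. M))" for u
  proof -
    have s: "(u (fst e), u (snd e)) \<in> space (M \<Otimes>\<^sub>M M)" if "e \<in> A" for e
      using pair_in_space[OF u, of "fst e" "snd e"] that A by auto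
    have "norm ((\<Prod>e\<in>A. U (u (fst e), u (snd e))) - (\<Prod>e\<in>A. W (u (fst e), u (snd e))))
        \<le> (\<Sum>e\<in>A. norm (U (u (fst e), u (snd e)) - W (u (fst e), u (snd e))))"
      using unit_funD(4,5)[OF U s] unit_funD(4,5)[OF W s] by (intro norm_prod_diff) auto
    also have "\<dots> \<le> real (card A) * c"
      using c[OF s] by (intro sum_bounded_above) auto
    also have "\<dots> \<le> real (card edges) * c"
      using card_mono[OF finite_edges A] c0 by (intro mult_right_mono) auto
    finally show ?thesis by (simp add: hom_def case_prod_unfold)
  qed
  have "rooted A a b U p - rooted A a b W p = (LINT z|Pi\<^sub>M ({1..k} - {a, b}) (\<lambda>_. M).
      (hom A U (z(a := fst p, b := snd p)) - hom A W (z(a := fst p, b := snd p))))"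
    unfolding rooted_def using N.integrable_bfun[OF bU] N.integrable_bfun[OF bW] by simp
  also have "\<bar>\<dots>\<bar> \<le> real (card edges) * c"
  proof (rule N.integral_bfun_bound)
    show "bfun (Pi\<^sub>M ({1..k} - {a, b}) (\<lambda>_. M)) (real (card edges) * c)
       (\<lambda>z. hom A U (z(a := fst p, b := snd p)) - hom A W (z(a := fst p, b := snd p)))"
      using bfun_measurable[OF bfun_diff[OF bU bW]] b measurable_space[OF m] unfolding bfun_def by blast
  qed
  finally show ?thesis .
qed

text \<open>The summand \<open>1\<close> keeps the constant positive, since the Picard estimate
  divides by it.\<close>

definition lip :: real where "lip = real (card arcs) * real (card edges) + 1"

lemma lip_pos: "0 < lip" unfolding lip_def by (intro add_nonneg_pos) auto

lemma arcs_sum_lipschitz: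
  assumes "\<And>a b. (a, b) \<in> arcs \<Longrightarrow> \<bar>f a b - g a b\<bar> \<le> real (card edges) * c" "0 \<le> c"
  shows "\<bar>(\<Sum>(a, b)\<in>arcs. f a b) - (\<Sum>(a, b)\<in>arcs. g a b)\<bar> \<le> lip * c"
proof -
  have "\<bar>(\<Sum>(a, b)\<in>arcs. f a b) - (\<Sum>(a, b)\<in>arcs. g a b)\<bar> \<le> (\<Sum>(a, b)\<in>arcs. \<bar>f a b - g a b\<bar>)"
    by (simp add: sum_subtractf[symmetric] case_prod_unfold sum_abs)
  also have "\<dots> \<le> real (card arcs) * (real (card edges) * c)"
    using assms(1) by (intro sum_bounded_above) auto
  also have "\<dots> \<le> lip * c" using assms(2) by (simp add: lip_def algebra_simps)
  finally show ?thesis .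
qed

lemma rate_lipschitz:
  assumes "unit_fun U" "unit_fun W" "p \<in> space (M \<Otimes>\<^sub>M M)"
    and c: "\<And>q. q \<in> space (M \<Otimes>\<^sub>M M) \<Longrightarrow> \<bar>U q - W q\<bar> \<le> c"
  shows "\<bar>rate U p - rate W p\<bar> \<le> lip * c"
  unfolding rate_def using order_trans[OF abs_ge_zero c[OF assms(3)]] assms
  by (intro arcs_sum_lipschitz rooted_lipschitz) (auto dest: arcsD)

lemma vel_lipschitz:
  assumes "unit_fun U" "unit_fun W" "p \<in> space (M \<Otimes>\<^sub>M M)"
    and c: "\<And>q. q \<in> space (M \<Otimes>\<^sub>M M) \<Longrightarrow> \<bar>U q - W q\<bar> \<le> c"
  shows "\<bar>vel U p - vel W p\<bar> \<le> lip * c"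
proof -
  have "\<bar>(\<Sum>(a, b)\<in>arcs. rooted edges a b U p) - (\<Sum>(a, b)\<in>arcs. rooted edges a b W p)\<bar> \<le> lip * c"
    using order_trans[OF abs_ge_zero c[OF assms(3)]] assms
    by (intro arcs_sum_lipschitz rooted_lipschitz) (auto dest: arcsD)
  then show ?thesis by (simp add: vel_def)
qed

lemma rate_nonneg: "unit_fun W \<Longrightarrow> p \<in> space (M \<Otimes>\<^sub>M M) \<Longrightarrow> 0 \<le> rate W p"
  unfolding rate_def by (intro sum_nonneg) (auto intro!: rooted_nonneg dest: arcsD)

lemma bfun_rate_param:
  assumes "bfun (N \<Otimes>\<^sub>M (M \<Otimes>\<^sub>M M)) 1 (\<lambda>(t, p). w t p)"
  shows "bfun (N \<Otimes>\<^sub>M (M \<Otimes>\<^sub>M M)) (card arcs) (\<lambda>(t, p). rate (w t) p)"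
proof -
  have "bfun (N \<Otimes>\<^sub>M (M \<Otimes>\<^sub>M M)) 1 (\<lambda>q. rooted (edges - {(min (fst e) (snd e), max (fst e) (snd e))})
      (fst e) (snd e) (w (fst q)) (snd q))" if "e \<in> arcs" for e
    using bfun_rooted_param[OF _ _ _ _ assms, of "edges - {(min (fst e) (snd e), max (fst e) (snd e))}" "fst e" "snd e"]
      arcsD[of "fst e" "snd e"] that by (auto simp: case_prod_unfold)
  from bfun_sum[of arcs, OF this] show ?thesis by (simp add: rate_def case_prod_unfold)
qed

lemma rate_swap: "rate W (y, x) = rate W (x, y)"
proof -
  have r: "rooted A a b W (y, x) = rooted A b a W (x, y)" if "(a, b) \<in> arcs" for A a b
    using arcsD[OF that] by (simp add: rooted_def fun_upd_twist insert_commute)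
  show ?thesis unfolding rate_def
    by (rule sum.reindex_bij_witness[of _ prod.swap prod.swap])
      (auto simp: r min.commute max.commute, auto simp: arcs_def insert_commute)
qed

text \<open>The root edge contributes the factor \<open>W p\<close> whatever the completion
  \<open>z\<close> is. For an arc with \<open>a > b\<close> it is read backwards, which the symmetry
  of \<open>W\<close> repairs.\<close>

lemma vel_eq_rate:
  assumes W: "unit_fun W" and p: "p \<in> space (M \<Otimes>\<^sub>M M)"
  shows "vel W p = - (W p * rate W p)"
proof -
  have "rooted edges a b W p = W p * rooted (edges - {(min a b, max a b)}) a b W p"
    if arc: "(a, b) \<in> arcs" for a b
  proof -
    have e: "(min a b, max a b) \<in> edges"
      using arcsD[OF arc] by (auto simp: edges_def min_def max_def insert_commute)
    have "hom edges W u = W (u (min a b), u (max a b)) * hom (edges - {(min a b, max a b)}) W u" for u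
      unfolding hom_def by (subst prod.remove[OF finite_edges e]) simp
    moreover have "W ((z(a := fst p, b := snd p)) (min a b), (z(a := fst p, b := snd p)) (max a b)) = W p" for z
      using arcsD[OF arc] unit_funD(6)[OF W p] by (cases "a < b") (auto simp: min_def max_def)
    ultimately show ?thesis by (simp add: rooted_def)
  qed
  then have "(\<Sum>(a, b)\<in>arcs. rooted edges a b W p) =
      (\<Sum>(a, b)\<in>arcs. W p * rooted (edges - {(min a b, max a b)}) a b W p)"
    by (intro sum.cong) auto
  then show ?thesis by (simp add: vel_def rate_def sum_distrib_left case_prod_unfold)
qed

text \<open>Picard iteration for \<open>W' = - W * rate W\<close> in exponential form, which keeps all iterates in
  \<open>[0, 1]\<close>, where the rate is Lipschitz.\<close>

primrec picard :: "('a \<times> 'a \<Rightarrow> real) \<Rightarrow> nat \<Rightarrow> real \<Rightarrow> 'a \<times> 'a \<Rightarrow> real" where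
  "picard W 0 t p = W p"
| "picard W (Suc n) t p = W p * exp (- (LINT s:{0..t}|lborel. rate (picard W n s) p))"

text \<open>Joint measurability keeps the time integral of the rate measurable in \<open>p\<close>,
  so that the iteration can continue.\<close>

definition unit_path :: "(real \<Rightarrow> 'a \<times> 'a \<Rightarrow> real) \<Rightarrow> bool" where
  "unit_path w \<longleftrightarrow> (\<lambda>(t, p). w t p) \<in> borel_measurable (borel \<Otimes>\<^sub>M (M \<Otimes>\<^sub>M M)) \<and> (\<forall>t. unit_fun (w t))"

lemma unit_path_bfun: "unit_path w \<Longrightarrow> bfun (borel \<Otimes>\<^sub>M (M \<Otimes>\<^sub>M M)) 1 (\<lambda>(t, p). w t p)"
  using unit_funD(4,5)[of "w t" for t]
  by (auto simp: bfun_def unit_path_def space_pair_measure)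

lemma bfun_rate_path:
  assumes "unit_path w" "p \<in> space (M \<Otimes>\<^sub>M M)"
  shows "bfun lborel (card arcs) (\<lambda>s. rate (w s) p)"
proof -
  have "(\<lambda>s. (s, p)) \<in> lborel \<rightarrow>\<^sub>M borel \<Otimes>\<^sub>M (M \<Otimes>\<^sub>M M)" using assms(2) by auto
  from bfun_comp[OF bfun_rate_param[OF unit_path_bfun[OF assms(1)]] this] show ?thesis by simp
qed

lemma integral_rate_nonneg:
  assumes "unit_path w" "p \<in> space (M \<Otimes>\<^sub>M M)"
  shows "0 \<le> (LINT s:{0..t}|lborel. rate (w s) p)"
  unfolding set_lebesgue_integral_def using assms rate_nonneg
  by (intro Bochner_Integration.integral_nonneg) (auto simp: unit_path_def)

lemma unit_path_exp:
  assumes W: "unit_fun W" and w: "unit_path w"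
  shows "unit_path (\<lambda>t p. W p * exp (- (LINT s:{0..t}|lborel. rate (w s) p)))"
proof -
  have m[measurable]: "(\<lambda>(t, p). rate (w t) p) \<in> borel_measurable (borel \<Otimes>\<^sub>M (M \<Otimes>\<^sub>M M))"
    by (rule bfun_measurable[OF bfun_rate_param[OF unit_path_bfun[OF w]]])
  note [measurable] = unit_funD(3)[OF W]
  have "(\<lambda>((t, p), s). indicator {0..t} s *\<^sub>R rate (w s) p) \<in>
      borel_measurable ((borel \<Otimes>\<^sub>M (M \<Otimes>\<^sub>M M)) \<Otimes>\<^sub>M lborel)"
  proof -
    have "(\<lambda>q. (snd q, snd (fst q))) \<in> (borel \<Otimes>\<^sub>M (M \<Otimes>\<^sub>M M)) \<Otimes>\<^sub>M (lborel :: real measure) \<rightarrow>\<^sub>M borel \<Otimes>\<^sub>M (M \<Otimes>\<^sub>M M)"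
      by measurable
    from measurable_compose[OF this m]
    have [measurable]: "(\<lambda>q. rate (w (snd q)) (snd (fst q))) \<in>
        borel_measurable ((borel \<Otimes>\<^sub>M (M \<Otimes>\<^sub>M M)) \<Otimes>\<^sub>M lborel)" by simp
    \<comment> \<open>The interval of integration depends on \<open>t\<close>; moving it into the
      integrand leaves one jointly measurable function.\<close>
    have "(\<lambda>q. if 0 \<le> snd q \<and> snd q \<le> fst (fst q) then rate (w (snd q)) (snd (fst q)) else 0) \<in>
        borel_measurable ((borel \<Otimes>\<^sub>M (M \<Otimes>\<^sub>M M)) \<Otimes>\<^sub>M lborel)"
      by measurable
    then show ?thesis
      by (rule subst[where P = "\<lambda>f. f \<in> _", rotated]) (auto simp: indicator_def fun_eq_iff)
  qed
  then have "(\<lambda>(t, p). LINT s:{0..t}|lborel. rate (w s) p) \<in> borel_measurable (borel \<Otimes>\<^sub>M (M \<Otimes>\<^sub>M M))"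
    unfolding set_lebesgue_integral_def case_prod_unfold
    by (intro lborel.borel_measurable_lebesgue_integral) (simp add: case_prod_unfold)
  then have meas: "(\<lambda>(t, p). W p * exp (- (LINT s:{0..t}|lborel. rate (w s) p))) \<in> borel_measurable (borel \<Otimes>\<^sub>M (M \<Otimes>\<^sub>M M))"
    unfolding case_prod_unfold by measurable
  show ?thesis
    unfolding unit_path_def
  proof (intro conjI allI meas)
    fix t
    let ?f = "\<lambda>p. W p * exp (- (LINT s:{0..t}|lborel. rate (w s) p))"
    have u: "?f p \<in> {0..1}" if p: "p \<in> space (M \<Otimes>\<^sub>M M)" for p
      using unit_funD(4,5)[OF W p] integral_rate_nonneg[OF w p, of t]
      by (auto intro!: mult_le_one)
    have "(\<lambda>p. (t, p)) \<in> M \<Otimes>\<^sub>M M \<rightarrow>\<^sub>M borel \<Otimes>\<^sub>M (M \<Otimes>\<^sub>M M)" by simp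
    from measurable_compose[OF this meas] have "?f \<in> borel_measurable (M \<Otimes>\<^sub>M M)" by simp
    moreover have "?f (x, y) = ?f (y, x)" if "x \<in> space M" "y \<in> space M" for x y
      using unit_funD(1)[OF W] that by (simp add: kernel_fun_def rate_swap[of _ x y])
    moreover have "\<exists>B. \<forall>p\<in>space (M \<Otimes>\<^sub>M M). \<bar>?f p\<bar> \<le> B"
      using u by (intro exI[of _ 1]) fastforce
    ultimately show "unit_fun ?f"
      using u unfolding unit_fun_def kernel_fun_def by blast
  qed
qed

lemma unit_path_picard: "unit_fun W \<Longrightarrow> unit_path (picard W n)"
proof (induction n)
  case 0
  have "(\<lambda>q. W (snd q)) \<in> borel_measurable (borel \<Otimes>\<^sub>M (M \<Otimes>\<^sub>M M))"
    using unit_funD(3)[OF 0] by measurable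
  then show ?case using 0 by (simp add: unit_path_def case_prod_unfold)
next
  case (Suc n)
  then show ?case using unit_path_exp[of W "picard W n"] by simp
qed

text \<open>The bound \<open>h s\<close> is uniform in \<open>q\<close> because the rate at
  \<open>p\<close> averages over other pairs. The exponent is nonpositive, so the exponential costs
  no factor.\<close>

lemma exp_path_diff_le:
  assumes W: "unit_fun W" and v: "unit_path v" and w: "unit_path w"
    and p: "p \<in> space (M \<Otimes>\<^sub>M M)" and t: "0 \<le> t"
    and h: "set_integrable lborel {0..t} h" "\<And>s q. s \<in> {0..t} \<Longrightarrow> q \<in> space (M \<Otimes>\<^sub>M M) \<Longrightarrow> \<bar>v s q - w s q\<bar> \<le> h s"
  shows "\<bar>W p * exp (- (LINT s:{0..t}|lborel. rate (v s) p)) - W p * exp (- (LINT s:{0..t}|lborel. rate (w s) p))\<bar>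
    \<le> lip * (LINT s:{0..t}|lborel. h s)"
proof -
  let ?a = "LINT s:{0..t}|lborel. rate (v s) p" and ?b = "LINT s:{0..t}|lborel. rate (w s) p"
  have "\<bar>W p * exp (- ?a) - W p * exp (- ?b)\<bar> = W p * \<bar>exp (- ?a) - exp (- ?b)\<bar>"
    using unit_funD(4)[OF W p] by (simp add: right_diff_distrib[symmetric] abs_mult)
  also have "\<dots> \<le> 1 * \<bar>exp (- ?a) - exp (- ?b)\<bar>"
    using unit_funD(5)[OF W p] by (intro mult_right_mono) auto
  also have "\<dots> \<le> \<bar>?a - ?b\<bar>"
    using exp_minus_lipschitz[OF integral_rate_nonneg[OF v p] integral_rate_nonneg[OF w p]] by simp
  also have "\<dots> \<le> (LINT s:{0..t}|lborel. lip * h s)"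
  proof (rule abs_set_integral_diff_le[OF bfun_rate_path[OF v p] bfun_rate_path[OF w p] t])
    show "set_integrable lborel {0..t} (\<lambda>s. lip * h s)" using h(1) by simp
    fix s assume "s \<in> {0..t}"
    then show "\<bar>rate (v s) p - rate (w s) p\<bar> \<le> lip * h s"
      using h(2) v w p by (intro rate_lipschitz) (auto simp: unit_path_def)
  qed
  finally show ?thesis by simp
qed

text \<open>The weight \<open>exp (2 * lip * t)\<close> makes the iteration contract by
  \<open>1 / 2\<close> on the whole half-line at once: \<open>lip\<close> times its integral from
  \<open>0\<close> to \<open>t\<close> is at most half of it. No subdivision into short time
  intervals arises.\<close>

lemma picard_step:
  assumes W: "unit_fun W"
  shows "0 \<le> t \<Longrightarrow> p \<in> space (M \<Otimes>\<^sub>M M) \<Longrightarrow> \<bar>picard W (Suc n) t p - picard W n t p\<bar> \<le> exp (2 * lip * t) / 2 ^ n"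
proof (induction n arbitrary: t p)
  case 0
  have "unit_fun (picard W (Suc 0) t)" "unit_fun (picard W 0 t)"
    using unit_path_picard[OF W] unfolding unit_path_def by blast+
  from unit_funD(4,5)[OF this(1) 0(2)] unit_funD(4,5)[OF this(2) 0(2)]
  have "\<bar>picard W (Suc 0) t p - picard W 0 t p\<bar> \<le> 1" by linarith
  also have "1 \<le> exp (2 * lip * t)" using lip_pos 0 by simp
  finally show ?case by simp
next
  case (Suc n)
  let ?h = "\<lambda>s. exp (2 * lip * s) / 2 ^ n"
  have cont: "continuous_on {0..t} ?h" by (intro continuous_intros) auto
  have i: "set_integrable lborel {0..t} ?h"
    using borel_integrable_atLeastAtMost'[OF cont] by simp
  have "\<bar>picard W (Suc (Suc n)) t p - picard W (Suc n) t p\<bar> \<le> lip * (LINT s:{0..t}|lborel. ?h s)"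
    using exp_path_diff_le[OF W unit_path_picard[OF W] unit_path_picard[OF W] Suc.prems(2,1) i,
        of "Suc n" n] Suc.IH by simp
  also have "(LINT s:{0..t}|lborel. ?h s) = exp (2 * lip * t) / (2 * lip * 2 ^ n) - exp (2 * lip * 0) / (2 * lip * 2 ^ n)"
  proof -
    have "(LINT s:{0..t}|lborel. ?h s) = (LINT s|lborel. ?h s * indicator {0..t} s)"
      by (simp add: set_lebesgue_integral_def mult.commute)
    also have "\<dots> = exp (2 * lip * t) / (2 * lip * 2 ^ n) - exp (2 * lip * 0) / (2 * lip * 2 ^ n)"
      using lip_pos Suc.prems
      by (intro integral_FTC_Icc_real) (auto intro!: derivative_eq_intros continuous_intros)
    finally show ?thesis .
  qed
  also have "lip * (exp (2 * lip * t) / (2 * lip * 2 ^ n) - exp (2 * lip * 0) / (2 * lip * 2 ^ n)) \<le> exp (2 * lip * t) / 2 ^ Suc n"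
    using lip_pos by (simp add: field_simps)
  finally show ?case .
qed

text \<open>Measurability in \<open>t\<close> is required on all of \<open>\<real>\<close>, while the convergence estimate holds for
  \<open>t \<ge> 0\<close> only; hence the truncation \<open>max 0 t\<close>.\<close>

lemma picard_limit:
  assumes W: "unit_fun W"
  defines "w \<equiv> \<lambda>t p. lim (\<lambda>n. picard W n (max 0 t) p)"
  shows "unit_path w"
    and "0 \<le> t \<Longrightarrow> p \<in> space (M \<Otimes>\<^sub>M M) \<Longrightarrow> w t p = W p * exp (- (LINT s:{0..t}|lborel. rate (w s) p))"
proof -
  note pic = unit_path_picard[OF W]
  have l: "(\<lambda>n. picard W n (max 0 t) p) \<longlonglongrightarrow> w t p"
    and e: "\<bar>w t p - picard W n (max 0 t) p\<bar> \<le> 2 * exp (2 * lip * max 0 t) / 2 ^ n"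
    if p: "p \<in> space (M \<Otimes>\<^sub>M M)" for t p n
    unfolding w_def using picard_step[OF W max.cobounded1 p]
    by (rule geometric_steps_limit)+
  show up: "unit_path w"
    unfolding unit_path_def
  proof (intro conjI allI)
    have "(\<lambda>q. picard W n (max 0 (fst q)) (snd q)) \<in> borel_measurable (borel \<Otimes>\<^sub>M (M \<Otimes>\<^sub>M M))" for n
    proof -
      have "(\<lambda>q. (max 0 (fst q), snd q)) \<in> borel \<Otimes>\<^sub>M (M \<Otimes>\<^sub>M M) \<rightarrow>\<^sub>M (borel :: real measure) \<Otimes>\<^sub>M (M \<Otimes>\<^sub>M M)"
        by measurable
      moreover have "(\<lambda>(t, p). picard W n t p) \<in> borel_measurable (borel \<Otimes>\<^sub>M (M \<Otimes>\<^sub>M M))"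
        using pic[of n] by (simp add: unit_path_def)
      ultimately have "(\<lambda>q. case (max 0 (fst q), snd q) of (t, p) \<Rightarrow> picard W n t p)
          \<in> borel_measurable (borel \<Otimes>\<^sub>M (M \<Otimes>\<^sub>M M))"
        by (rule measurable_compose)
      then show ?thesis by simp
    qed
    then show meas: "(\<lambda>(t, p). w t p) \<in> borel_measurable (borel \<Otimes>\<^sub>M (M \<Otimes>\<^sub>M M))"
      unfolding w_def case_prod_unfold by (rule borel_measurable_lim_metric)
    fix t
    have u: "w t p \<in> {0..1}" if p: "p \<in> space (M \<Otimes>\<^sub>M M)" for p
    proof -
      have "unit_fun (picard W n (max 0 t))" for n using pic by (auto simp: unit_path_def)
      from unit_funD(4,5)[OF this p] show ?thesis
        using LIMSEQ_le_const[OF l[OF p]] LIMSEQ_le_const2[OF l[OF p]] by auto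
    qed
    have "(\<lambda>p. (t, p)) \<in> M \<Otimes>\<^sub>M M \<rightarrow>\<^sub>M borel \<Otimes>\<^sub>M (M \<Otimes>\<^sub>M M)" by simp
    from measurable_compose[OF this meas] have "w t \<in> borel_measurable (M \<Otimes>\<^sub>M M)" by simp
    moreover have "w t (x, y) = w t (y, x)" if "x \<in> space M" "y \<in> space M" for x y
    proof -
      have "picard W n (max 0 t) (x, y) = picard W n (max 0 t) (y, x)" for n
        using pic[of n] that by (auto simp: unit_path_def unit_fun_def kernel_fun_def)
      then show ?thesis by (simp add: w_def)
    qed
    moreover have "\<exists>B. \<forall>p\<in>space (M \<Otimes>\<^sub>M M). \<bar>w t p\<bar> \<le> B"
      using u by (intro exI[of _ 1]) fastforce
    ultimately show "unit_fun (w t)"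
      using u unfolding unit_fun_def kernel_fun_def by blast
  qed
  show "w t p = W p * exp (- (LINT s:{0..t}|lborel. rate (w s) p))"
    if t: "0 \<le> t" and p: "p \<in> space (M \<Otimes>\<^sub>M M)"
  proof (rule LIMSEQ_unique)
    show "(\<lambda>n. picard W (Suc n) t p) \<longlonglongrightarrow> w t p"
      using LIMSEQ_Suc[OF l[OF p, of t]] t by simp
    let ?E = "exp (2 * lip * t)"
    \<comment> \<open>On all of \<open>[0, t]\<close> the iterate is within
      \<open>2 * ?E / 2 ^ n\<close> of \<open>w\<close>, so one more iteration brings it close to
      the right-hand side. The next iterate also tends to \<open>w t p\<close>, hence the two limits
      agree.\<close>
    have b: "\<bar>picard W (Suc n) t p - W p * exp (- (LINT s:{0..t}|lborel. rate (w s) p))\<bar>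
        \<le> lip * (2 * ?E / 2 ^ n * t)" for n
    proof -
      have "\<bar>picard W (Suc n) t p - W p * exp (- (LINT s:{0..t}|lborel. rate (w s) p))\<bar>
          \<le> lip * (LINT s:{0..t}|lborel. 2 * ?E / 2 ^ n)"
        unfolding picard.simps
      proof (rule exp_path_diff_le[OF W pic up p t])
        show "set_integrable lborel {0..t} (\<lambda>s. 2 * ?E / 2 ^ n)"
          by (rule set_integrable_bfun[OF bfun_const])
        fix s q assume s: "s \<in> {0..t}" and q: "q \<in> space (M \<Otimes>\<^sub>M M)"
        have "\<bar>picard W n s q - w s q\<bar> \<le> 2 * exp (2 * lip * s) / 2 ^ n"
          using e[OF q, of s n] s by (simp add: abs_minus_commute)
        also have "\<dots> \<le> 2 * ?E / 2 ^ n" using s lip_pos by (simp add: divide_right_mono)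
        finally show "\<bar>picard W n s q - w s q\<bar> \<le> 2 * ?E / 2 ^ n" .
      qed
      then show ?thesis unfolding set_integral_const_Icc[OF t] .
    qed
    have "(\<lambda>n. lip * (2 * ?E / 2 ^ n * t)) \<longlonglongrightarrow> 0" by real_asymp
    then have "(\<lambda>n. picard W (Suc n) t p - W p * exp (- (LINT s:{0..t}|lborel. rate (w s) p))) \<longlonglongrightarrow> 0"
      by (rule Lim_null_comparison[rotated]) (use b in auto)
    then show "(\<lambda>n. picard W (Suc n) t p) \<longlonglongrightarrow> W p * exp (- (LINT s:{0..t}|lborel. rate (w s) p))"
      by (rule LIM_zero_cancel)
  qed
qed

text \<open>The derivative is taken at each \<open>p\<close> separately, which gives access to real
  calculus; the derivative in norm is recovered from Lipschitz bounds that are uniform in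
  \<open>p\<close>.\<close>

definition solution :: "(real \<Rightarrow> 'a \<times> 'a \<Rightarrow> real) \<Rightarrow> bool" where
  "solution w \<longleftrightarrow> (\<forall>t\<ge>0. unit_fun (w t) \<and>
    (\<forall>p\<in>space (M \<Otimes>\<^sub>M M). ((\<lambda>s. w s p) has_real_derivative vel (w t) p) (at t within {0..})))"

lemma solution_exists:
  assumes W: "unit_fun W"
  obtains w where "solution w" "\<And>p. p \<in> space (M \<Otimes>\<^sub>M M) \<Longrightarrow> w 0 p = W p"
proof -
  define w where "w = (\<lambda>t p. lim (\<lambda>n. picard W n (max 0 t) p))"
  have up: "unit_path w" and eq: "\<And>t p. 0 \<le> t \<Longrightarrow> p \<in> space (M \<Otimes>\<^sub>M M) \<Longrightarrow>
      w t p = W p * exp (- (LINT s:{0..t}|lborel. rate (w s) p))"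
    unfolding w_def using picard_limit[OF W] by auto
  have u: "unit_fun (w t)" for t using up by (auto simp: unit_path_def)
  let ?N = "real (card arcs)"
  \<comment> \<open>Uniform in \<open>p\<close>, because continuity in time of the rate at one
    \<open>p\<close> requires closeness of \<open>w\<close> at all pairs.\<close>
  have w_lip: "\<bar>w t p - w s p\<bar> \<le> ?N * (t - s)" if st: "0 \<le> s" "s \<le> t" and p: "p \<in> space (M \<Otimes>\<^sub>M M)" for s t p
  proof -
    let ?A = "\<lambda>t. LINT s:{0..t}|lborel. rate (w s) p"
    note b = bfun_rate_path[OF up p]
    have "?A t = ?A s + (LINT r:{s<..t}|lborel. rate (w r) p)"
    proof -
      have "{0..t} = {0..s} \<union> {s<..t}" using st by auto
      then show ?thesis
        using set_integral_Un[OF _ set_integrable_bfun[OF b, of 0 s]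
          set_integrable_subset[OF set_integrable_bfun[OF b, of s t], of "{s<..t}"]]
        by (force simp: disjoint_iff)
    qed
    moreover have "\<bar>LINT r:{s<..t}|lborel. rate (w r) p\<bar> \<le> ?N * (t - s)"
    proof -
      have i: "set_integrable lborel {s<..t} (\<lambda>r. rate (w r) p)"
        by (rule set_integrable_subset[OF set_integrable_bfun[OF b, of s t]]) auto
      have "\<bar>LINT r:{s<..t}|lborel. rate (w r) p\<bar> \<le> (LINT r:{s<..t}|lborel. \<bar>rate (w r) p\<bar>)"
        using set_integral_norm_bound[OF i] by simp
      also have "\<dots> \<le> (LINT r:{s<..t}|lborel. ?N)"
        using bfun_bound[OF b]
        by (intro set_integral_mono set_integrable_abs[OF i]
            set_integrable_subset[OF set_integrable_bfun[OF bfun_const, of s t]]) auto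
      also have "\<dots> = ?N * (t - s)" using st by (simp add: set_lebesgue_integral_def)
      finally show ?thesis .
    qed
    ultimately have A: "\<bar>?A t - ?A s\<bar> \<le> ?N * (t - s)" by simp
    have "\<bar>w t p - w s p\<bar> = W p * \<bar>exp (- ?A t) - exp (- ?A s)\<bar>"
      using st eq[OF _ p] unit_funD(4)[OF W p] by (simp add: right_diff_distrib[symmetric] abs_mult)
    also have "\<dots> \<le> 1 * \<bar>exp (- ?A t) - exp (- ?A s)\<bar>"
      using unit_funD(5)[OF W p] by (intro mult_right_mono) auto
    also have "\<dots> \<le> \<bar>?A t - ?A s\<bar>"
      using exp_minus_lipschitz[OF integral_rate_nonneg[OF up p] integral_rate_nonneg[OF up p]] by simp
    finally show ?thesis using A by simp
  qed
  have w_lip': "\<bar>w t p - w s p\<bar> \<le> ?N * \<bar>t - s\<bar>" if "0 \<le> s" "0 \<le> t" "p \<in> space (M \<Otimes>\<^sub>M M)" for s t p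
    using w_lip[of s t p] w_lip[of t s p] that by (cases "s \<le> t") (auto simp: abs_minus_commute)
  have cont: "continuous_on {0..} (\<lambda>s. rate (w s) p)" if p: "p \<in> space (M \<Otimes>\<^sub>M M)" for p
  proof (rule lipschitz_on_continuous_on, rule lipschitz_onI)
    show "0 \<le> lip * ?N" using lip_pos by simp
    fix s t :: real assume "s \<in> {0..}" "t \<in> {0..}"
    then have "\<bar>rate (w s) p - rate (w t) p\<bar> \<le> lip * (?N * \<bar>s - t\<bar>)"
      using w_lip' by (intro rate_lipschitz u p) auto
    then show "dist (rate (w s) p) (rate (w t) p) \<le> lip * ?N * dist s t"
      by (simp add: dist_real_def)
  qed
  have "solution w"
    unfolding solution_def
  proof (intro allI impI conjI ballI u)
    fix t :: real and p assume t: "0 \<le> t" and p: "p \<in> space (M \<Otimes>\<^sub>M M)"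
    \<comment> \<open>The fundamental theorem of calculus is applied on a compact interval; ending
      it at \<open>t + 1\<close> leaves the one-sided neighbourhood filter of \<open>t\<close> in
      \<open>[0, \<infinity>)\<close> unchanged.\<close>
    have "((\<lambda>s. integral {0..s} (\<lambda>s. rate (w s) p)) has_real_derivative rate (w t) p) (at t within {0..t + 1})"
      using t by (intro integral_has_real_derivative continuous_on_subset[OF cont[OF p]]) auto
    then have d: "((\<lambda>s. integral {0..s} (\<lambda>s. rate (w s) p)) has_real_derivative rate (w t) p) (at t within {0..})"
    proof -
      have "at t within {0..t + 1} = at t within {0..}"
        by (rule at_within_nhd[of t "{..<t + 1}"]) auto
      with \<open>(_ has_real_derivative _) (at t within {0..t + 1})\<close> show ?thesis by simp
    qed
    have eq': "w s p = W p * exp (- integral {0..s} (\<lambda>s. rate (w s) p))" if "s \<in> {0..}" for s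
      using eq[OF _ p, of s] that set_borel_integral_eq_integral(2)[OF set_integrable_bfun[OF bfun_rate_path[OF up p], of 0 s]]
      by simp
    have "((\<lambda>s. W p * exp (- integral {0..s} (\<lambda>s. rate (w s) p))) has_real_derivative
        W p * (exp (- integral {0..t} (\<lambda>s. rate (w s) p)) * - rate (w t) p)) (at t within {0..})"
      by (intro DERIV_cmult DERIV_chain2[OF DERIV_exp] DERIV_minus d)
    then have "((\<lambda>s. w s p) has_real_derivative
        W p * (exp (- integral {0..t} (\<lambda>s. rate (w s) p)) * - rate (w t) p)) (at t within {0..})"
      using t eq' by (auto intro: has_field_derivative_transform_within[of _ _ _ _ 1])
    also have "W p * (exp (- integral {0..t} (\<lambda>s. rate (w s) p)) * - rate (w t) p) = vel (w t) p"
      using eq'[of t] t by (simp add: vel_eq_rate[OF u p])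
    finally show "((\<lambda>s. w s p) has_real_derivative vel (w t) p) (at t within {0..})" .
  qed
  moreover have "w 0 p = W p" if "p \<in> space (M \<Otimes>\<^sub>M M)" for p
    using eq[OF order_refl that]
      set_borel_integral_eq_integral(2)[OF set_integrable_bfun[OF bfun_rate_path[OF up that], of 0 0]]
    by (simp add: integral_unique[OF has_integral_refl(2)])
  ultimately show ?thesis by (rule that)
qed

end

section \<open>Destinations\<close>

lemma deriv_within_le_imp_diff_le:
  fixes f f' :: "real \<Rightarrow> real"
  assumes der: "\<And>t. 0 \<le> t \<Longrightarrow> (f has_real_derivative f' t) (at t within {0..})"
    and le: "\<And>t. 0 \<le> t \<Longrightarrow> f' t \<le> c" and st: "0 \<le> s" "s \<le> t"
  shows "f t - f s \<le> c * (t - s)"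
proof -
  have "\<exists>x\<in>{s..t}. f t - f s = (\<lambda>y. f' x * y) (t - s)"
    using st
    by (intro mvt_very_simple)
      (auto intro!: has_derivative_subset[OF der[unfolded has_field_derivative_def]])
  then obtain x where "x \<in> {s..t}" "f t - f s = f' x * (t - s)" by auto
  then show ?thesis using st le[of x] by (simp add: mult_right_mono)
qed

context removal
begin

section \<open>Solutions give trajectories of classes\<close>

lemma solutionD:
  assumes "solution w" "0 \<le> t"
  shows "unit_fun (w t)"
    "p \<in> space (M \<Otimes>\<^sub>M M) \<Longrightarrow> ((\<lambda>s. w s p) has_real_derivative vel (w t) p) (at t within {0..})"
  using assms by (auto simp: solution_def)

lemma vel_bound:
  assumes "unit_fun W" "p \<in> space (M \<Otimes>\<^sub>M M)"
  shows "\<bar>vel W p\<bar> \<le> real (card arcs)" "vel W p \<le> 0"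
proof -
  show "\<bar>vel W p\<bar> \<le> real (card arcs)"
    using bfun_bound[OF bfun_vel[OF unit_funD(2)[OF assms(1)]] assms(2)] by simp
  show "vel W p \<le> 0"
    using unit_funD(4)[OF assms] rate_nonneg[OF assms] by (simp add: vel_eq_rate[OF assms])
qed

lemma solution_lipschitz:
  assumes w: "solution w" and st: "0 \<le> s" "0 \<le> t" and p: "p \<in> space (M \<Otimes>\<^sub>M M)"
  shows "\<bar>w s p - w t p\<bar> \<le> real (card arcs) * \<bar>s - t\<bar>"
proof -
  have "norm (w s p - w t p) \<le> real (card arcs) * norm (s - t)"
  proof (rule field_differentiable_bound[where S = "{0..}" and f' = "\<lambda>r. vel (w r) p"])
    fix z :: real assume z: "z \<in> {0..}"
    then show "((\<lambda>s. w s p) has_real_derivative vel (w z) p) (at z within {0..})"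
      using solutionD(2)[OF w _ p] by simp
    show "norm (vel (w z) p) \<le> real (card arcs)"
      using vel_bound(1)[OF solutionD(1)[OF w] p] z by simp
  qed (use st in auto)
  then show ?thesis by simp
qed

text \<open>The error has to be uniform in \<open>p\<close> to give a derivative in norm. With the
  linear function of slope \<open>vel (w t) p\<close> subtracted, the remaining derivative is
  \<open>vel (w z) p - vel (w t) p\<close>, which is small because both \<open>vel\<close> and
  \<open>w\<close> are Lipschitz.\<close>

lemma solution_difference_quotient:
  assumes w: "solution w" and st: "0 \<le> s" "0 \<le> t" "s \<noteq> t" and p: "p \<in> space (M \<Otimes>\<^sub>M M)"
  shows "\<bar>(w s p - w t p) / (s - t) - vel (w t) p\<bar> \<le> lip * real (card arcs) * \<bar>s - t\<bar>"
proof -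
  let ?S = "{min s t..max s t}" and ?K = "lip * (real (card arcs) * \<bar>s - t\<bar>)"
  have "norm ((w s p - s * vel (w t) p) - (w t p - t * vel (w t) p)) \<le> ?K * norm (s - t)"
  proof (rule field_differentiable_bound[where S = ?S and f' = "\<lambda>r. vel (w r) p - 1 * vel (w t) p"])
    fix z assume z: "z \<in> ?S"
    have z0: "0 \<le> z" using z st by auto
    show "((\<lambda>s. w s p - s * vel (w t) p) has_real_derivative vel (w z) p - 1 * vel (w t) p) (at z within ?S)"
      using st by (intro DERIV_diff DERIV_cmult_right DERIV_ident DERIV_subset[OF solutionD(2)[OF w z0 p]]) auto
    have "\<bar>vel (w z) p - vel (w t) p\<bar> \<le> ?K"
    proof (rule vel_lipschitz[OF solutionD(1)[OF w z0] solutionD(1)[OF w st(2)] p])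
      fix q assume q: "q \<in> space (M \<Otimes>\<^sub>M M)"
      have "\<bar>w z q - w t q\<bar> \<le> real (card arcs) * \<bar>z - t\<bar>" by (rule solution_lipschitz[OF w z0 st(2) q])
      also have "\<dots> \<le> real (card arcs) * \<bar>s - t\<bar>" using z by (intro mult_left_mono) auto
      finally show "\<bar>w z q - w t q\<bar> \<le> real (card arcs) * \<bar>s - t\<bar>" .
    qed
    then show "norm (vel (w z) p - 1 * vel (w t) p) \<le> ?K" by simp
  qed auto
  then have "\<bar>(w s p - w t p) - (s - t) * vel (w t) p\<bar> \<le> ?K * \<bar>s - t\<bar>" by (simp add: algebra_simps)
  moreover have "(w s p - w t p) / (s - t) - vel (w t) p = ((w s p - w t p) - (s - t) * vel (w t) p) / (s - t)"
    using st by (simp add: field_simps)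
  ultimately show ?thesis using st by (simp add: abs_divide divide_le_eq mult.assoc)
qed

lemma class_unit_fun:
  assumes "unit_fun W"
  shows "kernel_class M W \<in> kernels M" "AE p in M \<Otimes>\<^sub>M M. rep (kernel_class M W) p = W p"
    "kernel_class M W \<in> graphons M"
proof -
  show k: "kernel_class M W \<in> kernels M" and ae: "AE p in M \<Otimes>\<^sub>M M. rep (kernel_class M W) p = W p"
    using kernel_class_in_kernels rep_kernel_class unit_funD(1)[OF assms] by auto
  have "AE p in M \<Otimes>\<^sub>M M. rep (kernel_class M W) p \<in> {0..1}"
    using ae AE_space by eventually_elim (use unit_funD(4,5)[OF assms] in auto)
  then show "kernel_class M W \<in> graphons M" using k by (simp add: graphons_def)
qed

lemma linf_norm_nonneg:
  assumes "f \<in> borel_measurable (M \<Otimes>\<^sub>M M)"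
  shows "0 \<le> linf_norm M f"
proof -
  interpret Q: prob_space "M \<Otimes>\<^sub>M M" by (rule prob_space_square)
  have "0 = esssup (M \<Otimes>\<^sub>M M) (\<lambda>_. 0 :: ereal)"
    by (rule esssup_const[symmetric]) (simp add: Q.emeasure_space_1)
  also have "\<dots> \<le> linf_norm M f"
    unfolding linf_norm_def by (rule esssup_mono) auto
  finally show ?thesis .
qed

lemma solution_trajectory:
  assumes w: "solution w" and X: "X = kernel_class M (w 0)"
  shows "is_trajectory M k rule X (\<lambda>t. kernel_class M (w t))"
  unfolding is_trajectory_def
proof (intro conjI allI impI)
  fix t :: real assume t: "0 \<le> t"
  let ?\<phi> = "\<lambda>t. kernel_class M (w t)"
  note c = class_unit_fun[OF solutionD(1)[OF w]]
  show "?\<phi> t \<in> kernels M" using c t by auto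
  let ?D = "velocity M k rule (?\<phi> t)"
  have D: "?D \<in> kernels M" "AE p in M \<Otimes>\<^sub>M M. rep ?D p = vel (w t) p"
    using velocity_removal[OF c(1)[OF t] unit_funD(1)[OF solutionD(1)[OF w t]] c(2)[OF t]] by auto
  have meas: "rep Y \<in> borel_measurable (M \<Otimes>\<^sub>M M)" if "Y \<in> kernels M" for Y
    using kernel_fun_rep[OF that] by (simp add: kernel_fun_def)
  let ?q = "\<lambda>s p. (rep (?\<phi> s) p - rep (?\<phi> t) p) / (s - t) - rep ?D p"
  have m: "?q s \<in> borel_measurable (M \<Otimes>\<^sub>M M)" if "0 \<le> s" for s
    using meas[OF c(1)[OF that]] meas[OF c(1)[OF t]] meas[OF D(1)] by measurable
  have ub: "linf_norm M (?q s) \<le> ereal (lip * real (card arcs) * \<bar>s - t\<bar>)" if s: "0 \<le> s" "s \<noteq> t" for s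
    unfolding linf_norm_def
  proof (rule esssup_I)
    show "(\<lambda>p. ereal \<bar>?q s p\<bar>) \<in> borel_measurable (M \<Otimes>\<^sub>M M)" using m[OF s(1)] by measurable
    show "AE p in M \<Otimes>\<^sub>M M. ereal \<bar>?q s p\<bar> \<le> ereal (lip * real (card arcs) * \<bar>s - t\<bar>)"
      using c(2)[OF t] c(2)[OF s(1)] D(2) AE_space
    proof eventually_elim
      fix p assume "rep (?\<phi> t) p = w t p" "rep (?\<phi> s) p = w s p" "rep ?D p = vel (w t) p"
        "p \<in> space (M \<Otimes>\<^sub>M M)"
      then show "ereal \<bar>?q s p\<bar> \<le> ereal (lip * real (card arcs) * \<bar>s - t\<bar>)"
        using solution_difference_quotient[OF w s(1) t s(2)] by simp
    qed
  qed
  have ev: "\<forall>\<^sub>F s in at t within {0..}. 0 \<le> s \<and> s \<noteq> t" by (simp add: eventually_at_filter)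
  show "has_linf_derivative M ?\<phi> ?D t"
    unfolding has_linf_derivative_def
  proof (rule tendsto_sandwich)
    show "\<forall>\<^sub>F s in at t within {0..}. 0 \<le> linf_norm M (?q s)"
      using ev by eventually_elim (use linf_norm_nonneg m in auto)
    show "\<forall>\<^sub>F s in at t within {0..}. linf_norm M (?q s) \<le> ereal (lip * real (card arcs) * \<bar>s - t\<bar>)"
      using ev by eventually_elim (use ub in auto)
    have "((\<lambda>s. lip * real (card arcs) * \<bar>s - t\<bar>) \<longlongrightarrow> lip * real (card arcs) * \<bar>t - t\<bar>) (at t within {0..})"
      by (intro tendsto_intros)
    then show "((\<lambda>s. ereal (lip * real (card arcs) * \<bar>s - t\<bar>)) \<longlongrightarrow> 0) (at t within {0..})"
      by (simp add: zero_ereal_def)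
  qed simp
qed (rule X[symmetric])

lemma graphon_solution:
  assumes X: "X \<in> graphons M"
  obtains w where "solution w" "X = kernel_class M (w 0)"
proof -
  \<comment> \<open>A representative lies in \<open>[0, 1]\<close> only almost everywhere;
    truncating it changes a null set and keeps the symmetry.\<close>
  define W where "W p = max 0 (min 1 (rep X p))" for p
  have Xk: "X \<in> kernels M" and ae: "AE p in M \<Otimes>\<^sub>M M. rep X p \<in> {0..1}"
    using X by (auto simp: graphons_def)
  have k: "kernel_fun M (rep X)" by (rule kernel_fun_rep[OF Xk])
  have W: "unit_fun W"
    unfolding unit_fun_def
  proof
    show "\<forall>p\<in>space (M \<Otimes>\<^sub>M M). W p \<in> {0..1}" by (simp add: W_def)
    have "W \<in> borel_measurable (M \<Otimes>\<^sub>M M)" using k unfolding W_def[abs_def] kernel_fun_def by auto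
    moreover have "\<exists>B. \<forall>p\<in>space (M \<Otimes>\<^sub>M M). \<bar>W p\<bar> \<le> B" by (intro exI[of _ 1]) (simp add: W_def)
    ultimately show "kernel_fun M W" using k by (simp add: kernel_fun_def W_def)
  qed
  obtain w where w: "solution w" "\<And>p. p \<in> space (M \<Otimes>\<^sub>M M) \<Longrightarrow> w 0 p = W p"
    using solution_exists[OF W] by blast
  note c = class_unit_fun[OF solutionD(1)[OF w(1) order_refl]]
  have "X = kernel_class M (w 0)"
  proof (rule kernels_eqI[OF Xk c(1)])
    show "AE p in M \<Otimes>\<^sub>M M. rep X p = rep (kernel_class M (w 0)) p"
      using c(2) ae AE_space by eventually_elim (auto simp: w(2) W_def)
  qed
  then show ?thesis using w(1) that by blast
qed

lemma set_integral_class: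
  assumes "unit_fun W" "A \<in> sets (M \<Otimes>\<^sub>M M)"
  shows "(LINT p:A|M \<Otimes>\<^sub>M M. rep (kernel_class M W) p) = (LINT p:A|M \<Otimes>\<^sub>M M. W p)"
  using kernel_fun_rep[OF class_unit_fun(1)[OF assms(1)]] unit_funD(3)[OF assms(1)] assms(2)
    class_unit_fun(2)[OF assms(1)]
  by (intro set_integral_cong_AE2) (auto simp: kernel_fun_def)

lemma set_integral_class_diff:
  assumes U: "unit_fun U" and V: "unit_fun V" and A: "A \<in> sets (M \<Otimes>\<^sub>M M)"
  shows "(LINT p:A|M \<Otimes>\<^sub>M M. (rep (kernel_class M U) p - rep (kernel_class M V) p)) =
    (LINT p:A|M \<Otimes>\<^sub>M M. (U p - V p))"
proof (rule set_integral_cong_AE2[OF _ _ A])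
  show "AE p in M \<Otimes>\<^sub>M M. rep (kernel_class M U) p - rep (kernel_class M V) p = U p - V p"
    using class_unit_fun(2)[OF U] class_unit_fun(2)[OF V] by eventually_elim simp
qed (use kernel_fun_rep[OF class_unit_fun(1)[OF U]] kernel_fun_rep[OF class_unit_fun(1)[OF V]]
    unit_funD(3)[OF U] unit_funD(3)[OF V] in \<open>auto simp: kernel_fun_def\<close>)

text \<open>Taken from the trajectory of classes, where the derivative in norm passes through the
  integral, rather than by differentiating under the integral sign.\<close>

lemma solution_integral_deriv:
  assumes w: "solution w" and A: "A \<in> sets (M \<Otimes>\<^sub>M M)" and t: "0 \<le> t"
  shows "((\<lambda>s. LINT p:A|M \<Otimes>\<^sub>M M. w s p) has_real_derivative (LINT p:A|M \<Otimes>\<^sub>M M. vel (w t) p)) (at t within {0..})"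
proof -
  note u = solutionD(1)[OF w]
  note c = class_unit_fun[OF u]
  note D = velocity_removal[OF c(1)[OF t] unit_funD(1)[OF u[OF t]] c(2)[OF t]]
  have "(LINT p:A|M \<Otimes>\<^sub>M M. rep (velocity M k rule (kernel_class M (w t))) p) = (LINT p:A|M \<Otimes>\<^sub>M M. vel (w t) p)"
    using kernel_fun_rep[OF D(1)] kernel_fun_vel[OF unit_funD(1)[OF u[OF t]]] A D(2)
    by (intro set_integral_cong_AE2) (auto simp: kernel_fun_def)
  with has_derivative_set_integral_trajectory[OF solution_trajectory[OF w refl] A t]
  have "((\<lambda>s. LINT p:A|M \<Otimes>\<^sub>M M. rep (kernel_class M (w s)) p) has_real_derivative
     (LINT p:A|M \<Otimes>\<^sub>M M. vel (w t) p)) (at t within {0..})" by simp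
  then show ?thesis
    using t set_integral_class[OF u A]
    by (auto intro: has_field_derivative_transform_within[of _ _ _ _ 1])
qed

section \<open>The monotone limit of a solution\<close>

lemma solution_antimono:
  assumes w: "solution w" and st: "0 \<le> s" "s \<le> t" and p: "p \<in> space (M \<Otimes>\<^sub>M M)"
  shows "w t p \<le> w s p"
  using deriv_within_le_imp_diff_le[of "\<lambda>s. w s p" "\<lambda>s. vel (w s) p" 0 s t]
    solutionD[OF w] vel_bound(2)[OF solutionD(1)[OF w] p] st p by auto

text \<open>By monotonicity, integer times suffice for the limit, and a sequence is what
  measurability and dominated convergence need.\<close>

definition final :: "(real \<Rightarrow> 'a \<times> 'a \<Rightarrow> real) \<Rightarrow> 'a \<times> 'a \<Rightarrow> real" where
  "final w p = lim (\<lambda>n. w (real n) p)"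

lemma final_tendsto:
  assumes w: "solution w" and p: "p \<in> space (M \<Otimes>\<^sub>M M)"
  shows "(\<lambda>n. w (real n) p) \<longlonglongrightarrow> final w p"
proof -
  have "decseq (\<lambda>n. w (real n) p)"
    using solution_antimono[OF w _ _ p] by (auto simp: decseq_def)
  moreover have "0 \<le> w (real n) p" for n
    using unit_funD(4)[OF solutionD(1)[OF w] p] by simp
  ultimately obtain L where "(\<lambda>n. w (real n) p) \<longlonglongrightarrow> L" using decseq_convergent by metis
  then show ?thesis unfolding final_def by (simp add: limI)
qed

lemma final_le:
  assumes w: "solution w" and p: "p \<in> space (M \<Otimes>\<^sub>M M)" and t: "0 \<le> t"
  shows "final w p \<le> w t p"
proof (rule LIMSEQ_le_const2[OF final_tendsto[OF w p]])
  obtain N where "t \<le> real N" using real_arch_simple by blast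
  then show "\<exists>N. \<forall>n\<ge>N. w (real n) p \<le> w t p"
    using solution_antimono[OF w t _ p] by (intro exI[of _ N]) auto
qed

lemma unit_fun_final:
  assumes w: "solution w"
  shows "unit_fun (final w)"
proof -
  note u = solutionD(1)[OF w of_nat_0_le_iff]
  have r: "final w p \<in> {0..1}" if p: "p \<in> space (M \<Otimes>\<^sub>M M)" for p
    using LIMSEQ_le_const[OF final_tendsto[OF w p], of 0] LIMSEQ_le_const2[OF final_tendsto[OF w p], of 1]
      unit_funD(4,5)[OF u p] by auto
  have "final w \<in> borel_measurable (M \<Otimes>\<^sub>M M)"
    unfolding final_def[abs_def] by (intro borel_measurable_lim_metric unit_funD(3)[OF u])
  moreover have "\<exists>B. \<forall>p\<in>space (M \<Otimes>\<^sub>M M). \<bar>final w p\<bar> \<le> B" using r by (intro exI[of _ 1]) fastforce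
  moreover have "final w (x, y) = final w (y, x)" if "x \<in> space M" "y \<in> space M" for x y
  proof -
    have "w (real n) (x, y) = w (real n) (y, x)" for n
      using unit_funD(1)[OF u[of n]] that by (simp add: kernel_fun_def)
    then show ?thesis by (simp add: final_def)
  qed
  ultimately show ?thesis using r unfolding unit_fun_def kernel_fun_def by blast
qed

lemma integral_final_tendsto:
  assumes w: "solution w"
  shows "(\<lambda>n. LINT p|(M \<Otimes>\<^sub>M M). w (real n) p) \<longlonglongrightarrow> (LINT p|(M \<Otimes>\<^sub>M M). final w p)"
proof -
  interpret Q: prob_space "M \<Otimes>\<^sub>M M" by (rule prob_space_square)
  note u = solutionD(1)[OF w of_nat_0_le_iff]
  show ?thesis
  proof (rule integral_dominated_convergence[where w = "\<lambda>_. 1"])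
    show "AE p in M \<Otimes>\<^sub>M M. (\<lambda>n. w (real n) p) \<longlonglongrightarrow> final w p"
      using final_tendsto[OF w] by (rule AE_I2)
    show "AE p in M \<Otimes>\<^sub>M M. norm (w (real n) p) \<le> 1" for n
      using unit_funD(4,5)[OF u[of n]] by (intro AE_I2) auto
  qed (use unit_funD(3)[OF u] unit_funD(3)[OF unit_fun_final[OF w]] in auto)
qed

text \<open>As \<open>V \<le> U\<close>, nothing cancels: the difference of the integrals is the
  \<open>L^1\<close> distance, which dominates the integral over any rectangle.\<close>

lemma cut_dist_le_integral_diff:
  assumes U: "unit_fun U" and V: "unit_fun V" and le: "\<And>p. p \<in> space (M \<Otimes>\<^sub>M M) \<Longrightarrow> V p \<le> U p"
  shows "cut_dist M (kernel_class M U) (kernel_class M V) \<le> (LINT p|(M \<Otimes>\<^sub>M M). U p) - (LINT p|(M \<Otimes>\<^sub>M M). V p)"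
proof (rule cut_dist_least)
  interpret Q: prob_space "M \<Otimes>\<^sub>M M" by (rule prob_space_square)
  fix S T assume ST: "S \<in> sets M" "T \<in> sets M"
  have i: "integrable (M \<Otimes>\<^sub>M M) U" "integrable (M \<Otimes>\<^sub>M M) V"
    using Q.integrable_bfun unit_funD(2)[OF U] unit_funD(2)[OF V] by auto
  have "\<bar>LINT p:S \<times> T|M \<Otimes>\<^sub>M M. (rep (kernel_class M U) p - rep (kernel_class M V) p)\<bar> =
      \<bar>LINT p:S \<times> T|M \<Otimes>\<^sub>M M. (U p - V p)\<bar>"
    using ST by (subst set_integral_class_diff[OF U V]) auto
  also have "\<dots> \<le> (LINT p|(M \<Otimes>\<^sub>M M). \<bar>indicator (S \<times> T) p *\<^sub>R (U p - V p)\<bar>)"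
    unfolding set_lebesgue_integral_def by (rule integral_abs_bound)
  also have "\<dots> \<le> (LINT p|(M \<Otimes>\<^sub>M M). U p - V p)"
    using i ST le by (intro integral_mono integrable_abs integrable_mult_indicator) (auto simp: indicator_def)
  also have "\<dots> = (LINT p|(M \<Otimes>\<^sub>M M). U p) - (LINT p|(M \<Otimes>\<^sub>M M). V p)" using i by simp
  finally show "\<bar>LINT p:S \<times> T|M \<Otimes>\<^sub>M M. (rep (kernel_class M U) p - rep (kernel_class M V) p)\<bar>
    \<le> (LINT p|(M \<Otimes>\<^sub>M M). U p) - (LINT p|(M \<Otimes>\<^sub>M M). V p)" .
qed

lemma integral_mono_unit:
  assumes "unit_fun U" "unit_fun V" "\<And>p. p \<in> space (M \<Otimes>\<^sub>M M) \<Longrightarrow> V p \<le> U p"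
  shows "(LINT p|(M \<Otimes>\<^sub>M M). V p) \<le> (LINT p|(M \<Otimes>\<^sub>M M). U p)"
proof -
  interpret Q: prob_space "M \<Otimes>\<^sub>M M" by (rule prob_space_square)
  show ?thesis using assms unit_funD(2) by (intro integral_mono Q.integrable_bfun) auto
qed

lemma cut_dist_final_tendsto:
  assumes w: "solution w"
  shows "((\<lambda>t. cut_dist M (kernel_class M (w t)) (kernel_class M (final w))) \<longlongrightarrow> 0) at_top"
proof (rule tendstoI)
  fix e :: real assume e: "0 < e"
  note u = solutionD(1)[OF w]
  note f = unit_fun_final[OF w]
  have "\<forall>\<^sub>F n in sequentially. (LINT p|(M \<Otimes>\<^sub>M M). w (real n) p) < (LINT p|(M \<Otimes>\<^sub>M M). final w p) + e"
    using e by (intro order_tendstoD(2)[OF integral_final_tendsto[OF w]]) simp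
  then obtain n where n: "(LINT p|(M \<Otimes>\<^sub>M M). w (real n) p) < (LINT p|(M \<Otimes>\<^sub>M M). final w p) + e"
    by (auto simp: eventually_sequentially)
  \<comment> \<open>The mass only decreases further after time \<open>real n\<close>, so one good
    \<open>n\<close> serves all later times.\<close>
  have "\<forall>\<^sub>F t in at_top. real n \<le> t" by (rule eventually_ge_at_top)
  then show "\<forall>\<^sub>F t in at_top. dist (cut_dist M (kernel_class M (w t)) (kernel_class M (final w))) 0 < e"
  proof eventually_elim
    fix t assume t: "real n \<le> t"
    then have t0: "0 \<le> t" by (meson of_nat_0_le_iff order_trans)
    have "cut_dist M (kernel_class M (w t)) (kernel_class M (final w)) \<le>
        (LINT p|(M \<Otimes>\<^sub>M M). w t p) - (LINT p|(M \<Otimes>\<^sub>M M). final w p)"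
      by (rule cut_dist_le_integral_diff[OF u[OF t0] f final_le[OF w _ t0]])
    also have "(LINT p|(M \<Otimes>\<^sub>M M). w t p) \<le> (LINT p|(M \<Otimes>\<^sub>M M). w (real n) p)"
      using t by (intro integral_mono_unit u t0 solution_antimono[OF w]) auto
    also have "\<dots> - (LINT p|(M \<Otimes>\<^sub>M M). final w p) < e" using n by simp
    finally show "dist (cut_dist M (kernel_class M (w t)) (kernel_class M (final w))) 0 < e"
      using cut_dist_nonneg[OF class_unit_fun(1)[OF u[OF t0]] class_unit_fun(1)[OF f]] by (simp add: dist_real_def)
  qed
qed

text \<open>Both descriptions are resolved by uniqueness: \<open>flow\<close> by that of
  trajectories, \<open>dest\<close> by that of limits in the cut metric. The limit sees only large
  \<open>t\<close>, so the values of \<open>flow\<close> at negative times do not interfere.\<close>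

lemma dest_eq:
  assumes w: "solution w" and X: "X = kernel_class M (w 0)"
  shows "dest M k rule X = kernel_class M (final w)"
proof -
  have fl: "flow M k rule t X = kernel_class M (w t)" if "0 \<le> t" for t
    by (rule flow_eq[OF solution_trajectory[OF w X] that])
  have ev: "\<forall>\<^sub>F t::real in at_top. 0 \<le> t" by (rule eventually_ge_at_top)
  note c = class_unit_fun[OF unit_fun_final[OF w]]
  have iff: "((\<lambda>t. cut_dist M (flow M k rule t X) S) \<longlongrightarrow> 0) at_top \<longleftrightarrow>
      ((\<lambda>t. cut_dist M (kernel_class M (w t)) S) \<longlongrightarrow> 0) at_top" for S
    by (intro tendsto_cong) (use ev in eventually_elim, simp add: fl)
  show ?thesis
    unfolding dest_def iff
  proof (rule the_equality)
    show "kernel_class M (final w) \<in> graphons M \<and>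
        ((\<lambda>t. cut_dist M (kernel_class M (w t)) (kernel_class M (final w))) \<longlongrightarrow> 0) at_top"
      using c(3) cut_dist_final_tendsto[OF w] by blast
    fix S assume S: "S \<in> graphons M \<and> ((\<lambda>t. cut_dist M (kernel_class M (w t)) S) \<longlongrightarrow> 0) at_top"
    then have Sk: "S \<in> kernels M" by (simp add: graphons_def)
    have "((\<lambda>t. cut_dist M (kernel_class M (w t)) S + cut_dist M (kernel_class M (w t)) (kernel_class M (final w)))
        \<longlongrightarrow> 0 + 0) at_top"
      using S cut_dist_final_tendsto[OF w] by (intro tendsto_add) auto
    moreover have "\<forall>\<^sub>F t in at_top. cut_dist M S (kernel_class M (final w)) \<le>
        cut_dist M (kernel_class M (w t)) S + cut_dist M (kernel_class M (w t)) (kernel_class M (final w))"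
      using ev
    proof eventually_elim
      fix t :: real assume "0 \<le> t"
      from cut_dist_triangle[OF Sk class_unit_fun(1)[OF solutionD(1)[OF w this]] c(1)]
      show "cut_dist M S (kernel_class M (final w)) \<le>
        cut_dist M (kernel_class M (w t)) S + cut_dist M (kernel_class M (w t)) (kernel_class M (final w))"
        by (simp add: cut_dist_commute)
    qed
    ultimately have "cut_dist M S (kernel_class M (final w)) \<le> 0 + 0"
      by (intro tendsto_lowerbound) auto
    then show "S = kernel_class M (final w)"
      using cut_dist_nonneg[OF Sk c(1)] cut_dist_eq_0_iff[OF Sk c(1)] by simp
  qed
qed

text \<open>Double counting: a copy \<open>u\<close> of \<open>F\<close> drains every one of its
  arcs, so its share in the loss on \<open>A\<close> is the number of its arcs that lie in
  \<open>A\<close>.\<close>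

lemma integral_vel:
  assumes W: "unit_fun W" and A: "A \<in> sets (M \<Otimes>\<^sub>M M)"
  shows "(LINT p:A|M \<Otimes>\<^sub>M M. vel W p) =
    - (LINT u|Pi\<^sub>M {1..k} (\<lambda>_. M). (\<Sum>(a, b)\<in>arcs. indicator A (u a, u b)) * hom edges W u)"
proof -
  interpret Q: prob_space "M \<Otimes>\<^sub>M M" by (rule prob_space_square)
  interpret N: prob_space "Pi\<^sub>M {1..k} (\<lambda>_. M)" by (rule prob_space_PiM_const)
  note b = unit_funD(2)[OF W] and ind = bfun_indicator[OF A]
  have ab: "fst e \<in> {1..k}" "snd e \<in> {1..k}" "fst e \<noteq> snd e" if "e \<in> arcs" for e
    using that by (auto simp: arcs_def)
  have "(LINT p:A|M \<Otimes>\<^sub>M M. vel W p) = - (LINT p|(M \<Otimes>\<^sub>M M). (\<Sum>e\<in>arcs. indicator A p * rooted edges (fst e) (snd e) W p))"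
    unfolding set_lebesgue_integral_def vel_def
    by (simp add: sum_distrib_left case_prod_unfold)
  also have "(LINT p|(M \<Otimes>\<^sub>M M). (\<Sum>e\<in>arcs. indicator A p * rooted edges (fst e) (snd e) W p)) =
      (\<Sum>e\<in>arcs. LINT p|(M \<Otimes>\<^sub>M M). indicator A p * rooted edges (fst e) (snd e) W p)"
    by (intro Bochner_Integration.integral_sum Q.integrable_bfun[OF bfun_mult[OF ind bfun_rooted[OF subset_refl _ _ _ b]]] ab)
  also have "\<dots> = (\<Sum>e\<in>arcs. LINT u|Pi\<^sub>M {1..k} (\<lambda>_. M). indicator A (u (fst e), u (snd e)) * hom edges W u)"
    by (intro sum.cong refl integral_rooted[OF subset_refl _ _ _ b ind] ab)
  also have "\<dots> = (LINT u|Pi\<^sub>M {1..k} (\<lambda>_. M). (\<Sum>e\<in>arcs. indicator A (u (fst e), u (snd e)) * hom edges W u))"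
    by (intro Bochner_Integration.integral_sum[symmetric]
        N.integrable_bfun[OF bfun_mult[OF bfun_PiM_pair[OF ind] bfun_hom[OF subset_refl b]]] ab)
  finally show ?thesis by (simp add: sum_distrib_right case_prod_unfold)
qed

end

section \<open>Continuity of the destination\<close>

context removal
begin

text \<open>The density of \<open>F\<close> along the trajectory stays above its value
  \<open>\<tau>\<close> at the limit, by monotonicity. If \<open>\<tau>\<close> were positive, mass
  would be lost at a rate bounded away from zero forever.\<close>

lemma final_hom_free:
  assumes w: "solution w"
  shows "AE u in Pi\<^sub>M {1..k} (\<lambda>_. M). hom edges (final w) u = 0"
proof -
  interpret Q: prob_space "M \<Otimes>\<^sub>M M" by (rule prob_space_square)
  interpret N: prob_space "Pi\<^sub>M {1..k} (\<lambda>_. M)" by (rule prob_space_PiM_const)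
  let ?N = "real (card arcs)" and ?S = "space (M \<Otimes>\<^sub>M M)"
  note u = solutionD(1)[OF w] and f = unit_fun_final[OF w]
  have int: "integrable (Pi\<^sub>M {1..k} (\<lambda>_. M)) (hom edges W)" if "unit_fun W" for W
    by (rule N.integrable_bfun[OF bfun_hom[OF subset_refl unit_funD(2)[OF that]]])
  define \<tau> where "\<tau> = (LINT u|Pi\<^sub>M {1..k} (\<lambda>_. M). hom edges (final w) u)"
  have d: "(LINT p:?S|M \<Otimes>\<^sub>M M. vel (w t) p) \<le> - (?N * \<tau>)" if t: "0 \<le> t" for t
  proof -
    have "(LINT p:?S|M \<Otimes>\<^sub>M M. vel (w t) p) =
        - (LINT u|Pi\<^sub>M {1..k} (\<lambda>_. M). ?N * hom edges (w t) u)"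
    proof -
      have "(\<Sum>(a, b)\<in>arcs. indicator ?S (x a, x b) :: real) = ?N"
        if "x \<in> space (Pi\<^sub>M {1..k} (\<lambda>_. M))" for x
      proof -
        have "(x a, x b) \<in> ?S" if "(a, b) \<in> arcs" for a b
          using arcsD[OF that] \<open>x \<in> _\<close> by (auto simp: space_PiM space_pair_measure)
        then have "(\<Sum>(a, b)\<in>arcs. indicator ?S (x a, x b) :: real) = (\<Sum>(a, b)\<in>arcs. 1)"
          by (intro sum.cong) auto
        then show ?thesis by (simp add: case_prod_unfold)
      qed
      then show ?thesis
        unfolding integral_vel[OF u[OF t] sets.top]
        by (intro arg_cong[where f = uminus] Bochner_Integration.integral_cong) auto
    qed
    also have "\<dots> \<le> - (?N * \<tau>)"
    proof -
      have "\<tau> \<le> (LINT u|Pi\<^sub>M {1..k} (\<lambda>_. M). hom edges (w t) u)"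
        unfolding \<tau>_def
      proof (rule integral_mono[OF int[OF f] int[OF u[OF t]]])
        fix x assume x: "x \<in> space (Pi\<^sub>M {1..k} (\<lambda>_. M))"
        show "hom edges (final w) x \<le> hom edges (w t) x"
          unfolding hom_def
          using unit_funD(4)[OF f pair_in_space[OF x]] final_le[OF w pair_in_space[OF x] t]
          by (intro prod_mono) auto
      qed
      then show ?thesis by (simp add: mult_left_mono)
    qed
    finally show ?thesis .
  qed
  have \<tau>0: "\<tau> \<le> 0"
  proof (rule ccontr)
    assume "\<not> \<tau> \<le> 0"
    then have pos: "0 < ?N * \<tau>" using card_arcs_pos by simp
    \<comment> \<open>By time \<open>real n\<close> more than the whole initial mass, which is at
      most \<open>1\<close>, would be gone.\<close>
    obtain n :: nat where n: "1 < real n * (?N * \<tau>)" using reals_Archimedean3[OF pos] by blast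
    have "(LINT p:?S|M \<Otimes>\<^sub>M M. w (real n) p) - (LINT p:?S|M \<Otimes>\<^sub>M M. w 0 p) \<le> - (?N * \<tau>) * (real n - 0)"
      by (rule deriv_within_le_imp_diff_le[OF solution_integral_deriv[OF w sets.top] d]) auto
    moreover have "0 \<le> (LINT p:?S|M \<Otimes>\<^sub>M M. w (real n) p)"
      unfolding set_lebesgue_integral_def
      using unit_funD(4)[OF u[OF of_nat_0_le_iff]] by (intro Bochner_Integration.integral_nonneg) auto
    moreover have "\<bar>LINT p:?S|M \<Otimes>\<^sub>M M. w 0 p\<bar> \<le> 1"
      using unit_funD(4,5)[OF u[OF order_refl]]
      by (intro Q.abs_set_integral_AE_le Q.integrable_bfun[OF unit_funD(2)[OF u[OF order_refl]]] AE_I2) auto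
    ultimately show False using n by (simp add: algebra_simps abs_le_iff)
  qed
  have nn: "AE x in Pi\<^sub>M {1..k} (\<lambda>_. M). 0 \<le> hom edges (final w) x"
    using hom_nonneg[OF f subset_refl] by (rule AE_I2)
  then have "\<tau> = 0" using \<tau>0 integral_nonneg_AE[OF nn] by (simp add: \<tau>_def)
  then show ?thesis
    using integral_nonneg_eq_0_iff_AE[OF int[OF f] nn] by (simp add: \<tau>_def)
qed

definition zero_set :: "('a \<times> 'a \<Rightarrow> real) \<Rightarrow> ('a \<times> 'a) set" where
  "zero_set V = {p \<in> space (M \<Otimes>\<^sub>M M). V p = 0}"

lemma zero_set_sets: "unit_fun V \<Longrightarrow> zero_set V \<in> sets (M \<Otimes>\<^sub>M M)"
  unfolding zero_set_def using unit_funD(3)[of V] by measurable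

text \<open>Every copy of \<open>F\<close> uses an edge of the zero set of an \<open>F\<close>-free \<open>V\<close>, so the total loss of
  any solution is at most a constant times its loss on that set.\<close>

lemma solution_loss_le:
  assumes V: "unit_fun V" "AE u in Pi\<^sub>M {1..k} (\<lambda>_. M). hom edges V u = 0"
    and w: "solution w" and st: "0 \<le> s" "s \<le> t"
  shows "(LINT p|(M \<Otimes>\<^sub>M M). w s p) - (LINT p|(M \<Otimes>\<^sub>M M). w t p)
    \<le> real (card arcs) * (LINT p:zero_set V|M \<Otimes>\<^sub>M M. w s p)"
proof -
  interpret N: prob_space "Pi\<^sub>M {1..k} (\<lambda>_. M)" by (rule prob_space_PiM_const)
  let ?N = "real (card arcs)" and ?S = "space (M \<Otimes>\<^sub>M M)" and ?B = "zero_set V"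
  note u = solutionD(1)[OF w] and B = zero_set_sets[OF V(1)]
  have cnt: "bfun (Pi\<^sub>M {1..k} (\<lambda>_. M)) ?N (\<lambda>x. \<Sum>e\<in>arcs. indicator A (x (fst e), x (snd e)))"
    if "A \<in> sets (M \<Otimes>\<^sub>M M)" for A
  proof -
    have "bfun (Pi\<^sub>M {1..k} (\<lambda>_. M)) 1 (\<lambda>x. indicator A (x (fst e), x (snd e)))" if "e \<in> arcs" for e
      using that by (intro bfun_PiM_pair[OF bfun_indicator[OF \<open>A \<in> _\<close>]]) (auto simp: arcs_def)
    from bfun_sum[of arcs, OF this] show ?thesis by simp
  qed
  \<comment> \<open>Rates of loss are compared copy by copy: the whole square counts all
    \<open>?N\<close> arcs of a copy, the zero set at least one of them.\<close>
  have d: "?N * (LINT p:?B|M \<Otimes>\<^sub>M M. vel (w r) p) - (LINT p:?S|M \<Otimes>\<^sub>M M. vel (w r) p) \<le> 0" if r: "0 \<le> r" for r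
  proof -
    let ?h = "hom edges (w r)"
    have i: "integrable (Pi\<^sub>M {1..k} (\<lambda>_. M)) (\<lambda>x. (\<Sum>(a, b)\<in>arcs. indicator A (x a, x b)) * ?h x)"
      if "A \<in> sets (M \<Otimes>\<^sub>M M)" for A
      using N.integrable_bfun[OF bfun_mult[OF cnt[OF that] bfun_hom[OF subset_refl unit_funD(2)[OF u[OF r]]]]]
      by (simp add: case_prod_unfold)
    have "(LINT x|Pi\<^sub>M {1..k} (\<lambda>_. M). (\<Sum>(a, b)\<in>arcs. indicator ?S (x a, x b)) * ?h x)
        \<le> (LINT x|Pi\<^sub>M {1..k} (\<lambda>_. M). ?N * ((\<Sum>(a, b)\<in>arcs. indicator ?B (x a, x b)) * ?h x))"
    proof (rule integral_mono_AE[OF i[OF sets.top] integrable_mult_right[OF i[OF B]]])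
      show "AE x in Pi\<^sub>M {1..k} (\<lambda>_. M). (\<Sum>(a, b)\<in>arcs. indicator ?S (x a, x b)) * ?h x
          \<le> ?N * ((\<Sum>(a, b)\<in>arcs. indicator ?B (x a, x b)) * ?h x)"
        using V(2) AE_space
      proof eventually_elim
        fix x assume z: "hom edges V x = 0" and x: "x \<in> space (Pi\<^sub>M {1..k} (\<lambda>_. M))"
        obtain i j where ij: "(i, j) \<in> edges" "V (x i, x j) = 0"
          using z finite_edges by (auto simp: hom_def prod_zero_iff)
        have arc: "(i, j) \<in> arcs" using ij(1) by (auto simp: edges_def arcs_def)
        have "(x i, x j) \<in> ?B" using ij pair_in_space[OF x ij(1)] by (simp add: zero_set_def)
        then have "1 \<le> (\<Sum>e\<in>arcs. indicator ?B (x (fst e), x (snd e)) :: real)"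
          using member_le_sum[OF arc, of "\<lambda>e. indicator ?B (x (fst e), x (snd e)) :: real"] finite_arcs
          by simp
        then have 1: "1 \<le> (\<Sum>(a, b)\<in>arcs. indicator ?B (x a, x b) :: real)" by (simp add: case_prod_unfold)
        have "(\<Sum>(a, b)\<in>arcs. indicator ?S (x a, x b) :: real) \<le> ?N * 1"
          by (rule sum_bounded_above) (auto simp: indicator_def)
        also have "\<dots> \<le> ?N * (\<Sum>(a, b)\<in>arcs. indicator ?B (x a, x b))"
          using 1 by (intro mult_left_mono) auto
        finally show "(\<Sum>(a, b)\<in>arcs. indicator ?S (x a, x b)) * ?h x
            \<le> ?N * ((\<Sum>(a, b)\<in>arcs. indicator ?B (x a, x b)) * ?h x)"
          using mult_right_mono[OF _ hom_nonneg[OF u[OF r] subset_refl x]] by (simp only: mult.assoc[symmetric])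
      qed
    qed
    then show ?thesis by (simp add: integral_vel[OF u[OF r]] B)
  qed
  have "(?N * (LINT p:?B|M \<Otimes>\<^sub>M M. w t p) - (LINT p:?S|M \<Otimes>\<^sub>M M. w t p)) -
      (?N * (LINT p:?B|M \<Otimes>\<^sub>M M. w s p) - (LINT p:?S|M \<Otimes>\<^sub>M M. w s p)) \<le> 0 * (t - s)"
    using st d
    by (intro deriv_within_le_imp_diff_le[where f = "\<lambda>r. ?N * (LINT p:?B|M \<Otimes>\<^sub>M M. w r p) - (LINT p:?S|M \<Otimes>\<^sub>M M. w r p)"
          and f' = "\<lambda>r. ?N * (LINT p:?B|M \<Otimes>\<^sub>M M. vel (w r) p) - (LINT p:?S|M \<Otimes>\<^sub>M M. vel (w r) p)"])
      (auto intro!: DERIV_diff DERIV_cmult solution_integral_deriv[OF w] B)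
  moreover have "0 \<le> (LINT p:?B|M \<Otimes>\<^sub>M M. w t p)"
    unfolding set_lebesgue_integral_def
    using unit_funD(4)[OF u[of t]] st by (intro Bochner_Integration.integral_nonneg) auto
  then have "0 \<le> ?N * (LINT p:?B|M \<Otimes>\<^sub>M M. w t p)" by simp
  moreover have "(LINT p:?S|M \<Otimes>\<^sub>M M. w r p) = (LINT p|(M \<Otimes>\<^sub>M M). w r p)" for r
    unfolding set_lebesgue_integral_def by (rule Bochner_Integration.integral_cong) auto
  ultimately show ?thesis by simp
qed

text \<open>The zero set belongs to \<open>V\<close> and not to the destination of \<open>w\<close>;
  this makes the estimate usable for all solutions near a given one. The loss on the set after time
  \<open>s\<close> is bounded by all the mass that is there at time \<open>s\<close>.\<close>

lemma cut_dist_final_le: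
  assumes V: "unit_fun V" "AE u in Pi\<^sub>M {1..k} (\<lambda>_. M). hom edges V u = 0"
    and w: "solution w" and s: "0 \<le> s"
  shows "cut_dist M (kernel_class M (w s)) (kernel_class M (final w))
    \<le> real (card arcs) * (LINT p:zero_set V|M \<Otimes>\<^sub>M M. w s p)"
proof -
  have "cut_dist M (kernel_class M (w s)) (kernel_class M (final w))
      \<le> (LINT p|(M \<Otimes>\<^sub>M M). w s p) - (LINT p|(M \<Otimes>\<^sub>M M). final w p)"
    by (rule cut_dist_le_integral_diff[OF solutionD(1)[OF w s] unit_fun_final[OF w] final_le[OF w _ s]])
  also have "\<dots> \<le> real (card arcs) * (LINT p:zero_set V|M \<Otimes>\<^sub>M M. w s p)"
  proof (rule LIMSEQ_le_const2)
    show "(\<lambda>n. (LINT p|(M \<Otimes>\<^sub>M M). w s p) - (LINT p|(M \<Otimes>\<^sub>M M). w (real n) p))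
        \<longlonglongrightarrow> (LINT p|(M \<Otimes>\<^sub>M M). w s p) - (LINT p|(M \<Otimes>\<^sub>M M). final w p)"
      by (intro tendsto_intros integral_final_tendsto[OF w])
    obtain n where "s \<le> real n" using real_arch_simple by blast
    then show "\<exists>N. \<forall>n\<ge>N. (LINT p|(M \<Otimes>\<^sub>M M). w s p) - (LINT p|(M \<Otimes>\<^sub>M M). w (real n) p)
        \<le> real (card arcs) * (LINT p:zero_set V|M \<Otimes>\<^sub>M M. w s p)"
      using solution_loss_le[OF V w s] by (intro exI[of _ n]) auto
  qed
  finally show ?thesis .
qed

text \<open>The factor depends on \<open>t\<close> but not on the solutions: values in
  \<open>[0, 1]\<close> allow the Lipschitz constant \<open>cut_lip 1\<close> for all of
  them.\<close>

lemma flow_cut_continuous: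
  assumes "0 \<le> t"
  obtains L where "0 < L" "\<And>v w. solution v \<Longrightarrow> solution w \<Longrightarrow>
    cut_dist M (kernel_class M (v t)) (kernel_class M (w t))
      \<le> L * cut_dist M (kernel_class M (v 0)) (kernel_class M (w 0))"
proof -
  have L: "0 < cut_lip 1" unfolding cut_lip_def by (intro add_nonneg_pos) auto
  obtain n :: nat where "t * (2 * cut_lip 1) \<le> real n" using real_arch_simple by blast
  then have n: "t \<le> real n / (2 * cut_lip 1)" using L by (simp add: field_simps)
  have b: "AE p in M \<Otimes>\<^sub>M M. \<bar>rep (kernel_class M (w s)) p\<bar> \<le> 1" if "solution w" "s \<in> {0..t}" for w s
  proof -
    have u: "unit_fun (w s)" using solutionD(1)[OF that(1)] that(2) by simp
    show ?thesis
      using class_unit_fun(2)[OF u] AE_space by eventually_elim (use unit_funD(4,5)[OF u] in auto)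
  qed
  show ?thesis
  proof (rule that[of "2 ^ n"])
    fix v w assume "solution v" "solution w"
    then show "cut_dist M (kernel_class M (v t)) (kernel_class M (w t))
      \<le> 2 ^ n * cut_dist M (kernel_class M (v 0)) (kernel_class M (w 0))"
      by (intro trajectory_cut_stability[OF solution_trajectory[OF _ refl] solution_trajectory[OF _ refl] _ b b assms n])
        auto
  qed simp
qed

end

section \<open>Fixed measurable sets tested against the cut norm\<close>

context prob_space
begin

text \<open>Cut smallness speaks of rectangles only, while the zero set of a destination is an
  arbitrary measurable set. The sets with this property contain the rectangles and are closed under
  complements and countable disjoint unions. The threshold \<open>d\<close> depends on
  \<open>A\<close> and \<open>e\<close> but not on \<open>D\<close>.\<close>

lemma cut_small_imp_set_integral_small:
  assumes A: "A \<in> sets (M \<Otimes>\<^sub>M M)" and e: "0 < e"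
  shows "\<exists>d>0. \<forall>D. bfun (M \<Otimes>\<^sub>M M) 1 D \<longrightarrow>
    (\<forall>S\<in>sets M. \<forall>T\<in>sets M. \<bar>LINT p:S \<times> T|M \<Otimes>\<^sub>M M. D p\<bar> \<le> d) \<longrightarrow> \<bar>LINT p:A|M \<Otimes>\<^sub>M M. D p\<bar> \<le> e"
proof -
  interpret Q: prob_space "M \<Otimes>\<^sub>M M" by (rule prob_space_square)
  let ?\<Omega> = "space M \<times> space M" and ?G = "{S \<times> T | S T. S \<in> sets M \<and> T \<in> sets M}"
  \<comment> \<open>Quantified over all \<open>e\<close>, because the inductive steps use the
    hypotheses with \<open>e / 2\<close>.\<close>
  define small where "small A \<longleftrightarrow> (\<forall>e>0. \<exists>d>0. \<forall>D. bfun (M \<Otimes>\<^sub>M M) 1 D \<longrightarrow>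
    (\<forall>S\<in>sets M. \<forall>T\<in>sets M. \<bar>LINT p:S \<times> T|M \<Otimes>\<^sub>M M. D p\<bar> \<le> d) \<longrightarrow> \<bar>LINT p:A|M \<Otimes>\<^sub>M M. D p\<bar> \<le> e)" for A
  have si: "set_integrable (M \<Otimes>\<^sub>M M) A D" if "bfun (M \<Otimes>\<^sub>M M) 1 D" "A \<in> sets (M \<Otimes>\<^sub>M M)" for A D
    unfolding set_integrable_def using that by (intro integrable_mult_indicator Q.integrable_bfun)
  have smallD: "\<exists>d>0. \<forall>D. bfun (M \<Otimes>\<^sub>M M) 1 D \<longrightarrow>
    (\<forall>S\<in>sets M. \<forall>T\<in>sets M. \<bar>LINT p:S \<times> T|M \<Otimes>\<^sub>M M. D p\<bar> \<le> d) \<longrightarrow> \<bar>LINT p:A|M \<Otimes>\<^sub>M M. D p\<bar> \<le> e"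
    if "small A" "0 < e" for A e using that unfolding small_def by blast
  have rect: "small (S \<times> T)" if "S \<in> sets M" "T \<in> sets M" for S T
    unfolding small_def using that by blast
  have empty: "small {}" using rect[of "{}" "{}"] by simp
  have lin: "small C" if AB: "small A" "small B" and CAB: "\<And>D. bfun (M \<Otimes>\<^sub>M M) 1 D \<Longrightarrow>
      \<bar>LINT p:C|M \<Otimes>\<^sub>M M. D p\<bar> \<le> \<bar>LINT p:A|M \<Otimes>\<^sub>M M. D p\<bar> + \<bar>LINT p:B|M \<Otimes>\<^sub>M M. D p\<bar>" for A B C
    unfolding small_def
  proof (intro allI impI)
    fix e :: real assume e: "0 < e"
    obtain a where a: "0 < a" "\<forall>D. bfun (M \<Otimes>\<^sub>M M) 1 D \<longrightarrow>
       (\<forall>S\<in>sets M. \<forall>T\<in>sets M. \<bar>LINT p:S \<times> T|M \<Otimes>\<^sub>M M. D p\<bar> \<le> a) \<longrightarrow> \<bar>LINT p:A|M \<Otimes>\<^sub>M M. D p\<bar> \<le> e / 2"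
      using smallD[OF AB(1) half_gt_zero[OF e]] by blast
    obtain b where b: "0 < b" "\<forall>D. bfun (M \<Otimes>\<^sub>M M) 1 D \<longrightarrow>
       (\<forall>S\<in>sets M. \<forall>T\<in>sets M. \<bar>LINT p:S \<times> T|M \<Otimes>\<^sub>M M. D p\<bar> \<le> b) \<longrightarrow> \<bar>LINT p:B|M \<Otimes>\<^sub>M M. D p\<bar> \<le> e / 2"
      using smallD[OF AB(2) half_gt_zero[OF e]] by blast
    show "\<exists>d>0. \<forall>D. bfun (M \<Otimes>\<^sub>M M) 1 D \<longrightarrow>
      (\<forall>S\<in>sets M. \<forall>T\<in>sets M. \<bar>LINT p:S \<times> T|M \<Otimes>\<^sub>M M. D p\<bar> \<le> d) \<longrightarrow> \<bar>LINT p:C|M \<Otimes>\<^sub>M M. D p\<bar> \<le> e"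
    proof (intro exI[of _ "min a b"] conjI allI impI)
      fix D assume D: "bfun (M \<Otimes>\<^sub>M M) 1 D"
        "\<forall>S\<in>sets M. \<forall>T\<in>sets M. \<bar>LINT p:S \<times> T|M \<Otimes>\<^sub>M M. D p\<bar> \<le> min a b"
      then have "\<bar>LINT p:A|M \<Otimes>\<^sub>M M. D p\<bar> \<le> e / 2" "\<bar>LINT p:B|M \<Otimes>\<^sub>M M. D p\<bar> \<le> e / 2"
        using a(2) b(2) by (meson min.boundedE)+
      then show "\<bar>LINT p:C|M \<Otimes>\<^sub>M M. D p\<bar> \<le> e" using CAB[OF D(1)] by linarith
    qed (use a b in simp)
  qed
  have Un: "small (A \<union> B)" if "small A" "small B" "A \<inter> B = {}" "A \<in> sets (M \<Otimes>\<^sub>M M)" "B \<in> sets (M \<Otimes>\<^sub>M M)" for A B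
  proof (rule lin[OF that(1,2)])
    fix D assume D: "bfun (M \<Otimes>\<^sub>M M) 1 D"
    from set_integral_Un[OF that(3) si[OF D that(4)] si[OF D that(5)]]
    show "\<bar>LINT p:A \<union> B|M \<Otimes>\<^sub>M M. D p\<bar> \<le> \<bar>LINT p:A|M \<Otimes>\<^sub>M M. D p\<bar> + \<bar>LINT p:B|M \<Otimes>\<^sub>M M. D p\<bar>" by simp
  qed
  have sets_eq: "sets (M \<Otimes>\<^sub>M M) = sigma_sets ?\<Omega> ?G" by (rule sets_pair_measure)
  have "Int_stable ?G" by (rule Int_stable_pair_measure_generator)
  moreover have "?G \<subseteq> Pow ?\<Omega>" by (auto dest: sets.sets_into_space)
  moreover have "A \<in> sigma_sets ?\<Omega> ?G" using A by (simp add: sets_eq)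
  ultimately have "small A"
  proof (induction rule: sigma_sets_induct_disjoint)
    case (basic A)
    then show ?case using rect by auto
  next
    case empty
    show ?case by fact
  next
    case (compl A)
    have A: "A \<in> sets (M \<Otimes>\<^sub>M M)" using compl by (simp add: sets_eq)
    show ?case
    proof (rule lin[OF rect[OF sets.top sets.top] compl(2)])
      fix D assume D: "bfun (M \<Otimes>\<^sub>M M) 1 D"
      have sub: "A \<subseteq> ?\<Omega>" using sets.sets_into_space[OF A] by (simp add: space_pair_measure)
      then have "?\<Omega> = (?\<Omega> - A) \<union> A" by auto
      moreover have "(LINT p:(?\<Omega> - A) \<union> A|M \<Otimes>\<^sub>M M. D p) =
          (LINT p:?\<Omega> - A|M \<Otimes>\<^sub>M M. D p) + (LINT p:A|M \<Otimes>\<^sub>M M. D p)"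
        using A by (intro set_integral_Un si[OF D]) auto
      ultimately show "\<bar>LINT p:?\<Omega> - A|M \<Otimes>\<^sub>M M. D p\<bar>
          \<le> \<bar>LINT p:?\<Omega>|M \<Otimes>\<^sub>M M. D p\<bar> + \<bar>LINT p:A|M \<Otimes>\<^sub>M M. D p\<bar>" by simp
    qed
  next
    case (union A)
    have A: "A i \<in> sets (M \<Otimes>\<^sub>M M)" for i using union(2) by (auto simp: sets_eq)
    have fin: "small (\<Union>i<n. A i) \<and> (\<Union>i<n. A i) \<in> sets (M \<Otimes>\<^sub>M M)" for n
    proof (induction n)
      case 0
      show ?case using empty by simp
    next
      case (Suc n)
      have "A i \<inter> A n = {}" if "i < n" for i
        using disjoint_family_onD[OF union(1), of i n] that by simp
      then have "(\<Union>i<n. A i) \<inter> A n = {}" by blast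
      with Suc Un[of "\<Union>i<n. A i" "A n"] A union(3)
      have "small ((\<Union>i<n. A i) \<union> A n)" "(\<Union>i<n. A i) \<union> A n \<in> sets (M \<Otimes>\<^sub>M M)" by blast+
      moreover have "(\<Union>i<Suc n. A i) = (\<Union>i<n. A i) \<union> A n" by (auto simp: lessThan_Suc)
      ultimately show ?case by simp
    qed
    show "small (\<Union>i. A i)"
      unfolding small_def
    proof (intro allI impI)
      fix e :: real assume e: "0 < e"
      have "(\<lambda>n. measure (M \<Otimes>\<^sub>M M) (\<Union>i<n. A i)) \<longlonglongrightarrow> measure (M \<Otimes>\<^sub>M M) (\<Union>n. \<Union>i<n. A i)"
      proof (rule Q.finite_Lim_measure_incseq)
        show "incseq (\<lambda>n. \<Union>i<n. A i)" by (intro incseq_SucI UN_mono) auto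
      qed (use fin in auto)
      moreover have "(\<Union>n. \<Union>i<n. A i) = (\<Union>i. A i)" by auto
      ultimately have "\<forall>\<^sub>F n in sequentially. measure (M \<Otimes>\<^sub>M M) (\<Union>i. A i) - e / 2 < measure (M \<Otimes>\<^sub>M M) (\<Union>i<n. A i)"
        using e by (intro order_tendstoD(1)) auto
      then obtain n where n: "measure (M \<Otimes>\<^sub>M M) (\<Union>i. A i) - e / 2 < measure (M \<Otimes>\<^sub>M M) (\<Union>i<n. A i)"
        by (auto simp: eventually_sequentially)
      \<comment> \<open>Finitely many members exhaust the union up to measure \<open>e / 2\<close>.
        As \<open>D\<close> is bounded by \<open>1\<close>, the rest \<open>A2\<close> contributes
        at most its measure, whatever \<open>D\<close> is.\<close>
      define A1 A2 where "A1 = (\<Union>i<n. A i)" and "A2 = (\<Union>i. A i) - A1"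
      have s12: "A1 \<in> sets (M \<Otimes>\<^sub>M M)" "A2 \<in> sets (M \<Otimes>\<^sub>M M)" "A1 \<inter> A2 = {}" "(\<Union>i. A i) = A1 \<union> A2"
        using A fin unfolding A1_def A2_def by auto
      have m2: "measure (M \<Otimes>\<^sub>M M) A2 \<le> e / 2"
        using n Q.finite_measure_Union[OF s12(1,2,3)] s12(4) by (simp add: A1_def)
      obtain d where d: "0 < d" "\<forall>D. bfun (M \<Otimes>\<^sub>M M) 1 D \<longrightarrow>
          (\<forall>S\<in>sets M. \<forall>T\<in>sets M. \<bar>LINT p:S \<times> T|M \<Otimes>\<^sub>M M. D p\<bar> \<le> d) \<longrightarrow> \<bar>LINT p:A1|M \<Otimes>\<^sub>M M. D p\<bar> \<le> e / 2"
        using smallD[OF conjunct1[OF fin] half_gt_zero[OF e], of n] unfolding A1_def by blast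
      show "\<exists>d>0. \<forall>D. bfun (M \<Otimes>\<^sub>M M) 1 D \<longrightarrow>
        (\<forall>S\<in>sets M. \<forall>T\<in>sets M. \<bar>LINT p:S \<times> T|M \<Otimes>\<^sub>M M. D p\<bar> \<le> d) \<longrightarrow> \<bar>LINT p:(\<Union>i. A i)|M \<Otimes>\<^sub>M M. D p\<bar> \<le> e"
      proof (intro exI[of _ d] conjI allI impI d(1))
        fix D assume D: "bfun (M \<Otimes>\<^sub>M M) 1 D"
          "\<forall>S\<in>sets M. \<forall>T\<in>sets M. \<bar>LINT p:S \<times> T|M \<Otimes>\<^sub>M M. D p\<bar> \<le> d"
        have "\<bar>LINT p:A2|M \<Otimes>\<^sub>M M. D p\<bar> \<le> (LINT p|(M \<Otimes>\<^sub>M M). \<bar>indicator A2 p *\<^sub>R D p\<bar>)"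
          unfolding set_lebesgue_integral_def by (rule integral_abs_bound)
        also have "\<dots> \<le> (LINT p|(M \<Otimes>\<^sub>M M). indicator A2 p)"
        proof (rule integral_mono)
          show "integrable (M \<Otimes>\<^sub>M M) (\<lambda>p. \<bar>indicator A2 p *\<^sub>R D p\<bar>)"
            using si[OF D(1) s12(2)] unfolding set_integrable_def by (rule integrable_abs)
          show "integrable (M \<Otimes>\<^sub>M M) (indicator A2 :: _ \<Rightarrow> real)"
            by (rule Q.integrable_bfun[OF bfun_indicator[OF s12(2)]])
          show "\<bar>indicator A2 p *\<^sub>R D p\<bar> \<le> indicator A2 p" if "p \<in> space (M \<Otimes>\<^sub>M M)" for p
            using bfun_bound[OF D(1) that] by (auto simp: indicator_def)
        qed
        also have "\<dots> = measure (M \<Otimes>\<^sub>M M) A2" using s12(2) by simp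
        finally have "\<bar>LINT p:A2|M \<Otimes>\<^sub>M M. D p\<bar> \<le> e / 2" using m2 by simp
        moreover have "\<bar>LINT p:A1|M \<Otimes>\<^sub>M M. D p\<bar> \<le> e / 2" using d(2) D by blast
        ultimately show "\<bar>LINT p:(\<Union>i. A i)|M \<Otimes>\<^sub>M M. D p\<bar> \<le> e"
          unfolding s12(4) set_integral_Un[OF s12(3) si[OF D(1) s12(1)] si[OF D(1) s12(2)]] by linarith
      qed
    qed
  qed
  then show ?thesis using smallD e by blast
qed

end

section \<open>The epsilon-delta argument\<close>

context removal
begin

lemma dest_continuous_at:
  assumes X: "X \<in> graphons M" and e: "0 < e"
  shows "\<exists>d>0. \<forall>Y\<in>graphons M. cut_dist M X Y < d \<longrightarrow> cut_dist M (dest M k rule X) (dest M k rule Y) < e"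
proof -
  obtain v where v: "solution v" "X = kernel_class M (v 0)" using graphon_solution[OF X] by blast
  let ?N = "real (card arcs)" and ?V = "final v"
  let ?c = "kernel_class M"
  note V = unit_fun_final[OF v(1)] final_hom_free[OF v(1)]
  have N: "0 < ?N" using card_arcs_pos by simp
  obtain d1 where d1: "0 < d1" "\<And>D. bfun (M \<Otimes>\<^sub>M M) 1 D \<Longrightarrow>
     (\<And>S T. S \<in> sets M \<Longrightarrow> T \<in> sets M \<Longrightarrow> \<bar>LINT p:S \<times> T|M \<Otimes>\<^sub>M M. D p\<bar> \<le> d1) \<Longrightarrow>
       \<bar>LINT p:zero_set ?V|M \<Otimes>\<^sub>M M. D p\<bar> \<le> e / (4 * ?N)"
    using cut_small_imp_set_integral_small[OF zero_set_sets[OF V(1)], of "e / (4 * ?N)"] e N by auto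
  \<comment> \<open>The distance of \<open>w t\<close> to \<open>?V\<close> is a sum of two errors
    below \<open>r\<close> and must not exceed \<open>d1\<close>; the final estimate adds two errors
    below \<open>r\<close> and one of at most \<open>e / 4\<close>.\<close>
  define r where "r = min (d1 / 2) (e / 4)"
  have r: "0 < r" using d1 e by (simp add: r_def)
  have "\<forall>\<^sub>F t in at_top. 0 \<le> t \<and> cut_dist M (?c (v t)) (?c ?V) < r"
    using order_tendstoD(2)[OF cut_dist_final_tendsto[OF v(1)] r] eventually_ge_at_top[of 0]
    by eventually_elim simp
  then obtain t where t: "0 \<le> t" "cut_dist M (?c (v t)) (?c ?V) < r"
    by (auto simp: eventually_at_top_linorder)
  \<comment> \<open>The time \<open>t\<close>, and with it \<open>L\<close>, is fixed by
    \<open>X\<close> and \<open>e\<close> before any \<open>Y\<close> enters, so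
    \<open>r / L\<close> can serve as the radius.\<close>
  obtain L where L: "0 < L" "\<And>v w. solution v \<Longrightarrow> solution w \<Longrightarrow>
      cut_dist M (?c (v t)) (?c (w t)) \<le> L * cut_dist M (?c (v 0)) (?c (w 0))"
    using flow_cut_continuous[OF t(1)] by blast
  show ?thesis
  proof (intro exI[of _ "r / L"] conjI ballI impI)
    show "0 < r / L" using r L by simp
    fix Y assume Y: "Y \<in> graphons M" and XY: "cut_dist M X Y < r / L"
    obtain w where w: "solution w" "Y = ?c (w 0)" using graphon_solution[OF Y] by blast
    note u = solutionD(1)[OF w(1) t(1)]
    note k = class_unit_fun(1)[OF u] class_unit_fun(1)[OF solutionD(1)[OF v(1) t(1)]]
      class_unit_fun(1)[OF V(1)] class_unit_fun(1)[OF unit_fun_final[OF w(1)]]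
    have vw: "cut_dist M (?c (v t)) (?c (w t)) < r"
    proof -
      have "cut_dist M (?c (v t)) (?c (w t)) \<le> L * cut_dist M X Y" using L(2)[OF v(1) w(1)] v w by simp
      also have "\<dots> < r" using XY L(1) by (simp add: pos_less_divide_eq mult.commute)
      finally show ?thesis .
    qed
    have "cut_dist M (?c (w t)) (?c ?V) \<le> cut_dist M (?c (w t)) (?c (v t)) + cut_dist M (?c (v t)) (?c ?V)"
      by (rule cut_dist_triangle[OF k(1,2,3)])
    also have "\<dots> \<le> d1" using vw t(2) by (simp add: cut_dist_commute[of "?c (w t)"] r_def)
    finally have wV: "cut_dist M (?c (w t)) (?c ?V) \<le> d1" .
    have bD: "bfun (M \<Otimes>\<^sub>M M) 1 (\<lambda>p. w t p - ?V p)"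
    proof -
      have "\<bar>w t p - ?V p\<bar> \<le> 1" if "p \<in> space (M \<Otimes>\<^sub>M M)" for p
        using unit_funD(4,5)[OF u that] unit_funD(4,5)[OF V(1) that] by linarith
      then show ?thesis using unit_funD(3)[OF u] unit_funD(3)[OF V(1)] by (simp add: bfun_def)
    qed
    have "\<bar>LINT p:zero_set ?V|M \<Otimes>\<^sub>M M. (w t p - ?V p)\<bar> \<le> e / (4 * ?N)"
    proof (rule d1(2)[OF bD])
      fix S T assume ST: "S \<in> sets M" "T \<in> sets M"
      then have "(LINT p:S \<times> T|M \<Otimes>\<^sub>M M. (w t p - ?V p)) =
          (LINT p:S \<times> T|M \<Otimes>\<^sub>M M. (rep (?c (w t)) p - rep (?c ?V) p))"
        by (intro set_integral_class_diff[OF u V(1), symmetric]) auto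
      then show "\<bar>LINT p:S \<times> T|M \<Otimes>\<^sub>M M. (w t p - ?V p)\<bar> \<le> d1"
        using cut_dist_upper[OF k(1,3) ST] wV by simp
    qed
    \<comment> \<open>\<open>?V\<close> vanishes on its own zero set, so testing the difference
      there measures the mass of \<open>w t\<close>; cut closeness thus becomes an
      \<open>L^1\<close> statement on this set.\<close>
    moreover have "(LINT p:zero_set ?V|M \<Otimes>\<^sub>M M. (w t p - ?V p)) = (LINT p:zero_set ?V|M \<Otimes>\<^sub>M M. w t p)"
      unfolding set_lebesgue_integral_def
      by (rule Bochner_Integration.integral_cong) (auto simp: zero_set_def indicator_def)
    ultimately have "(LINT p:zero_set ?V|M \<Otimes>\<^sub>M M. w t p) \<le> e / (4 * ?N)" by simp
    then have "?N * (LINT p:zero_set ?V|M \<Otimes>\<^sub>M M. w t p) \<le> e / 4" using N by (simp add: field_simps)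
    then have wf: "cut_dist M (?c (w t)) (?c (final w)) \<le> e / 4"
      using cut_dist_final_le[OF V w(1) t(1)] by linarith
    have "cut_dist M (?c ?V) (?c (final w)) \<le> cut_dist M (?c ?V) (?c (v t)) +
        (cut_dist M (?c (v t)) (?c (w t)) + cut_dist M (?c (w t)) (?c (final w)))"
      using cut_dist_triangle[OF k(3,2,4)] cut_dist_triangle[OF k(2,1,4)] by linarith
    also have "\<dots> < e"
      using t(2) vw wf e by (simp add: cut_dist_commute[of "?c ?V"] r_def)
    finally show "cut_dist M (dest M k rule X) (dest M k rule Y) < e"
      by (simp add: dest_eq[OF v] dest_eq[OF w])
  qed
qed

lemma dest_in_graphons: "X \<in> graphons M \<Longrightarrow> dest M k rule X \<in> graphons M"
  using graphon_solution[of X] dest_eq class_unit_fun(3)[OF unit_fun_final] by metis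

end

theorem theorem10p7:
  fixes M :: "'a measure" and k :: nat and F :: graph
  assumes "prob_space M" and "atomless M" and "separable_sigma_algebra M"
    and "F \<in> graphs k" and "card F > 0"
  shows "continuous_map (cut_topology M) (cut_topology M) (dest M k (removal_rule F))"
proof -
  interpret prob_space M by fact
  interpret removal M k F using assms by unfold_locales
  interpret G: Metric_space "graphons M" "graphon_dist M" by (rule Metric_space_graphons)
  show ?thesis
    unfolding cut_topology_def G.metric_continuous_map[OF Metric_space_graphons]
  proof (intro conjI ballI allI impI)
    show "dest M k (removal_rule F) ` graphons M \<subseteq> graphons M" using dest_in_graphons by auto
    fix X and e :: real assume X: "X \<in> graphons M" and e: "0 < e"
    obtain d where d: "0 < d" "\<forall>Y\<in>graphons M. cut_dist M X Y < d \<longrightarrow>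
        cut_dist M (dest M k (removal_rule F) X) (dest M k (removal_rule F) Y) < e"
      using dest_continuous_at[OF X e] by blast
    then show "\<exists>d>0. \<forall>Y. Y \<in> graphons M \<and> graphon_dist M X Y < d \<longrightarrow>
        graphon_dist M (dest M k (removal_rule F) X) (dest M k (removal_rule F) Y) < e"
      using X dest_in_graphons by (intro exI[of _ d]) (auto simp: graphon_dist_def)
  qed
qed

end
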